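(* Let $K$ be an algebraically closed field, let $n\ge 2$ and $m\ge 1$ be integers, and let $A,B\in (K^{n\times n})^m$. Assume that the $R$-module $V_A$ or the $R$-module $V_B$ has Jordan--Hölder composition length at most $2$. Then $A\le_{\mathrm{deg}}B$ if and only if $A\le_{\mathrm{hom}}B$.
   Context: $R=K\langle x_1,\dots,x_m\rangle$ is the free associative unital $K$-algebra. For $A\in (K^{n\times n})^m$, $V_A$ is the $R$-module $K^n$ with $f\cdot v:=f(A_1,\dots,A_m)v$ for $f\in R$, $v\in K^n$. $\mathrm{GL}_n(K)$ acts on $(K^{n\times n})^m$ by simultaneous conjugation: $g\cdot(A_1,\dots,A_m)=(gA_1g^{-1},\dots,gA_mg^{-1})$; $\mathcal{O}(A)$ is the orbit of $A$, $\overline{\mathcal{O}(A)}$ its Zariski closure. $A\le_{\mathrm{deg}}B$ means $B\in\overline{\mathcal{O}(A)}$. For a matrix $\varphi=(\varphi_{ij})\in R^{k\times l}$ let $\varphi(A)$ be the $kn\times ln$ matrix over $K$ whose $(i,j)$ block of size $n\times n$ is $\varphi_{ij}(A_1,\dots,A_m)$. $A\le_{\mathrm{hom}}B$ means $\mathrm{rk}\,\varphi(A)\ge\mathrm{rk}\,\varphi(B)$ for all $k,l\ge1$ and all $\varphi\in R^{k\times l}$. *)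

theory Defs
  imports
    "HOL-Library.Poly_Mapping"
    "HOL-Library.Extended_Nat"
    "HOL-Algebra.Module"
    "HOL-Computational_Algebra.Polynomial"
    "Jordan_Normal_Form.DL_Rank"
begin

section \<open>The free associative algebra\<close>

text \<open>
  Words form the free monoid. It is written additively because \<^typ>\<open>'b \<Rightarrow>\<^sub>0 'a\<close> carries the
  convolution product of the monoid algebra of an additive monoid, which need not be commutative.
\<close>

datatype free_word = Word (letters: "nat list")

instantiation free_word :: monoid_add
begin

definition zero_free_word :: free_word where
  "0 = Word []"

definition plus_free_word :: "free_word \<Rightarrow> free_word \<Rightarrow> free_word" where
  "u + v = Word (letters u @ letters v)"

instance
  by standard (simp_all add: zero_free_word_def plus_free_word_def)

end

type_synonym 'a nc_poly = "free_word \<Rightarrow>\<^sub>0 'a"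

text \<open>The generators are indexed by \<open>0, \<dots>, m - 1\<close>.\<close>

definition free_algebra :: "nat \<Rightarrow> 'a::comm_ring_1 nc_poly ring" where
  "free_algebra m =
    \<lparr>carrier = {f. \<forall>w \<in> Poly_Mapping.keys f. set (letters w) \<subseteq> {..<m}},
     mult = (*), one = 1, zero = 0, add = (+)\<rparr>"


section \<open>Tuples of matrices and evaluation\<close>

definition mat_tuples :: "nat \<Rightarrow> nat \<Rightarrow> 'a mat list set" where
  "mat_tuples n m = {A. length A = m \<and> set A \<subseteq> carrier_mat n n}"

definition word_eval :: "nat \<Rightarrow> 'a::comm_ring_1 mat list \<Rightarrow> free_word \<Rightarrow> 'a mat" where
  "word_eval n A w = foldr (\<lambda>t X. A ! t * X) (letters w) (1\<^sub>m n)"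

definition nc_eval :: "nat \<Rightarrow> 'a::comm_ring_1 mat list \<Rightarrow> 'a nc_poly \<Rightarrow> 'a mat" where
  "nc_eval n A f = mat n n (\<lambda>(i, j).
     \<Sum>w \<in> Poly_Mapping.keys f. Poly_Mapping.lookup f w * word_eval n A w $$ (i, j))"

definition block_eval ::
  "nat \<Rightarrow> 'a::comm_ring_1 mat list \<Rightarrow> 'a nc_poly mat \<Rightarrow> 'a mat" where
  "block_eval n A \<phi> = mat (dim_row \<phi> * n) (dim_col \<phi> * n) (\<lambda>(i, j).
     nc_eval n A (\<phi> $$ (i div n, j div n)) $$ (i mod n, j mod n))"


section \<open>Modules and composition length\<close>

text \<open>
  The locale \<^locale>\<open>module\<close> of the library requires a commutative ring of scalars, so only the
  record type is used here; the fields \<open>mult\<close> and \<open>one\<close> have no meaning for a module.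
  The predicate \<^const>\<open>Module.submodule\<close> makes no commutativity assumption.
\<close>

definition rep_module :: "nat \<Rightarrow> 'a::comm_ring_1 mat list \<Rightarrow> ('a nc_poly, 'a vec) module" where
  "rep_module n A =
    \<lparr>carrier = carrier_vec n, mult = undefined, one = undefined, zero = 0\<^sub>v n, add = (+),
     smult = (\<lambda>f v. nc_eval n A f *\<^sub>v v)\<rparr>"

text \<open>
  A quotient of two consecutive members of a chain of submodules is simple iff the inclusion is
  strict and no submodule lies strictly in between.
\<close>

definition composition_series ::
  "('r, 'c) ring_scheme \<Rightarrow> ('r, 'v, 'd) module_scheme \<Rightarrow> 'v set list \<Rightarrow> bool" where
  "composition_series R M Hs \<longleftrightarrow>
     Hs \<noteq> [] \<and> hd Hs = {\<zero>\<^bsub>M\<^esub>} \<and> last Hs = carrier M \<and>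
     (\<forall>H \<in> set Hs. Module.submodule H R M) \<and>
     (\<forall>i. Suc i < length Hs \<longrightarrow> Hs ! i \<subset> Hs ! Suc i \<and>
        \<not> (\<exists>H. Module.submodule H R M \<and> Hs ! i \<subset> H \<and> H \<subset> Hs ! Suc i))"

text \<open>
  All composition series of a module have the same length (Jordan--Hoelder), so the infimum is just
  that common length; it is \<^term>\<open>\<infinity> :: enat\<close> if there is no composition series.
\<close>

definition composition_length ::
  "('r, 'c) ring_scheme \<Rightarrow> ('r, 'v, 'd) module_scheme \<Rightarrow> enat" where
  "composition_length R M = (INF Hs \<in> {Hs. composition_series R M Hs}. enat (length Hs - 1))"


section \<open>Degeneration order\<close>

definition conj_orbit :: "nat \<Rightarrow> 'a::comm_ring_1 mat list \<Rightarrow> 'a mat list set" where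
  "conj_orbit n A = {map (\<lambda>X. g * X * h) A | g h.
     g \<in> carrier_mat n n \<and> h \<in> carrier_mat n n \<and> inverts_mat g h \<and> inverts_mat h g}"

text \<open>
  Commutative polynomials in the coordinates of the affine space of matrix tuples: the variable
  \<open>(t, i, j)\<close> is the \<open>(i, j)\<close> entry of the \<open>t\<close>-th matrix.
\<close>

type_synonym 'a entry_poly = "((nat \<times> nat \<times> nat) \<Rightarrow>\<^sub>0 nat) \<Rightarrow>\<^sub>0 'a"

definition entry_polys :: "nat \<Rightarrow> nat \<Rightarrow> 'a::comm_ring_1 entry_poly set" where
  "entry_polys n m = {p. \<forall>c \<in> Poly_Mapping.keys p.
     Poly_Mapping.keys c \<subseteq> {..<m} \<times> {..<n} \<times> {..<n}}"

definition entry_poly_eval :: "'a::comm_ring_1 mat list \<Rightarrow> 'a entry_poly \<Rightarrow> 'a" where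
  "entry_poly_eval A p = (\<Sum>c \<in> Poly_Mapping.keys p. Poly_Mapping.lookup p c *
     (\<Prod>(t, i, j) \<in> Poly_Mapping.keys c. (A ! t $$ (i, j)) ^ Poly_Mapping.lookup c (t, i, j)))"

definition zariski_closed :: "nat \<Rightarrow> nat \<Rightarrow> 'a::comm_ring_1 mat list set \<Rightarrow> bool" where
  "zariski_closed n m Z \<longleftrightarrow>
     (\<exists>P \<subseteq> entry_polys n m. Z = {A \<in> mat_tuples n m. \<forall>p \<in> P. entry_poly_eval A p = 0})"

definition deg_le :: "nat \<Rightarrow> nat \<Rightarrow> 'a::comm_ring_1 mat list \<Rightarrow> 'a mat list \<Rightarrow> bool" where
  "deg_le n m A B \<longleftrightarrow> B \<in> zariski_closed n m hull conj_orbit n A"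


section \<open>Hom order\<close>

definition hom_le :: "nat \<Rightarrow> nat \<Rightarrow> 'a::field mat list \<Rightarrow> 'a mat list \<Rightarrow> bool" where
  "hom_le n m A B \<longleftrightarrow>
     (\<forall>k \<ge> 1. \<forall>l \<ge> 1. \<forall>\<phi> \<in> carrier_mat k l.
        elements_mat \<phi> \<subseteq> carrier (free_algebra m) \<longrightarrow>
        vec_space.rank (k * n) (block_eval n A \<phi>) \<ge> vec_space.rank (k * n) (block_eval n B \<phi>))"

end

theory Submission
  imports Defs "Jordan_Normal_Form.Char_Poly"
begin

text \<open>
  That degeneration implies the hom order is semicontinuity of rank: \<open>rk \<phi>(X) \<le> r\<close> is a Zariski closed
  condition on \<open>X\<close>, given by determinants that are polynomials in the entries of \<open>X\<close>, and \<open>\<phi>(X)\<close> has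
  constant rank on an orbit (\<open>deg_le_imp_hom_le\<close>).

  For the converse the hom order is used only through one consequence (\<open>hom_le_imp_dominated\<close>).
  The intertwiners from a representation \<open>C\<close> to \<open>A\<close> are the kernel of \<open>\<phi>(A)\<close> for a matrix \<open>\<phi>\<close> that
  depends only on \<open>C\<close>. So \<open>A \<le> B\<close> in the hom order gives \<open>dim Hom(C, A) \<le> dim Hom(C, B)\<close> for every \<open>C\<close>.

  If \<open>A\<close> or \<open>B\<close> is simple, then \<open>Hom(A, B) \<noteq> 0\<close>, and a nonzero map is invertible because both
  spaces have dimension \<open>n\<close>.

  Let \<open>A\<close> be an extension of a simple \<open>D\<close> by a simple \<open>C\<close>. The inequality for the sources \<open>C\<close>, \<open>D\<close>
  and \<open>A\<close> leaves two possibilities (\<open>length_two_dichotomy\<close>). Either \<open>A\<close> and \<open>B\<close> are isomorphic, and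
  \<open>B\<close> lies in the orbit of \<open>A\<close>. Or \<open>B\<close> is the direct sum of \<open>C\<close> and \<open>D\<close>, and then \<open>A\<close> degenerates to
  \<open>B\<close> by scaling the extension to zero (\<open>deg_le_of_direct_sum\<close>).

  If instead \<open>B\<close> is an extension of two simple representations, then \<open>A\<close> is one as well
  (\<open>length_two_inherited\<close>), which brings back the previous case. Otherwise \<open>Hom(A, B)\<close> would embed into
  the endomorphisms of \<open>A\<close> that have their image in a simple subrepresentation. These do not contain
  the identity, so \<open>dim End(A)\<close> would exceed \<open>dim Hom(A, B)\<close>.

  Everything is phrased with matrices of varying sizes: a subspace is given by a left invertible
  matrix, a quotient by a right invertible one, and a short exact sequence by a decomposition of the
  identity.
\<close>

section \<open>One-sided inverses, complements and rank factorisations\<close>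

lemma mult_assoc_dim:
  "dim_col A = dim_row B \<Longrightarrow> dim_col B = dim_row C \<Longrightarrow> (A * B) * C = A * (B * C :: 'a::comm_ring_1 mat)"
  by (rule assoc_mult_mat[of A "dim_row A" "dim_col A" B "dim_col B" C "dim_col C"]) auto

lemma add_mult_dim:
  "dim_row A = dim_row B \<Longrightarrow> dim_col A = dim_col B \<Longrightarrow> dim_col B = dim_row C \<Longrightarrow>
   (A + B) * C = A * C + (B * C :: 'a::comm_ring_1 mat)"
  by (rule add_mult_distrib_mat[of A "dim_row A" "dim_col A" B C "dim_col C"]) auto

lemma mult_add_dim:
  "dim_row B = dim_row C \<Longrightarrow> dim_col B = dim_col C \<Longrightarrow> dim_col A = dim_row B \<Longrightarrow>
   A * (B + C) = A * B + (A * C :: 'a::comm_ring_1 mat)"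
  by (rule mult_add_distrib_mat[of A "dim_row A" "dim_col A" B "dim_col B" C]) auto

lemma minus_mult_dim:
  "dim_row A = dim_row B \<Longrightarrow> dim_col A = dim_col B \<Longrightarrow> dim_col B = dim_row C \<Longrightarrow>
   (A - B) * C = A * C - (B * C :: 'a::comm_ring_1 mat)"
  by (rule minus_mult_distrib_mat[of A "dim_row A" "dim_col A" B C "dim_col C"]) auto

lemma mult_minus_dim:
  "dim_row B = dim_row C \<Longrightarrow> dim_col B = dim_col C \<Longrightarrow> dim_col A = dim_row B \<Longrightarrow>
   A * (B - C) = A * B - (A * C :: 'a::comm_ring_1 mat)"
  by (rule mult_minus_distrib_mat[of A "dim_row A" "dim_col A" B "dim_col B" C]) auto

lemma smult_mult_dim:
  "dim_col A = dim_row B \<Longrightarrow> (a \<cdot>\<^sub>m A) * B = a \<cdot>\<^sub>m (A * B :: 'a::comm_ring_1 mat)"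
  by (rule mult_smult_assoc_mat[of A "dim_row A" "dim_col A" B "dim_col B"]) auto

lemma mult_smult_dim:
  "dim_col A = dim_row B \<Longrightarrow> A * (a \<cdot>\<^sub>m B) = a \<cdot>\<^sub>m (A * B :: 'a::comm_ring_1 mat)"
  by (rule mult_smult_distrib[of A "dim_row A" "dim_col A" B "dim_col B"]) auto

lemma add_zero_dim:
  "dim_row A = n \<Longrightarrow> dim_col A = k \<Longrightarrow> A + 0\<^sub>m n k = (A :: 'a::comm_ring_1 mat)"
  "dim_row A = n \<Longrightarrow> dim_col A = k \<Longrightarrow> 0\<^sub>m n k + A = (A :: 'a::comm_ring_1 mat)"
  by (auto intro: eq_matI)

text \<open>
  These forms of the ring laws have no variables that occur only in their side conditions, so the
  simplifier can discharge the dimension conditions by itself.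
\<close>

lemmas mat_ring = mult_assoc_dim add_mult_dim mult_add_dim minus_mult_dim mult_minus_dim
  smult_mult_dim mult_smult_dim add_zero_dim

lemma mult_absorb:
  assumes "A * B = (C :: 'a::comm_ring_1 mat)" "dim_col A = dim_row B" "dim_row X = dim_col B"
  shows "A * (B * X) = C * X"
  using assms mult_assoc_dim[of A B X] by simp

lemma index_mult_sum:
  "i < dim_row A \<Longrightarrow> j < dim_col B \<Longrightarrow> dim_col A = dim_row B \<Longrightarrow>
   (A * B) $$ (i, j) = (\<Sum>k<dim_row B. A $$ (i, k) * B $$ (k, j))"
  by (simp add: scalar_prod_def atLeast0LessThan)

lemma index_mult_vec_sum:
  "i < dim_row A \<Longrightarrow> dim_col A = dim_vec v \<Longrightarrow>
   (A *\<^sub>v v) $ i = (\<Sum>k<dim_vec v. A $$ (i, k) * v $ k)"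
  by (simp add: scalar_prod_def atLeast0LessThan)

lemma mult_mat_zero_vec: "A \<in> carrier_mat n k \<Longrightarrow> A *\<^sub>v 0\<^sub>v k = 0\<^sub>v n"
  by (rule eq_vecI) auto

text \<open>
  If \<open>n < c\<close>, zero rows and columns make both matrices square without changing the product \<open>L P\<close>.
  Then they are two-sided inverses, but one of them has a zero row.
\<close>

lemma left_invertible_le:
  fixes P :: "'a::field mat"
  assumes P: "P \<in> carrier_mat n c" and L: "L \<in> carrier_mat c n" and LP: "L * P = 1\<^sub>m c"
  shows "c \<le> n"
proof (rule ccontr)
  assume nc: "\<not> c \<le> n"
  define P' where "P' = mat c c (\<lambda>(i, j). if i < n then P $$ (i, j) else 0)"
  define L' where "L' = mat c c (\<lambda>(i, j). if j < n then L $$ (i, j) else 0)"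
  have C: "P' \<in> carrier_mat c c" "L' \<in> carrier_mat c c" by (auto simp: P'_def L'_def)
  have "L' * P' = L * P"
  proof (rule eq_matI)
    fix i j assume "i < dim_row (L * P)" "j < dim_col (L * P)"
    then have ij: "i < c" "j < c" using L P by auto
    have "(L' * P') $$ (i, j) = (\<Sum>k<c. L' $$ (i, k) * P' $$ (k, j))"
      using ij C by (subst index_mult_sum) auto
    also have "\<dots> = (\<Sum>k<c. if k < n then L $$ (i, k) * P $$ (k, j) else 0)"
      using ij by (intro sum.cong) (auto simp: P'_def L'_def)
    also have "\<dots> = (\<Sum>k<n. L $$ (i, k) * P $$ (k, j))"
      using nc by (intro sum.mono_neutral_cong_right) auto
    also have "\<dots> = (L * P) $$ (i, j)"
      using ij L P by (subst index_mult_sum) auto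
    finally show "(L' * P') $$ (i, j) = (L * P) $$ (i, j)" .
  qed (use C L P in auto)
  then have "P' * L' = 1\<^sub>m c"
    using mat_mult_left_right_inverse[OF C(2,1)] LP by simp
  then have "(P' * L') $$ (n, n) = 1" using nc by simp
  moreover have "(P' * L') $$ (n, n) = 0"
    using nc C by (subst index_mult_sum) (auto simp: P'_def)
  ultimately show False by simp
qed

text \<open>
  The column space of \<open>P\<close> consists of the \<open>v\<close> with \<open>P L v = v\<close>. For any other \<open>v\<close> the difference
  \<open>w = v - P L v\<close> is a nonzero vector in the kernel of \<open>L\<close> and serves as an additional column.
\<close>

lemma left_inverse_extend:
  fixes P :: "'a::field mat"
  assumes P: "P \<in> carrier_mat n c" and L: "L \<in> carrier_mat c n" and LP: "L * P = 1\<^sub>m c"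
    and v: "v \<in> carrier_vec n" and ne: "P *\<^sub>v (L *\<^sub>v v) \<noteq> v"
  shows "\<exists>P' L'. P' \<in> carrier_mat n (Suc c) \<and> L' \<in> carrier_mat (Suc c) n \<and> L' * P' = 1\<^sub>m (Suc c) \<and>
     (\<forall>u \<in> carrier_vec (Suc c). \<exists>u' \<in> carrier_vec c. \<exists>a. P' *\<^sub>v u = P *\<^sub>v u' + a \<cdot>\<^sub>v v)"
proof -
  define w where "w = v - P *\<^sub>v (L *\<^sub>v v)"
  have w: "w \<in> carrier_vec n" using v P L by (auto simp: w_def)
  have LPv: "L *\<^sub>v (P *\<^sub>v (L *\<^sub>v v)) = L *\<^sub>v v"
    using L P v LP by (metis assoc_mult_mat_vec mult_mat_vec_carrier one_mult_mat_vec)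
  have Lw: "L *\<^sub>v w = 0\<^sub>v c"
    unfolding w_def using v P L by (subst mult_minus_distrib_mat_vec) (auto simp: LPv)
  have "\<exists>i<n. w $ i \<noteq> 0"
  proof (rule ccontr)
    assume "\<not> (\<exists>i<n. w $ i \<noteq> 0)"
    then have "v = P *\<^sub>v (L *\<^sub>v v)"
      using v P L by (intro eq_vecI) (auto simp: w_def)
    then show False using ne by simp
  qed
  then obtain i0 where i0: "i0 < n" "w $ i0 \<noteq> 0" by blast
  \<comment> \<open>The row \<open>r\<close> kills the columns of \<open>P\<close> and takes the value \<open>1\<close> at \<open>w\<close>.\<close>
  define r where "r j = ((if i0 = j then 1 else 0) - (P * L) $$ (i0, j)) / w $ i0" for j
  have PLP: "P * L * P = P" using P L LP by (simp add: mat_ring)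
  have rP: "(\<Sum>k<n. r k * P $$ (k, j)) = 0" if "j < c" for j
  proof -
    have "(\<Sum>k<n. r k * P $$ (k, j)) =
       (\<Sum>k<n. ((if i0 = k then P $$ (k, j) else 0) - (P * L) $$ (i0, k) * P $$ (k, j))) / w $ i0"
      unfolding sum_divide_distrib r_def by (intro sum.cong) (auto simp: field_simps)
    also have "\<dots> = (P $$ (i0, j) - (P * L * P) $$ (i0, j)) / w $ i0"
      using i0 that P L by (subst index_mult_sum[of _ "P * L"]) (auto simp: sum_subtractf)
    finally show ?thesis by (simp add: PLP)
  qed
  have rw: "(\<Sum>k<n. r k * w $ k) = 1"
  proof -
    have "(\<Sum>k<n. r k * w $ k) =
       (\<Sum>k<n. ((if i0 = k then w $ k else 0) - (P * L) $$ (i0, k) * w $ k)) / w $ i0"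
      unfolding sum_divide_distrib r_def by (intro sum.cong) (auto simp: field_simps)
    also have "\<dots> = (w $ i0 - ((P * L) *\<^sub>v w) $ i0) / w $ i0"
      using i0 w P L by (subst index_mult_vec_sum) (auto simp: sum_subtractf)
    also have "(P * L) *\<^sub>v w = 0\<^sub>v n" using P L w Lw by (simp add: assoc_mult_mat_vec[of _ n c _ n] mult_mat_zero_vec)
    finally show ?thesis using i0 by simp
  qed
  define P' where "P' = mat n (Suc c) (\<lambda>(i, j). if j < c then P $$ (i, j) else w $ i)"
  define L' where "L' = mat (Suc c) n (\<lambda>(i, j). if i < c then L $$ (i, j) else r j)"
  have C: "P' \<in> carrier_mat n (Suc c)" "L' \<in> carrier_mat (Suc c) n" by (auto simp: P'_def L'_def)
  have Lw': "(\<Sum>k<n. L $$ (i, k) * w $ k) = 0" if "i < c" for i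
    using arg_cong[OF Lw, of "\<lambda>x. x $ i"] that L w by (subst (asm) index_mult_vec_sum) auto
  have LP': "(\<Sum>k<n. L $$ (i, k) * P $$ (k, j)) = (if i = j then 1 else 0)" if "i < c" "j < c" for i j
    using arg_cong[OF LP, of "\<lambda>x. x $$ (i, j)"] that L P by (subst (asm) index_mult_sum) auto
  have "L' * P' = 1\<^sub>m (Suc c)"
  proof (rule eq_matI)
    fix i j assume "i < dim_row (1\<^sub>m (Suc c) :: 'a mat)" "j < dim_col (1\<^sub>m (Suc c) :: 'a mat)"
    then have ij: "i < Suc c" "j < Suc c" by auto
    have "(L' * P') $$ (i, j) = (\<Sum>k<n. L' $$ (i, k) * P' $$ (k, j))"
      using ij C by (subst index_mult_sum) auto
    also have "\<dots> = (\<Sum>k<n. (if i < c then L $$ (i, k) else r k) * (if j < c then P $$ (k, j) else w $ k))"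
      using ij by (intro sum.cong) (auto simp: P'_def L'_def)
    also have "\<dots> = (if i = j then 1 else 0)"
      using ij by (cases "i < c"; cases "j < c") (auto simp: LP' Lw' rP rw)
    finally show "(L' * P') $$ (i, j) = 1\<^sub>m (Suc c) $$ (i, j)" using ij by simp
  qed (use C in auto)
  moreover have "\<exists>u' \<in> carrier_vec c. \<exists>a. P' *\<^sub>v u = P *\<^sub>v u' + a \<cdot>\<^sub>v v" if u: "u \<in> carrier_vec (Suc c)" for u
  proof (intro bexI exI)
    let ?u = "vec c (\<lambda>i. u $ i)"
    let ?u' = "?u - u $ c \<cdot>\<^sub>v (L *\<^sub>v v)"
    show "?u' \<in> carrier_vec c" using L v by auto
    have "P' *\<^sub>v u = P *\<^sub>v ?u + u $ c \<cdot>\<^sub>v w"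
    proof (rule eq_vecI)
      fix i assume "i < dim_vec (P *\<^sub>v ?u + u $ c \<cdot>\<^sub>v w)"
      then have i: "i < n" using w by auto
      have "(P' *\<^sub>v u) $ i = (\<Sum>k<Suc c. P' $$ (i, k) * u $ k)"
        using i C u by (subst index_mult_vec_sum) auto
      also have "\<dots> = (\<Sum>k<c. P $$ (i, k) * ?u $ k) + w $ i * u $ c"
        using i by (simp add: P'_def)
      also have "(\<Sum>k<c. P $$ (i, k) * ?u $ k) = (P *\<^sub>v ?u) $ i"
        using i P by (subst index_mult_vec_sum) auto
      finally show "(P' *\<^sub>v u) $ i = (P *\<^sub>v ?u + u $ c \<cdot>\<^sub>v w) $ i"
        using i P w by (simp add: mult.commute)
    qed (use C w in auto)
    also have "\<dots> = P *\<^sub>v ?u' + u $ c \<cdot>\<^sub>v v"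
    proof -
      have "P *\<^sub>v ?u' = P *\<^sub>v ?u - u $ c \<cdot>\<^sub>v (P *\<^sub>v (L *\<^sub>v v))"
        using P L v by (subst mult_minus_distrib_mat_vec[of _ n c]) (auto simp: mult_mat_vec[of _ n c])
      then show ?thesis using P L v by (intro eq_vecI) (auto simp: w_def algebra_simps)
    qed
    finally show "P' *\<^sub>v u = P *\<^sub>v ?u' + u $ c \<cdot>\<^sub>v v" .
  qed
  ultimately show ?thesis using C by blast
qed

text \<open>
  Among the left invertible matrices with column space inside the given subspace, one with the
  largest number of columns spans it, since otherwise a column could be added.
\<close>

lemma subspace_eq_range:
  fixes H :: "'a::field vec set"
  assumes H: "H \<subseteq> carrier_vec n" and zero: "0\<^sub>v n \<in> H"
    and add: "\<And>x y. x \<in> H \<Longrightarrow> y \<in> H \<Longrightarrow> x + y \<in> H"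
    and smult: "\<And>a x. x \<in> H \<Longrightarrow> a \<cdot>\<^sub>v x \<in> H"
  shows "\<exists>c P L. P \<in> carrier_mat n c \<and> L \<in> carrier_mat c n \<and> L * P = 1\<^sub>m c \<and>
     H = (\<lambda>u. P *\<^sub>v u) ` carrier_vec c"
proof -
  define good where "good c P L \<longleftrightarrow> P \<in> carrier_mat n c \<and> L \<in> carrier_mat c n \<and> L * P = 1\<^sub>m c \<and>
     (\<forall>u \<in> carrier_vec c. P *\<^sub>v u \<in> H)" for c P L
  have "0\<^sub>m n 0 *\<^sub>v u = (0\<^sub>v n :: 'a vec)" if "u \<in> carrier_vec 0" for u
    using that by (intro eq_vecI) (auto simp: scalar_prod_def)
  then have "good 0 (0\<^sub>m n 0) (0\<^sub>m 0 n)" using zero by (auto simp: good_def)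
  moreover have "c \<le> n" if "\<exists>P L. good c P L" for c
    using that left_invertible_le unfolding good_def by blast
  ultimately have "\<exists>c. (\<exists>P L. good c P L) \<and> (\<forall>c'. (\<exists>P L. good c' P L) \<longrightarrow> c' \<le> c)"
    using GreatestI_nat[of "\<lambda>c. \<exists>P L. good c P L" 0 n] Greatest_le_nat[of "\<lambda>c. \<exists>P L. good c P L" _ n]
    by (intro exI[of _ "GREATEST c. \<exists>P L. good c P L"]) auto
  then obtain c P L where g: "good c P L" and mx: "\<And>c' P L. good c' P L \<Longrightarrow> c' \<le> c" by blast
  have PL: "P \<in> carrier_mat n c" "L \<in> carrier_mat c n" "L * P = 1\<^sub>m c"
    and PH: "\<And>u. u \<in> carrier_vec c \<Longrightarrow> P *\<^sub>v u \<in> H" using g by (auto simp: good_def)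
  have "v \<in> (\<lambda>u. P *\<^sub>v u) ` carrier_vec c" if v: "v \<in> H" for v
  proof -
    have "P *\<^sub>v (L *\<^sub>v v) = v"
    proof (rule ccontr)
      assume "P *\<^sub>v (L *\<^sub>v v) \<noteq> v"
      from left_inverse_extend[OF PL _ this] v H obtain P' L' where
        "P' \<in> carrier_mat n (Suc c)" "L' \<in> carrier_mat (Suc c) n" "L' * P' = 1\<^sub>m (Suc c)"
        and *: "\<forall>u \<in> carrier_vec (Suc c). \<exists>u' \<in> carrier_vec c. \<exists>a. P' *\<^sub>v u = P *\<^sub>v u' + a \<cdot>\<^sub>v v"
        by blast
      moreover have "P' *\<^sub>v u \<in> H" if "u \<in> carrier_vec (Suc c)" for u
        using * that PH add smult v by metis
      ultimately have "good (Suc c) P' L'" by (auto simp: good_def)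
      from mx[OF this] show False by simp
    qed
    moreover have "L *\<^sub>v v \<in> carrier_vec c" using PL v H by auto
    ultimately show ?thesis by (metis imageI)
  qed
  then have "H = (\<lambda>u. P *\<^sub>v u) ` carrier_vec c" using PH by auto
  then show ?thesis using PL by blast
qed

lemma cols_in_range:
  fixes P :: "'a::field mat"
  assumes "P \<in> carrier_mat n c" "Z \<in> carrier_mat n k"
    and "\<And>j. j < k \<Longrightarrow> col Z j \<in> (\<lambda>u. P *\<^sub>v u) ` carrier_vec c"
  shows "\<exists>Q \<in> carrier_mat c k. Z = P * Q"
proof -
  have "\<forall>j. \<exists>u. j < k \<longrightarrow> u \<in> carrier_vec c \<and> col Z j = P *\<^sub>v u" using assms(3) by blast
  then obtain u where u: "\<And>j. j < k \<Longrightarrow> u j \<in> carrier_vec c" "\<And>j. j < k \<Longrightarrow> col Z j = P *\<^sub>v u j"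
    by metis
  let ?Q = "mat c k (\<lambda>(i, j). u j $ i)"
  have "Z = P * ?Q"
  proof (rule eq_matI)
    fix i j assume "i < dim_row (P * ?Q)" "j < dim_col (P * ?Q)"
    then have ij: "i < n" "j < k" using assms by auto
    have "Z $$ (i, j) = col Z j $ i" using ij assms by auto
    also have "\<dots> = (\<Sum>l<c. P $$ (i, l) * u j $ l)"
      using u[OF ij(2)] ij assms by (simp add: index_mult_vec_sum del: index_mult_mat_vec)
    also have "\<dots> = (P * ?Q) $$ (i, j)"
      using ij assms by (simp add: index_mult_sum del: index_mult_mat)
    finally show "Z $$ (i, j) = (P * ?Q) $$ (i, j)" .
  qed (use assms in auto)
  then show ?thesis by auto
qed

lemma col_mult_vec:
  "A \<in> carrier_mat n m \<Longrightarrow> B \<in> carrier_mat m k \<Longrightarrow> j < k \<Longrightarrow> col (A * B) j = A *\<^sub>v col B j"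
  by (rule eq_vecI) auto

lemma col_range:
  fixes P :: "'a::field mat"
  assumes "P \<in> carrier_mat n c" "j < c"
  shows "col P j \<in> (\<lambda>u. P *\<^sub>v u) ` carrier_vec c"
  using assms col_mult_vec[of P n c "1\<^sub>m c" c j] by (metis imageI one_carrier_mat right_mult_one_mat col_one unit_vec_carrier)

text \<open>
  The columns of the left factor form a basis of the column space of \<open>Z\<close>; these columns are themselves of the form
  \<open>Z v\<close>, and this gives the right inverse of the other factor.
\<close>

lemma rank_factorization:
  fixes Z :: "'a::field mat"
  assumes Z: "Z \<in> carrier_mat n k"
  shows "\<exists>r P Q L R. P \<in> carrier_mat n r \<and> Q \<in> carrier_mat r k \<and> L \<in> carrier_mat r n \<and>
     R \<in> carrier_mat k r \<and> Z = P * Q \<and> L * P = 1\<^sub>m r \<and> Q * R = 1\<^sub>m r"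
proof -
  let ?H = "(\<lambda>u. Z *\<^sub>v u) ` carrier_vec k"
  have "\<exists>c P L. P \<in> carrier_mat n c \<and> L \<in> carrier_mat c n \<and> L * P = 1\<^sub>m c \<and>
     ?H = (\<lambda>u. P *\<^sub>v u) ` carrier_vec c"
  proof (rule subspace_eq_range)
    show "?H \<subseteq> carrier_vec n" using Z by auto
    have "0\<^sub>v n = Z *\<^sub>v 0\<^sub>v k" using Z by (intro eq_vecI) auto
    then show "0\<^sub>v n \<in> ?H" by auto
    show "x + y \<in> ?H" if xy: "x \<in> ?H" "y \<in> ?H" for x y
    proof -
      obtain u v where uv: "u \<in> carrier_vec k" "v \<in> carrier_vec k" "x = Z *\<^sub>v u" "y = Z *\<^sub>v v"
        using xy by auto
      then have "x + y = Z *\<^sub>v (u + v)" using Z by (simp add: mult_add_distrib_mat_vec)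
      then show ?thesis using uv by auto
    qed
    show "a \<cdot>\<^sub>v x \<in> ?H" if x: "x \<in> ?H" for a x
    proof -
      obtain u where u: "u \<in> carrier_vec k" "x = Z *\<^sub>v u" using x by auto
      then have "a \<cdot>\<^sub>v x = Z *\<^sub>v (a \<cdot>\<^sub>v u)" using Z by (simp add: mult_mat_vec)
      then show ?thesis using u by auto
    qed
  qed
  then obtain r P L where P: "P \<in> carrier_mat n r" "L \<in> carrier_mat r n" "L * P = 1\<^sub>m r"
    and eq: "?H = (\<lambda>u. P *\<^sub>v u) ` carrier_vec r" by auto
  obtain R where R: "R \<in> carrier_mat k r" "P = Z * R"
    using cols_in_range[OF Z P(1)] col_range[OF P(1)] eq by blast
  obtain Q where Q: "Q \<in> carrier_mat r k" "Z = P * Q"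
    using cols_in_range[OF P(1) Z] col_range[OF Z] eq by blast
  have "P * (Q * R) = P" using R Q P(1) by (metis assoc_mult_mat)
  moreover have "(L * P) * (Q * R) = L * (P * (Q * R))"
    using P(1,2) Q(1) R(1) by (simp add: mult_assoc_dim)
  ultimately have "Q * R = 1\<^sub>m r" using P(3) Q(1) R(1) by simp
  then show ?thesis using P Q R by blast
qed

text \<open>
  A decomposition \<open>K\<^sup>n = K\<^sup>c \<oplus> K\<^sup>d\<close> with injections \<open>P\<close>, \<open>Y\<close> and projections \<open>L\<close>, \<open>Q\<close>.
\<close>

definition split_mats ::
  "nat \<Rightarrow> nat \<Rightarrow> nat \<Rightarrow> 'a::field mat \<Rightarrow> 'a mat \<Rightarrow> 'a mat \<Rightarrow> 'a mat \<Rightarrow> bool" where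
  "split_mats n c d P L Y Q \<longleftrightarrow> P \<in> carrier_mat n c \<and> L \<in> carrier_mat c n \<and> Y \<in> carrier_mat n d \<and>
     Q \<in> carrier_mat d n \<and> L * P = 1\<^sub>m c \<and> Q * Y = 1\<^sub>m d \<and> Q * P = 0\<^sub>m d c \<and> L * Y = 0\<^sub>m c d \<and>
     P * L + Y * Q = 1\<^sub>m n"

lemma split_mats_sym: "split_mats n c d P L Y Q \<Longrightarrow> split_mats n d c Y Q P L"
  by (auto simp: split_mats_def comm_add_mat[of _ n n])

lemma mat_add_eq_diff:
  fixes A :: "'a::ab_group_add mat"
  assumes "A \<in> carrier_mat n m" "B \<in> carrier_mat n m" "C \<in> carrier_mat n m" "B = C - A"
  shows "A + B = C"
  using assms by (intro eq_matI) auto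

text \<open>
  The idempotent \<open>1 - P L\<close> is factored through its image.
\<close>

lemma complement_exists:
  fixes P :: "'a::field mat"
  assumes P: "P \<in> carrier_mat n c" and L: "L \<in> carrier_mat c n" and LP: "L * P = 1\<^sub>m c"
  shows "\<exists>d Y Q. split_mats n c d P L Y Q"
proof -
  define N where "N = 1\<^sub>m n - P * L"
  have N: "N \<in> carrier_mat n n" using P L by (auto simp: N_def)
  have NP: "N * P = 0\<^sub>m n c" and LN: "L * N = 0\<^sub>m c n"
    using P L LP by (simp_all add: N_def mat_ring mult_absorb[OF LP])
  have NN: "N * N = N"
  proof -
    have "N * N = N - P * (L * N)" using N P L by (simp add: N_def mat_ring)
    also have "P * (L * N) = 0\<^sub>m n n" using P by (simp add: LN)
    finally show ?thesis using N by auto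
  qed
  obtain d Y Q M R where Y: "Y \<in> carrier_mat n d" "Q \<in> carrier_mat d n" "M \<in> carrier_mat d n"
    "R \<in> carrier_mat n d" "N = Y * Q" "M * Y = 1\<^sub>m d" "Q * R = 1\<^sub>m d"
    using rank_factorization[OF N] by blast
  have D: "dim_row Y = n" "dim_col Y = d" "dim_row Q = d" "dim_col Q = n" "dim_row M = d" "dim_col M = n"
    "dim_row R = n" "dim_col R = d" "dim_row P = n" "dim_col P = c" "dim_row L = c" "dim_col L = n"
    "dim_row N = n" "dim_col N = n"
    using Y P L N by auto
  have "M * (N * N) * R = M * N * R" by (simp add: NN)
  then have QY: "Q * Y = 1\<^sub>m d"
    using Y(6,7) unfolding Y(5) by (simp add: mat_ring D mult_absorb[OF Y(6)])
  have "Q * P = M * (N * P)" unfolding Y(5) by (simp add: mat_ring D mult_absorb[OF Y(6)])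
  then have QP: "Q * P = 0\<^sub>m d c" using D by (simp add: NP)
  have "L * Y = (L * N) * R" unfolding Y(5) by (simp add: mat_ring D Y(7))
  then have LY: "L * Y = 0\<^sub>m c d" using D by (simp add: LN)
  have "P * L + Y * Q = 1\<^sub>m n"
    using P L Y by (intro mat_add_eq_diff[of _ n n]) (auto simp: N_def)
  then show ?thesis using P L LP Y QY QP LY unfolding split_mats_def by blast
qed

lemma split_matsD:
  assumes "split_mats n c d P L Y Q"
  shows "P \<in> carrier_mat n c" "L \<in> carrier_mat c n" "Y \<in> carrier_mat n d" "Q \<in> carrier_mat d n"
    "L * P = 1\<^sub>m c" "Q * Y = 1\<^sub>m d" "Q * P = 0\<^sub>m d c" "L * Y = 0\<^sub>m c d" "P * L + Y * Q = 1\<^sub>m n"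
  using assms by (auto simp: split_mats_def)

text \<open>Empty lower and right blocks turn \<open>four_block_mat\<close> into horizontal and vertical concatenation.\<close>

lemma four_block_mult_blocks:
  fixes P :: "'a::field mat"
  assumes "P \<in> carrier_mat n c" "Y \<in> carrier_mat n d" "L \<in> carrier_mat c n" "Q \<in> carrier_mat d n"
  defines "U \<equiv> four_block_mat P Y (0\<^sub>m 0 c) (0\<^sub>m 0 d)"
    and "V \<equiv> four_block_mat L (0\<^sub>m c 0) Q (0\<^sub>m d 0)"
  shows "U \<in> carrier_mat n (c + d)" "V \<in> carrier_mat (c + d) n" "U * V = P * L + Y * Q"
    "V * U = four_block_mat (L * P) (L * Y) (Q * P) (Q * Y)"
proof -
  show "U \<in> carrier_mat n (c + d)" "V \<in> carrier_mat (c + d) n"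
    using assms four_block_carrier_mat[of P n c "0\<^sub>m 0 d" 0 d Y "0\<^sub>m 0 c"]
      four_block_carrier_mat[of L c n "0\<^sub>m d 0" d 0 "0\<^sub>m c 0" Q] by (simp_all add: U_def V_def)
  have "U * V = four_block_mat (P * L + Y * Q) (P * 0\<^sub>m c 0 + Y * 0\<^sub>m d 0)
     (0\<^sub>m 0 c * L + 0\<^sub>m 0 d * Q) (0\<^sub>m 0 c * 0\<^sub>m c 0 + 0\<^sub>m 0 d * 0\<^sub>m d 0)"
    unfolding U_def V_def by (rule mult_four_block_mat) (use assms in auto)
  also have "\<dots> = P * L + Y * Q"
    using assms by (intro eq_matI) auto
  finally show "U * V = P * L + Y * Q" .
  have "V * U = four_block_mat (L * P + 0\<^sub>m c 0 * 0\<^sub>m 0 c) (L * Y + 0\<^sub>m c 0 * 0\<^sub>m 0 d)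
     (Q * P + 0\<^sub>m d 0 * 0\<^sub>m 0 c) (Q * Y + 0\<^sub>m d 0 * 0\<^sub>m 0 d)"
    unfolding U_def V_def by (rule mult_four_block_mat) (use assms in auto)
  also have "\<dots> = four_block_mat (L * P) (L * Y) (Q * P) (Q * Y)"
    using assms by simp
  finally show "V * U = four_block_mat (L * P) (L * Y) (Q * P) (Q * Y)" .
qed

lemma split_mats_dim:
  assumes "split_mats n c d P L Y Q"
  shows "n = c + d"
proof -
  note s = split_matsD[OF assms]
  note b = four_block_mult_blocks[OF s(1,3,2,4)]
  have "four_block_mat (1\<^sub>m c) (0\<^sub>m c d) (0\<^sub>m d c) (1\<^sub>m d) = (1\<^sub>m (c + d) :: 'a mat)"
    by (rule eq_matI) auto
  then have "c + d \<le> n" using left_invertible_le[OF b(1,2)] b(4) s by simp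
  moreover have "n \<le> c + d" using left_invertible_le[OF b(2,1)] b(3) s by simp
  ultimately show ?thesis by simp
qed

section \<open>Representations and intertwiners\<close>

definition rep :: "nat \<Rightarrow> nat \<Rightarrow> (nat \<Rightarrow> 'a::field mat) \<Rightarrow> bool" where
  "rep m d C \<longleftrightarrow> (\<forall>t<m. C t \<in> carrier_mat d d)"

text \<open>The module homomorphisms from \<open>C\<close>, of dimension \<open>d\<close>, to \<open>A\<close>, of dimension \<open>n\<close>.\<close>

definition homs ::
  "nat \<Rightarrow> nat \<Rightarrow> (nat \<Rightarrow> 'a::field mat) \<Rightarrow> nat \<Rightarrow> (nat \<Rightarrow> 'a mat) \<Rightarrow> 'a mat set" where
  "homs m d C n A = {X \<in> carrier_mat n d. \<forall>t<m. A t * X = X * C t}"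

text \<open>A subrepresentation is given by an intertwiner that is injective, that is, left invertible.\<close>

definition simple_rep :: "nat \<Rightarrow> nat \<Rightarrow> (nat \<Rightarrow> 'a::field mat) \<Rightarrow> bool" where
  "simple_rep m d C \<longleftrightarrow> rep m d C \<and> d > 0 \<and>
     (\<forall>r I P L. rep m r I \<longrightarrow> P \<in> homs m r I d C \<longrightarrow> L \<in> carrier_mat r d \<longrightarrow> L * P = 1\<^sub>m r \<longrightarrow>
        r = 0 \<or> r = d)"

text \<open>
  A short exact sequence \<open>0 \<rightarrow> C \<rightarrow> A \<rightarrow> D \<rightarrow> 0\<close> with maps \<open>P\<close>, \<open>Q\<close> and a linear splitting \<open>L\<close>, \<open>Y\<close>, which
  need not respect the action.
\<close>

definition ses where
  "ses m n A c C d D P L Y Q \<longleftrightarrow> split_mats n c d P L Y Q \<and> rep m n A \<and> rep m c C \<and> rep m d D \<and>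
     P \<in> homs m c C n A \<and> Q \<in> homs m n A d D"

lemma simple_repD:
  assumes "simple_rep m d C"
  shows "rep m d C" "d > 0"
  using assms by (auto simp: simple_rep_def)

lemma rep_dims: "rep m d C \<Longrightarrow> t < m \<Longrightarrow> dim_row (C t) = d" "rep m d C \<Longrightarrow> t < m \<Longrightarrow> dim_col (C t) = d"
  by (auto simp: rep_def)

lemma homs_dims: "X \<in> homs m d C n A \<Longrightarrow> dim_row X = n" "X \<in> homs m d C n A \<Longrightarrow> dim_col X = d"
  by (auto simp: homs_def)

lemma homs_carrier: "X \<in> homs m d C n A \<Longrightarrow> X \<in> carrier_mat n d"
  by (auto simp: homs_def)

lemma homs_eq: "X \<in> homs m d C n A \<Longrightarrow> t < m \<Longrightarrow> A t * X = X * C t"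
  by (auto simp: homs_def)

lemma homsI: "X \<in> carrier_mat n d \<Longrightarrow> (\<And>t. t < m \<Longrightarrow> A t * X = X * C t) \<Longrightarrow> X \<in> homs m d C n A"
  by (auto simp: homs_def)

lemma homs_one: "rep m d C \<Longrightarrow> 1\<^sub>m d \<in> homs m d C d C"
  by (rule homsI) (auto simp: rep_dims)

lemma homs_comp:
  assumes "X \<in> homs m d C n A" "Y \<in> homs m n A p B" "rep m d C" "rep m n A" "rep m p B"
  shows "Y * X \<in> homs m d C p B"
proof (rule homsI)
  show "Y * X \<in> carrier_mat p d"
    by (rule mult_carrier_mat[OF homs_carrier[OF assms(2)] homs_carrier[OF assms(1)]])
  fix t assume t: "t < m"
  note D = homs_dims[OF assms(1)] homs_dims[OF assms(2)] rep_dims[OF assms(3) t]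
    rep_dims[OF assms(4) t] rep_dims[OF assms(5) t]
  have "B t * (Y * X) = Y * (A t * X)"
    using assms homs_eq[OF assms(2) t] mult_assoc_dim[of "B t" Y X] mult_assoc_dim[of Y "A t" X]
    by (simp add: D)
  also have "\<dots> = Y * X * C t"
    using homs_eq[OF assms(1) t] mult_assoc_dim[of Y X "C t"]
    by (simp add: D)
  finally show "B t * (Y * X) = Y * X * C t" .
qed

lemma homs_inverse:
  assumes X: "X \<in> homs m d C n A" and W: "W \<in> carrier_mat d n" "W * X = 1\<^sub>m d" "X * W = 1\<^sub>m n"
    and C: "rep m d C" and A: "rep m n A"
  shows "W \<in> homs m n A d C"
proof (rule homsI)
  fix t assume t: "t < m"
  note D = rep_dims[OF C t] rep_dims[OF A t] homs_dims[OF X]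
  have "C t * W = W * (X * C t) * W"
    using W(1) by (simp add: mat_ring D mult_absorb[OF W(2)])
  also have "\<dots> = W * A t"
    using W by (simp add: homs_eq[OF X t, symmetric] mat_ring D)
  finally show "C t * W = W * A t" .
qed (use W in auto)

text \<open>The quotient by a subrepresentation acts on the chosen complement.\<close>

lemma ses_of_mono:
  assumes s: "split_mats n c d P L Y Q" and P: "P \<in> homs m c C n A" and C: "rep m c C" and A: "rep m n A"
  shows "ses m n A c C d (\<lambda>t. Q * A t * Y) P L Y Q"
proof -
  note s' = split_matsD[OF s]
  have D: "dim_row P = n" "dim_col P = c" "dim_row L = c" "dim_col L = n"
    "dim_row Y = n" "dim_col Y = d" "dim_row Q = d" "dim_col Q = n" using s' by auto
  have "Q \<in> homs m n A d (\<lambda>t. Q * A t * Y)"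
  proof (rule homsI)
    fix t assume t: "t < m"
    note D' = D rep_dims[OF C t] rep_dims[OF A t]
    have "Q * A t = Q * A t * (P * L + Y * Q)" using s'(9) by (simp add: D')
    also have "\<dots> = Q * (A t * P) * L + Q * A t * (Y * Q)" by (simp add: mat_ring D')
    also have "Q * (A t * P) * L = 0\<^sub>m d n"
      unfolding homs_eq[OF P t] by (simp add: mat_ring D' mult_absorb[OF s'(7)])
    also have "0\<^sub>m d n + Q * A t * (Y * Q) = Q * A t * Y * Q" by (simp add: mat_ring D')
    finally show "Q * A t * Y * Q = Q * A t" by (rule sym)
  qed (use s' in auto)
  moreover have "rep m d (\<lambda>t. Q * A t * Y)" using s' A by (auto simp: rep_def)
  ultimately show ?thesis using assms by (auto simp: ses_def)
qed

lemma ses_of_epi: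
  assumes s: "split_mats n c d P L Y Q" and Q: "Q \<in> homs m n A d D" and R: "rep m d D" and A: "rep m n A"
  shows "ses m n A c (\<lambda>t. L * A t * P) d D P L Y Q"
proof -
  note s' = split_matsD[OF s]
  have D: "dim_row P = n" "dim_col P = c" "dim_row L = c" "dim_col L = n"
    "dim_row Y = n" "dim_col Y = d" "dim_row Q = d" "dim_col Q = n" using s' by auto
  have "P \<in> homs m c (\<lambda>t. L * A t * P) n A"
  proof (rule homsI)
    fix t assume t: "t < m"
    note D' = D rep_dims[OF R t] rep_dims[OF A t]
    have "A t * P = (P * L + Y * Q) * (A t * P)" using s'(9) by (simp add: D')
    also have "\<dots> = P * (L * A t * P) + Y * ((Q * A t) * P)" by (simp add: mat_ring D')
    also have "Y * ((Q * A t) * P) = 0\<^sub>m n c"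
      unfolding homs_eq[OF Q t, symmetric] using s'(7) by (simp add: mat_ring D')
    finally show "A t * P = P * (L * A t * P)" using D' by (simp add: add_zero_dim)
  qed (use s' in auto)
  moreover have "rep m c (\<lambda>t. L * A t * P)" using s' A by (auto simp: rep_def)
  ultimately show ?thesis using assms by (auto simp: ses_def)
qed

lemma sesD:
  assumes "ses m n A c C d D P L Y Q"
  shows "split_mats n c d P L Y Q" "rep m n A" "rep m c C" "rep m d D"
     "P \<in> homs m c C n A" "Q \<in> homs m n A d D" "n = c + d"
     "dim_row P = n" "dim_col P = c" "dim_row L = c" "dim_col L = n"
    "dim_row Y = n" "dim_col Y = d" "dim_row Q = d" "dim_col Q = n"
  using assms split_matsD[of n c d P L Y Q] split_mats_dim[of n c d P L Y Q] by (auto simp: ses_def)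

lemma ses_descend:
  assumes s: "ses m n A c C d D P L Y Q" and f: "f \<in> homs m n A p B" and B: "rep m p B"
    and fP: "f * P = 0\<^sub>m p c"
  shows "f * Y \<in> homs m d D p B" "f = f * Y * Q"
proof -
  note s' = split_matsD[OF sesD(1)[OF s]]
  note D = sesD(8-)[OF s] homs_dims[OF f]
  have "f = f * (P * L + Y * Q)" using s'(9) by (simp add: D)
  also have "\<dots> = f * P * L + f * Y * Q" by (simp add: mat_ring D)
  also have "f * P * L = 0\<^sub>m p n" unfolding fP by (simp add: D)
  finally show fYQ: "f = f * Y * Q" by (simp add: D add_zero_dim)
  show "f * Y \<in> homs m d D p B"
  proof (rule homsI)
    fix t assume t: "t < m"
    note D' = D rep_dims[OF sesD(2)[OF s] t] rep_dims[OF sesD(4)[OF s] t] rep_dims[OF B t]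
    have "f * Y * D t = f * Y * (D t * Q) * Y" using s'(6) by (simp add: mat_ring D')
    also have "\<dots> = (f * Y * Q) * A t * Y"
      unfolding homs_eq[OF sesD(6)[OF s] t] by (simp add: mat_ring D')
    also have "\<dots> = B t * f * Y" unfolding fYQ[symmetric] homs_eq[OF f t] ..
    also have "\<dots> = B t * (f * Y)" by (simp add: mat_ring D')
    finally show "B t * (f * Y) = f * Y * D t" by simp
  qed (use s' homs_carrier[OF f] in auto)
qed

lemma ses_lift:
  assumes s: "ses m n A c C d D P L Y Q" and f: "f \<in> homs m p B n A" and B: "rep m p B"
    and Qf: "Q * f = 0\<^sub>m d p"
  shows "L * f \<in> homs m p B c C" "f = P * (L * f)"
proof -
  note s' = split_matsD[OF sesD(1)[OF s]]
  note D = sesD(8-)[OF s] homs_dims[OF f]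
  have "f = (P * L + Y * Q) * f" using s'(9) by (simp add: D)
  also have "\<dots> = P * (L * f) + Y * (Q * f)" by (simp add: mat_ring D)
  finally show PLf: "f = P * (L * f)" unfolding Qf by (simp add: D add_zero_dim)
  show "L * f \<in> homs m p B c C"
  proof (rule homsI)
    fix t assume t: "t < m"
    note D' = D rep_dims[OF sesD(2)[OF s] t] rep_dims[OF sesD(3)[OF s] t] rep_dims[OF B t]
    have "C t * (L * f) = L * (P * C t) * (L * f)" using s'(5) by (simp add: mat_ring D' mult_absorb[OF s'(5)])
    also have "\<dots> = L * (A t * (P * (L * f)))"
      unfolding homs_eq[OF sesD(5)[OF s] t, symmetric] by (simp add: mat_ring D')
    also have "\<dots> = L * f * B t" unfolding PLf[symmetric] homs_eq[OF f t] by (simp add: mat_ring D')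
    finally show "C t * (L * f) = L * f * B t" .
  qed (use s' homs_carrier[OF f] in auto)
qed

text \<open>
  Both factors of a rank factorisation of an intertwiner are intertwiners, for the action that the
  image inherits.
\<close>

lemma homs_image:
  assumes Z: "Z \<in> homs m d C n A" and C: "rep m d C" and A: "rep m n A"
  shows "\<exists>r I P Q L R. rep m r I \<and> P \<in> homs m r I n A \<and> Q \<in> homs m d C r I \<and>
     L \<in> carrier_mat r n \<and> R \<in> carrier_mat d r \<and> Z = P * Q \<and> L * P = 1\<^sub>m r \<and> Q * R = 1\<^sub>m r"
proof -
  obtain r P Q L R where f: "P \<in> carrier_mat n r" "Q \<in> carrier_mat r d" "L \<in> carrier_mat r n"
     "R \<in> carrier_mat d r" "Z = P * Q" "L * P = 1\<^sub>m r" "Q * R = 1\<^sub>m r"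
    using rank_factorization[OF homs_carrier[OF Z]] by blast
  define I where "I t = Q * C t * R" for t
  have D: "dim_row P = n" "dim_col P = r" "dim_row Q = r" "dim_col Q = d"
    "dim_row L = r" "dim_col L = n" "dim_row R = d" "dim_col R = r" using f by auto
  have I: "rep m r I" using f C by (auto simp: rep_def I_def)
  have "P \<in> homs m r I n A"
  proof (rule homsI)
    fix t assume t: "t < m"
    note D' = D rep_dims[OF C t] rep_dims[OF A t]
    have "A t * P = A t * (P * Q) * R" by (simp add: mat_ring D' f(7))
    also have "\<dots> = P * Q * C t * R" using homs_eq[OF Z t] unfolding f(5) by simp
    also have "\<dots> = P * I t" by (simp add: mat_ring D' I_def)
    finally show "A t * P = P * I t" .
  qed (use f in auto)
  moreover have "Q \<in> homs m d C r I"
  proof (rule homsI)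
    fix t assume t: "t < m"
    note D' = D rep_dims[OF C t] rep_dims[OF A t]
    have AP: "P * (Q * C t) = A t * (P * Q)"
      using homs_eq[OF Z t] unfolding f(5) by (simp add: mat_ring D')
    have "I t * Q = L * (P * (Q * C t)) * R * Q"
      by (simp add: mat_ring D' mult_absorb[OF f(6)] I_def)
    also have "\<dots> = L * (A t * (P * Q))"
      unfolding AP by (simp add: mat_ring D' mult_absorb[OF f(7)])
    also have "\<dots> = Q * C t" 
      unfolding AP[symmetric] by (simp add: mat_ring D' mult_absorb[OF f(6)])
    finally show "I t * Q = Q * C t" .
  qed (use f in auto)
  ultimately show ?thesis using f I by blast
qed

section \<open>Simple representations\<close>

lemma mult_zero_inner: "P \<in> carrier_mat n 0 \<Longrightarrow> Q \<in> carrier_mat 0 d \<Longrightarrow> P * Q = 0\<^sub>m n d"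
  by (rule eq_matI) (auto simp: scalar_prod_def)

text \<open>The kernel of a nonzero map is a proper subrepresentation of its source, hence zero.\<close>

lemma simple_source:
  assumes C: "simple_rep m d C" and A: "rep m n A" and Z: "Z \<in> homs m d C n A" and nz: "Z \<noteq> 0\<^sub>m n d"
  shows "\<exists>L \<in> carrier_mat d n. L * Z = 1\<^sub>m d"
proof -
  note C' = simple_repD(1)[OF C]
  obtain r I P Q L R where f: "rep m r I" "P \<in> homs m r I n A" "Q \<in> homs m d C r I"
     "L \<in> carrier_mat r n" "R \<in> carrier_mat d r" "Z = P * Q" "L * P = 1\<^sub>m r" "Q * R = 1\<^sub>m r"
    using homs_image[OF Z C' A] by blast
  obtain e Y W where s: "split_mats d r e R Q Y W"
    using complement_exists[OF f(5) homs_carrier[OF f(3)] f(8)] by blast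
  note ss = split_mats_sym[OF s]
  have "ses m d C e (\<lambda>t. W * C t * Y) r I Y W R Q"
    by (rule ses_of_epi[OF ss f(3) f(1) C'])
  note k = sesD[OF this]
  have "e = 0 \<or> e = d"
    using C k(3,5) split_matsD[OF ss] unfolding simple_rep_def by blast
  moreover have "r \<noteq> 0" using nz f(6) homs_carrier[OF f(2)] homs_carrier[OF f(3)] mult_zero_inner by blast
  ultimately have rd: "r = d" using k(7) by auto
  have "R * Q = 1\<^sub>m d"
    using mat_mult_left_right_inverse[of Q d R] f(5,8) homs_carrier[OF f(3)] rd by simp
  then have "(R * L) * Z = 1\<^sub>m d"
    using f(4,5) homs_dims[OF f(2)] homs_dims[OF f(3)] unfolding f(6)
    by (simp add: mat_ring mult_absorb[OF f(7)])
  moreover have "R * L \<in> carrier_mat d n" using f by auto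
  ultimately show ?thesis by blast
qed

text \<open>The image of a nonzero map is a nonzero subrepresentation of its target, hence everything.\<close>

lemma simple_target:
  assumes D: "simple_rep m n D" and A: "rep m d A" and Z: "Z \<in> homs m d A n D" and nz: "Z \<noteq> 0\<^sub>m n d"
  shows "\<exists>R \<in> carrier_mat d n. Z * R = 1\<^sub>m n"
proof -
  note D' = simple_repD(1)[OF D]
  obtain r I P Q L R where f: "rep m r I" "P \<in> homs m r I n D" "Q \<in> homs m d A r I"
     "L \<in> carrier_mat r n" "R \<in> carrier_mat d r" "Z = P * Q" "L * P = 1\<^sub>m r" "Q * R = 1\<^sub>m r"
    using homs_image[OF Z A D'] by blast
  have "r = 0 \<or> r = n"
    using D f unfolding simple_rep_def by blast
  moreover have "r \<noteq> 0" using nz f(6) homs_carrier[OF f(2)] homs_carrier[OF f(3)] mult_zero_inner by blast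
  ultimately have rd: "r = n" by auto
  have PL: "P * L = 1\<^sub>m n"
    using mat_mult_left_right_inverse[of L n P] f(4,7) homs_carrier[OF f(2)] rd by simp
  have "Z * (R * L) = 1\<^sub>m n"
    using f(4,5) homs_dims[OF f(2)] homs_dims[OF f(3)] PL unfolding f(6)
    by (simp add: mat_ring mult_absorb[OF f(8)])
  moreover have "R * L \<in> carrier_mat d n" using f by auto
  ultimately show ?thesis by blast
qed

lemma simple_simple:
  assumes C: "simple_rep m d C" and D: "simple_rep m n D" and Z: "Z \<in> homs m d C n D" and nz: "Z \<noteq> 0\<^sub>m n d"
  shows "d = n" "\<exists>W \<in> homs m n D d C. W * Z = 1\<^sub>m d \<and> Z * W = 1\<^sub>m n"
proof -
  note C' = simple_repD(1)[OF C] and D' = simple_repD(1)[OF D]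
  obtain L where L: "L \<in> carrier_mat d n" "L * Z = 1\<^sub>m d" using simple_source[OF C D' Z nz] by blast
  obtain R where R: "R \<in> carrier_mat d n" "Z * R = 1\<^sub>m n" using simple_target[OF D C' Z nz] by blast
  have "d \<le> n" using left_invertible_le[OF homs_carrier[OF Z] L] .
  moreover have "n \<le> d" using left_invertible_le[OF R(1) homs_carrier[OF Z] R(2)] .
  ultimately show dn: "d = n" by simp
  have ZL: "Z * L = 1\<^sub>m n"
    using mat_mult_left_right_inverse[of L n Z] L homs_carrier[OF Z] dn by simp
  show "\<exists>W \<in> homs m n D d C. W * Z = 1\<^sub>m d \<and> Z * W = 1\<^sub>m n"
    using homs_inverse[OF Z L ZL C' D'] L ZL by blast
qed

text \<open>A nonzero subrepresentation of least dimension is simple.\<close>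

lemma simple_sub_exists:
  assumes A: "rep m n A" and n: "n > 0"
  shows "\<exists>c C P L. simple_rep m c C \<and> P \<in> homs m c C n A \<and> L \<in> carrier_mat c n \<and> L * P = 1\<^sub>m c"
proof -
  define good where "good c \<longleftrightarrow> c > 0 \<and> (\<exists>C P L. rep m c C \<and> P \<in> homs m c C n A \<and>
     L \<in> carrier_mat c n \<and> L * P = 1\<^sub>m c)" for c
  have "good n" unfolding good_def using n A homs_one[OF A] by (intro conjI exI[of _ A] exI[of _ "1\<^sub>m n"]) auto
  define c where "c = (LEAST c. good c)"
  have "good c" unfolding c_def using \<open>good n\<close> by (rule LeastI)
  then obtain C P L where c: "c > 0" and C: "rep m c C" and P: "P \<in> homs m c C n A"
     and L: "L \<in> carrier_mat c n" "L * P = 1\<^sub>m c" by (auto simp: good_def)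
  have "simple_rep m c C"
    unfolding simple_rep_def
  proof (intro conjI allI impI)
    fix r I P' L' assume I: "rep m r I" "P' \<in> homs m r I c C" "L' \<in> carrier_mat r c" "L' * P' = 1\<^sub>m r"
    show "r = 0 \<or> r = c"
    proof (rule ccontr)
      assume "\<not> (r = 0 \<or> r = c)"
      then have "r < c" "r > 0" using left_invertible_le[OF homs_carrier[OF I(2)] I(3,4)] by auto
      have "(L' * L) * (P * P') = 1\<^sub>m r"
        using I(3,4) L(1) homs_dims[OF I(2)] homs_dims[OF P] by (simp add: mat_ring mult_absorb[OF L(2)])
      then have "good r" unfolding good_def
        using homs_comp[OF I(2) P I(1) C A] I(1,3) L \<open>r > 0\<close> by (meson mult_carrier_mat)
      then show False using \<open>r < c\<close> not_less_Least unfolding c_def by blast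
    qed
  qed (use C c in auto)
  then show ?thesis using P L by blast
qed

lemma homs_diff_smult:
  assumes "X \<in> homs m d C n A" "Y \<in> homs m d C n A" "rep m d C" "rep m n A"
  shows "X - a \<cdot>\<^sub>m Y \<in> homs m d C n A"
proof (rule homsI)
  fix t assume t: "t < m"
  show "A t * (X - a \<cdot>\<^sub>m Y) = (X - a \<cdot>\<^sub>m Y) * C t"
    using homs_eq[OF assms(1) t] homs_eq[OF assms(2) t]
    by (simp add: mat_ring homs_dims[OF assms(1)] homs_dims[OF assms(2)] rep_dims[OF assms(3) t] rep_dims[OF assms(4) t])
qed (use homs_carrier[OF assms(1)] homs_carrier[OF assms(2)] in auto)

text \<open>
  Subtracting an eigenvalue makes the endomorphism non-invertible, and for a simple representation
  that means zero.
\<close>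

lemma schur:
  fixes C :: "nat \<Rightarrow> 'a::alg_closed_field mat"
  assumes C: "simple_rep m d C" and Z: "Z \<in> homs m d C d C"
  shows "\<exists>a. Z = a \<cdot>\<^sub>m 1\<^sub>m d"
proof -
  note C' = simple_repD[OF C]
  have "degree (char_poly Z) > 0"
    using degree_monic_char_poly[OF homs_carrier[OF Z]] C'(2) by simp
  then obtain a where "poly (char_poly Z) a = 0" using alg_closed_imp_poly_has_root by blast
  then have "eigenvalue Z a" using eigenvalue_root_char_poly[OF homs_carrier[OF Z]] by simp
  then obtain v where v: "v \<in> carrier_vec d" "v \<noteq> 0\<^sub>v d" "Z *\<^sub>v v = a \<cdot>\<^sub>v v"
    using homs_dims[OF Z] by (auto simp: eigenvalue_def eigenvector_def)
  define W where "W = Z - a \<cdot>\<^sub>m 1\<^sub>m d"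
  have W: "W \<in> homs m d C d C" unfolding W_def by (rule homs_diff_smult[OF Z homs_one]) (use C' in auto)
  have Wv: "W *\<^sub>v v = 0\<^sub>v d"
  proof -
    have "W *\<^sub>v v = Z *\<^sub>v v - (a \<cdot>\<^sub>m 1\<^sub>m d) *\<^sub>v v"
      unfolding W_def using homs_carrier[OF Z] v by (intro minus_mult_distrib_mat_vec) auto
    also have "(a \<cdot>\<^sub>m 1\<^sub>m d) *\<^sub>v v = a \<cdot>\<^sub>v v"
      using v by (intro eq_vecI) auto
    finally show ?thesis using v by simp
  qed
  have "W = 0\<^sub>m d d"
  proof (rule ccontr)
    assume "W \<noteq> 0\<^sub>m d d"
    then obtain L where L: "L \<in> carrier_mat d d" "L * W = 1\<^sub>m d"
      using simple_source[OF C C'(1) W] by blast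
    have "v = (L * W) *\<^sub>v v" using L v by simp
    also have "\<dots> = L *\<^sub>v (W *\<^sub>v v)" using L homs_carrier[OF W] v by (intro assoc_mult_mat_vec) auto
    also have "\<dots> = 0\<^sub>v d" unfolding Wv using L by (intro mult_mat_zero_vec) auto
    finally show False using v by simp
  qed
  have "Z = a \<cdot>\<^sub>m 1\<^sub>m d"
  proof (rule eq_matI)
    fix i j assume "i < dim_row (a \<cdot>\<^sub>m 1\<^sub>m d)" "j < dim_col (a \<cdot>\<^sub>m 1\<^sub>m d)"
    then have ij: "i < d" "j < d" by auto
    then have "W $$ (i, j) = 0" using \<open>W = 0\<^sub>m d d\<close> by simp
    then show "Z $$ (i, j) = (a \<cdot>\<^sub>m 1\<^sub>m d) $$ (i, j)" using ij homs_carrier[OF Z] by (simp add: W_def)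
  qed (use homs_carrier[OF Z] in auto)
  then show ?thesis by blast
qed

section \<open>Independent families of intertwiners\<close>

text \<open>
  Dimensions of spaces of intertwiners are compared by way of independent families, so that these
  spaces need not be set up as vector spaces.
\<close>

definition lin_comb :: "nat \<Rightarrow> (nat \<Rightarrow> 'a::field) \<Rightarrow> (nat \<Rightarrow> 'a mat) \<Rightarrow> nat \<Rightarrow> nat \<Rightarrow> 'a mat" where
  "lin_comb k a Z n d = mat n d (\<lambda>(i, j). \<Sum>l<k. a l * Z l $$ (i, j))"

definition indep :: "nat \<Rightarrow> nat \<Rightarrow> nat \<Rightarrow> (nat \<Rightarrow> 'a::field mat) \<Rightarrow> bool" where
  "indep k n d Z \<longleftrightarrow> (\<forall>a. lin_comb k a Z n d = 0\<^sub>m n d \<longrightarrow> (\<forall>i<k. a i = 0))"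

text \<open>The inequality \<open>dim Hom(C, A) \<le> dim Hom(C, B)\<close> for every representation \<open>C\<close>.\<close>

definition hom_dominated :: "nat \<Rightarrow> nat \<Rightarrow> (nat \<Rightarrow> 'a::field mat) \<Rightarrow> (nat \<Rightarrow> 'a mat) \<Rightarrow> bool" where
  "hom_dominated m n A B \<longleftrightarrow> (\<forall>d C k Z. rep m d C \<longrightarrow> (\<forall>i<k. Z i \<in> homs m d C n A) \<longrightarrow> indep k n d Z \<longrightarrow>
     (\<exists>Z'. (\<forall>i<k. Z' i \<in> homs m d C n B) \<and> indep k n d Z'))"

lemma lin_comb_carrier [simp]:
  "lin_comb k a Z n d \<in> carrier_mat n d" "dim_row (lin_comb k a Z n d) = n" "dim_col (lin_comb k a Z n d) = d"
  by (auto simp: lin_comb_def)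

lemma mult_lin_comb:
  assumes M: "M \<in> carrier_mat p n" and Z: "\<And>l. l < k \<Longrightarrow> Z l \<in> carrier_mat n d"
  shows "M * lin_comb k a Z n d = lin_comb k a (\<lambda>l. M * Z l) p d"
proof (rule eq_matI)
  fix i j assume "i < dim_row (lin_comb k a (\<lambda>l. M * Z l) p d)" "j < dim_col (lin_comb k a (\<lambda>l. M * Z l) p d)"
  then have ij: "i < p" "j < d" by auto
  have "(M * lin_comb k a Z n d) $$ (i, j) = (\<Sum>r<n. \<Sum>l<k. M $$ (i, r) * (a l * Z l $$ (r, j)))"
    using ij M by (subst index_mult_sum) (auto simp: lin_comb_def sum_distrib_left intro!: sum.cong)
  also have "\<dots> = (\<Sum>l<k. a l * (\<Sum>r<n. M $$ (i, r) * Z l $$ (r, j)))"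
    by (subst sum.swap) (simp add: sum_distrib_left ac_simps)
  also have "\<dots> = (\<Sum>l<k. a l * (M * Z l) $$ (i, j))"
  proof (intro sum.cong arg_cong2[of _ _ _ _ "(*)"] refl)
    fix l assume "l \<in> {..<k}"
    then show "(\<Sum>r<n. M $$ (i, r) * Z l $$ (r, j)) = (M * Z l) $$ (i, j)"
      using ij M Z[of l] by (subst index_mult_sum) auto
  qed
  finally show "(M * lin_comb k a Z n d) $$ (i, j) = lin_comb k a (\<lambda>l. M * Z l) p d $$ (i, j)"
    using ij by (simp add: lin_comb_def)
qed (use M in auto)

lemma lin_comb_mult:
  assumes M: "M \<in> carrier_mat d p" and Z: "\<And>l. l < k \<Longrightarrow> Z l \<in> carrier_mat n d"
  shows "lin_comb k a Z n d * M = lin_comb k a (\<lambda>l. Z l * M) n p"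
proof (rule eq_matI)
  fix i j assume "i < dim_row (lin_comb k a (\<lambda>l. Z l * M) n p)" "j < dim_col (lin_comb k a (\<lambda>l. Z l * M) n p)"
  then have ij: "i < n" "j < p" by auto
  have "(lin_comb k a Z n d * M) $$ (i, j) = (\<Sum>r<d. \<Sum>l<k. a l * Z l $$ (i, r) * M $$ (r, j))"
    using ij M by (subst index_mult_sum) (auto simp: lin_comb_def sum_distrib_right intro!: sum.cong)
  also have "\<dots> = (\<Sum>l<k. a l * (\<Sum>r<d. Z l $$ (i, r) * M $$ (r, j)))"
    by (subst sum.swap) (simp add: sum_distrib_left ac_simps)
  also have "\<dots> = (\<Sum>l<k. a l * (Z l * M) $$ (i, j))"
  proof (intro sum.cong arg_cong2[of _ _ _ _ "(*)"] refl)
    fix l assume "l \<in> {..<k}"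
    then show "(\<Sum>r<d. Z l $$ (i, r) * M $$ (r, j)) = (Z l * M) $$ (i, j)"
      using ij M Z[of l] by (subst index_mult_sum) auto
  qed
  finally show "(lin_comb k a Z n d * M) $$ (i, j) = lin_comb k a (\<lambda>l. Z l * M) n p $$ (i, j)"
    using ij by (simp add: lin_comb_def)
qed (use M in auto)

lemma lin_comb_cong:
  "(\<And>l. l < k \<Longrightarrow> a l = b l) \<Longrightarrow> (\<And>l. l < k \<Longrightarrow> Z l = Z' l) \<Longrightarrow> lin_comb k a Z n d = lin_comb k b Z' n d"
  unfolding lin_comb_def by (intro cong_mat refl) (auto intro!: sum.cong)

lemma lin_comb_homs:
  assumes C: "rep m d C" and A: "rep m n A" and Z: "\<And>l. l < k \<Longrightarrow> Z l \<in> homs m d C n A"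
  shows "lin_comb k a Z n d \<in> homs m d C n A"
proof (rule homsI)
  fix t assume t: "t < m"
  have Zc: "\<And>l. l < k \<Longrightarrow> Z l \<in> carrier_mat n d" using Z homs_carrier by blast
  have "A t * lin_comb k a Z n d = lin_comb k a (\<lambda>l. A t * Z l) n d"
    using A t by (intro mult_lin_comb Zc) (auto simp: rep_def)
  also have "\<dots> = lin_comb k a (\<lambda>l. Z l * C t) n d"
    by (intro lin_comb_cong refl homs_eq[OF Z t])
  also have "\<dots> = lin_comb k a Z n d * C t"
    using C t by (intro lin_comb_mult[symmetric] Zc) (auto simp: rep_def)
  finally show "A t * lin_comb k a Z n d = lin_comb k a Z n d * C t" .
qed auto

lemma lin_comb_Suc:
  assumes "Z k \<in> carrier_mat n d"
  shows "lin_comb (Suc k) a Z n d = lin_comb k a Z n d + a k \<cdot>\<^sub>m Z k"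
  using assms by (intro eq_matI) (auto simp: lin_comb_def)

lemma lin_comb_1:
  assumes "Z 0 \<in> carrier_mat n d"
  shows "lin_comb 1 a Z n d = a 0 \<cdot>\<^sub>m Z 0"
  using assms by (intro eq_matI) (auto simp: lin_comb_def)

lemma lin_comb_2:
  assumes "Z 0 \<in> carrier_mat n d" "Z 1 \<in> carrier_mat n d"
  shows "lin_comb 2 a Z n d = a 0 \<cdot>\<^sub>m Z 0 + a 1 \<cdot>\<^sub>m Z 1"
  using assms by (intro eq_matI) (auto simp: lin_comb_def numeral_2_eq_2)

lemma smult_eq_zero:
  assumes "X \<in> carrier_mat n d" "X \<noteq> 0\<^sub>m n d" "a \<cdot>\<^sub>m X = 0\<^sub>m n d"
  shows "a = (0 :: 'a::field)"
proof (rule ccontr)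
  assume a: "a \<noteq> 0"
  have "X = 0\<^sub>m n d"
  proof (rule eq_matI)
    fix i j assume "i < dim_row (0\<^sub>m n d)" "j < dim_col (0\<^sub>m n d)"
    then show "X $$ (i, j) = 0\<^sub>m n d $$ (i, j)"
      using arg_cong[OF assms(3), of "\<lambda>x. x $$ (i, j)"] assms(1) a by auto
  qed (use assms in auto)
  then show False using assms by simp
qed

lemma hom_dominated_one:
  assumes h: "hom_dominated m n A B" and C: "rep m d C" and X: "X \<in> homs m d C n A" and nz: "X \<noteq> 0\<^sub>m n d"
  shows "\<exists>X' \<in> homs m d C n B. X' \<noteq> 0\<^sub>m n d"
proof -
  have "indep 1 n d (\<lambda>_. X)"
    unfolding indep_def using homs_carrier[OF X] nz by (auto simp: lin_comb_1[simplified] dest: smult_eq_zero)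
  then obtain Z' where Z': "\<forall>i<(1::nat). Z' i \<in> homs m d C n B" "indep 1 n d Z'"
    using h C X unfolding hom_dominated_def by metis
  have "Z' 0 \<noteq> 0\<^sub>m n d"
  proof
    assume "Z' 0 = 0\<^sub>m n d"
    then have "lin_comb 1 (\<lambda>_. 1) Z' n d = 0\<^sub>m n d" by (subst lin_comb_1) auto
    then show False using Z'(2) unfolding indep_def by (metis less_numeral_extra(1) zero_neq_one)
  qed
  then show ?thesis using Z' by auto
qed

lemma hom_dominated_two:
  assumes h: "hom_dominated m n A B" and C: "rep m d C" and X: "X \<in> homs m d C n A" "Y \<in> homs m d C n A"
    and ind: "\<And>a b. a \<cdot>\<^sub>m X + b \<cdot>\<^sub>m Y = 0\<^sub>m n d \<Longrightarrow> a = 0 \<and> b = 0"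
  shows "\<exists>X' \<in> homs m d C n B. \<exists>Y' \<in> homs m d C n B.
     \<forall>a b. a \<cdot>\<^sub>m X' + b \<cdot>\<^sub>m Y' = 0\<^sub>m n d \<longrightarrow> a = 0 \<and> b = 0"
proof -
  define Z where "Z i = (if i = 0 then X else Y)" for i :: nat
  have Z: "\<forall>i<2. Z i \<in> homs m d C n A" using X by (auto simp: Z_def)
  have "lin_comb 2 a Z n d = a 0 \<cdot>\<^sub>m X + a 1 \<cdot>\<^sub>m Y" for a
    using X homs_carrier by (subst lin_comb_2) (auto simp: Z_def)
  then have "indep 2 n d Z"
    unfolding indep_def using ind by (metis One_nat_def less_2_cases)
  then obtain Z' where Z': "\<forall>i<2. Z' i \<in> homs m d C n B" "indep 2 n d Z'"
    using h C Z unfolding hom_dominated_def by metis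
  have c: "Z' 0 \<in> homs m d C n B" "Z' 1 \<in> homs m d C n B" using Z' by auto
  have "a = 0 \<and> b = 0" if "a \<cdot>\<^sub>m Z' 0 + b \<cdot>\<^sub>m Z' 1 = 0\<^sub>m n d" for a b
  proof -
    define e where "e i = (if i = 0 then a else b)" for i :: nat
    have "lin_comb 2 e Z' n d = 0\<^sub>m n d"
      using that homs_carrier[OF c(1)] homs_carrier[OF c(2)] by (subst lin_comb_2) (auto simp: e_def)
    then have "\<forall>i<2. e i = 0" using Z'(2) unfolding indep_def by blast
    then have "e 0 = 0" "e 1 = 0" by auto
    then show ?thesis by (auto simp: e_def)
  qed
  then show ?thesis using c by blast
qed

lemma trivial_kernel_left_inverse:
  fixes W :: "'a::field mat"
  assumes W: "W \<in> carrier_mat N k" and ker: "\<And>v. v \<in> carrier_vec k \<Longrightarrow> W *\<^sub>v v = 0\<^sub>v N \<Longrightarrow> v = 0\<^sub>v k"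
  shows "\<exists>L \<in> carrier_mat k N. L * W = 1\<^sub>m k"
proof -
  obtain r P Q L R where f: "P \<in> carrier_mat N r" "Q \<in> carrier_mat r k" "L \<in> carrier_mat r N"
     "R \<in> carrier_mat k r" "W = P * Q" "L * P = 1\<^sub>m r" "Q * R = 1\<^sub>m r"
    using rank_factorization[OF W] by blast
  obtain e Y V where s: "split_mats k r e R Q Y V"
    using complement_exists[OF f(4,2,7)] by blast
  note s' = split_matsD[OF s]
  have "e = 0"
  proof (rule ccontr)
    assume e: "e \<noteq> 0"
    have "W * Y = 0\<^sub>m N e"
      using f s' by (simp add: mat_ring)
    then have "W *\<^sub>v col Y 0 = 0\<^sub>v N"
      using col_mult_vec[OF W s'(3), of 0] e by simp
    then have "col Y 0 = 0\<^sub>v k" using ker[of "col Y 0"] s'(3) col_dim[of Y 0] by auto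
    then have "col (V * Y) 0 = 0\<^sub>v e"
      using col_mult_vec[OF s'(4,3), of 0] e s'(4) by (simp add: mult_mat_zero_vec)
    then have "(V * Y) $$ (0, 0) = 0" using e s'(3,4) by (metis (no_types, lifting) carrier_matD index_col index_mult_mat(2,3) index_zero_vec(1) neq0_conv)
    then show False using s'(6) e by simp
  qed
  then have rk: "r = k" using split_mats_dim[OF s] by simp
  then have RQ: "R * Q = 1\<^sub>m k" using mat_mult_left_right_inverse[of Q k R] f by simp
  then have "(R * L) * W = 1\<^sub>m k" using f by (simp add: mat_ring mult_absorb[OF f(6)])
  then show ?thesis using f by (meson mult_carrier_mat)
qed

text \<open>
  Stacking the columns of an \<open>n \<times> d\<close> matrix into a vector of length \<open>d n\<close> matches the block
  structure of \<^const>\<open>block_eval\<close>.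
\<close>

definition stack_family :: "nat \<Rightarrow> nat \<Rightarrow> nat \<Rightarrow> (nat \<Rightarrow> 'a::field mat) \<Rightarrow> 'a mat" where
  "stack_family k n d Z = mat (d * n) k (\<lambda>(p, l). Z l $$ (p mod n, p div n))"

lemma stack_index:
  assumes "j < (d::nat)" "i < n"
  shows "j * n + i < d * n" "(j * n + i) mod n = i" "(j * n + i) div n = j"
proof -
  have "j * n + i < j * n + n" using assms by simp
  also have "\<dots> = Suc j * n" by simp
  also have "\<dots> \<le> d * n" using assms by (intro mult_le_mono1) simp
  finally show "j * n + i < d * n" .
qed (use assms in auto)

lemma unstack_index:
  assumes "p < d * (n::nat)"
  shows "p mod n < n" "p div n < d" "p = (p div n) * n + p mod n"
proof -
  have "n > 0" using assms by (cases n) auto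
  then show "p mod n < n" by simp
  show "p div n < d" using assms by (simp add: less_mult_imp_div_less)
qed simp

lemma stack_family_kernel:
  assumes v: "v \<in> carrier_vec k"
  shows "stack_family k n d Z *\<^sub>v v = 0\<^sub>v (d * n) \<longleftrightarrow> lin_comb k (\<lambda>l. v $ l) Z n d = 0\<^sub>m n d"
proof -
  have eq: "(stack_family k n d Z *\<^sub>v v) $ p = lin_comb k (\<lambda>l. v $ l) Z n d $$ (p mod n, p div n)"
    if p: "p < d * n" for p
  proof -
    have "(stack_family k n d Z *\<^sub>v v) $ p = (\<Sum>l<k. stack_family k n d Z $$ (p, l) * v $ l)"
      using p v by (subst index_mult_vec_sum) (auto simp: stack_family_def)
    then show ?thesis using p unstack_index[OF p]
      by (simp add: stack_family_def lin_comb_def mult.commute)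
  qed
  show ?thesis
  proof
    assume l: "stack_family k n d Z *\<^sub>v v = 0\<^sub>v (d * n)"
    show "lin_comb k (\<lambda>l. v $ l) Z n d = 0\<^sub>m n d"
    proof (rule eq_matI)
      fix i j assume "i < dim_row (0\<^sub>m n d :: 'a mat)" "j < dim_col (0\<^sub>m n d :: 'a mat)"
      then have ij: "j < d" "i < n" by auto
      show "lin_comb k (\<lambda>l. v $ l) Z n d $$ (i, j) = 0\<^sub>m n d $$ (i, j)"
        using eq[OF stack_index(1)[OF ij]] stack_index[OF ij] l ij by simp
    qed auto
  next
    assume r: "lin_comb k (\<lambda>l. v $ l) Z n d = 0\<^sub>m n d"
    show "stack_family k n d Z *\<^sub>v v = 0\<^sub>v (d * n)"
    proof (rule eq_vecI)
      fix p assume "p < dim_vec (0\<^sub>v (d * n) :: 'a vec)"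
      then have p: "p < d * n" by simp
      show "(stack_family k n d Z *\<^sub>v v) $ p = 0\<^sub>v (d * n) $ p"
        using eq[OF p] r unstack_index[OF p] p by simp
    qed (simp add: stack_family_def)
  qed
qed

lemma indep_left_inverse:
  assumes "indep k n d Z"
  shows "\<exists>L \<in> carrier_mat k (d * n). L * stack_family k n d Z = 1\<^sub>m k"
proof (rule trivial_kernel_left_inverse)
  show "stack_family k n d Z \<in> carrier_mat (d * n) k" by (simp add: stack_family_def)
  fix v :: "'a vec" assume v: "v \<in> carrier_vec k" "stack_family k n d Z *\<^sub>v v = 0\<^sub>v (d * n)"
  then have "\<forall>l<k. v $ l = 0"
    using assms stack_family_kernel[OF v(1)] unfolding indep_def by blast
  then show "v = 0\<^sub>v k" using v by (intro eq_vecI) auto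
qed

lemma indep_bound:
  assumes "indep k n d Z"
  shows "k \<le> d * n"
proof -
  have "stack_family k n d Z \<in> carrier_mat (d * n) k" by (simp add: stack_family_def)
  then show ?thesis using indep_left_inverse[OF assms] left_invertible_le by blast
qed

section \<open>Representations of length two\<close>

lemma one_mat_not_zero: "0 < n \<Longrightarrow> 1\<^sub>m n \<noteq> (0\<^sub>m n n :: 'a::field mat)"
  by (metis index_one_mat(1) index_zero_mat(1) zero_neq_one)

lemma left_invertible_nonzero:
  assumes "L * P = (1\<^sub>m c :: 'a::field mat)" "L \<in> carrier_mat c n" "0 < c"
  shows "P \<noteq> 0\<^sub>m n c"
  using assms one_mat_not_zero[OF assms(3), where 'a = 'a] right_mult_zero_mat[OF assms(2), of c] by metis

lemma mat_minus_self: "A - A = 0\<^sub>m (dim_row A) (dim_col (A :: 'a::field mat))"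
  by (rule eq_matI) auto

text \<open>
  The quotient of \<open>B\<close> by the image of \<open>P\<close> has the dimension of \<open>D\<close>. As \<open>Q\<close> does not factor through
  \<open>P\<close>, it induces a nonzero map from \<open>D\<close> to this quotient, which is then an isomorphism.
\<close>

lemma direct_sum_criterion:
  assumes C: "simple_rep m c C" and D: "simple_rep m d D" and B: "rep m n B" and n: "n = c + d"
    and P: "P \<in> homs m c C n B" "P \<noteq> 0\<^sub>m n c" and Q: "Q \<in> homs m d D n B"
    and no: "\<And>X. X \<in> homs m d D c C \<Longrightarrow> Q \<noteq> P * X"
  shows "\<exists>L Y. split_mats n c d P L Q Y"
proof -
  note C' = simple_repD(1)[OF C] and D' = simple_repD(1)[OF D]
  obtain L where L: "L \<in> carrier_mat c n" "L * P = 1\<^sub>m c" using simple_source[OF C B P] by blast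
  obtain e Y W where s: "split_mats n c e P L Y W"
    using complement_exists[OF homs_carrier[OF P(1)] L] by blast
  have e: "e = d" using split_mats_dim[OF s] n by simp
  define E where "E t = W * B t * Y" for t
  have ses: "ses m n B c C d E P L Y W"
    using ses_of_mono[OF s P(1) C' B] unfolding E_def e .
  note s' = split_matsD[OF s[unfolded e]] and sd = sesD[OF ses]
  have WQ: "W * Q \<in> homs m d D d E" by (rule homs_comp[OF Q sd(6) D' B sd(4)])
  have "W * Q \<noteq> 0\<^sub>m d d"
    using ses_lift[OF ses Q D'] no by blast
  then obtain G where G: "G \<in> carrier_mat d d" "G * (W * Q) = 1\<^sub>m d"
    using simple_source[OF D sd(4) WQ] by blast
  have WQG: "W * Q * G = 1\<^sub>m d"
    using mat_mult_left_right_inverse[OF G(1) homs_carrier[OF WQ] G(2)] .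
  have DD: "dim_row P = n" "dim_col P = c" "dim_row Q = n" "dim_col Q = d" "dim_row G = d" "dim_col G = d"
    "dim_row L = c" "dim_col L = n" "dim_row W = d" "dim_col W = n" "dim_row Y = n" "dim_col Y = d"
    using sd(8-) homs_dims[OF Q] G by auto
  define L' where "L' = L - L * Q * G * W"
  have WQGX: "W * (Q * (G * X)) = X" if "dim_row X = d" for X
    using mult_absorb[OF WQG, of X] that by (simp add: DD mat_ring)
  have GWQ: "G * (W * Q) = 1\<^sub>m d" by (rule G(2))
  have "split_mats n c d P L' Q (G * W)"
    unfolding split_mats_def
  proof (intro conjI)
    show "P \<in> carrier_mat n c" "Q \<in> carrier_mat n d" using homs_carrier P(1) Q by blast+
    show "L' \<in> carrier_mat c n" unfolding L'_def using DD by (intro carrier_matI) simp_all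
    show "G * W \<in> carrier_mat d n" using DD by (intro carrier_matI) simp_all
    show "L' * P = 1\<^sub>m c" using s'(5,7) by (simp add: L'_def mat_ring DD) (auto intro: eq_matI)
    show "G * W * Q = 1\<^sub>m d" using GWQ by (simp add: mat_ring DD)
    show "G * W * P = 0\<^sub>m d c" using s'(7) by (simp add: mat_ring DD)
    show "L' * Q = 0\<^sub>m c d" using GWQ by (simp add: L'_def mat_ring DD mat_minus_self)
    have "Q * (G * W) = (P * L + Y * W) * (Q * (G * W))" unfolding s'(9) by (simp add: DD)
    also have "\<dots> = P * (L * (Q * (G * W))) + Y * W" by (simp add: mat_ring DD WQGX)
    finally have eq: "Q * (G * W) = P * (L * (Q * (G * W))) + Y * W" .
    have "P * L' + Q * (G * W) = P * L - P * (L * (Q * (G * W))) + Q * (G * W)"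
      by (simp add: L'_def mat_ring DD)
    also have "\<dots> = P * L - P * (L * (Q * (G * W))) + (P * (L * (Q * (G * W))) + Y * W)"
      by (subst (2) eq) simp
    also have "\<dots> = P * L + Y * W" by (intro eq_matI) (auto simp: DD)
    finally show "P * L' + Q * (G * W) = 1\<^sub>m n" using s'(9) by simp
  qed
  then show ?thesis by blast
qed

lemma simple_in_kernel:
  assumes A: "rep m n A" and B: "rep m p B" and f: "f \<in> homs m n A p B"
    and ni: "\<not> (\<exists>L \<in> carrier_mat n p. L * f = 1\<^sub>m n)"
  shows "\<exists>s S V L. simple_rep m s S \<and> V \<in> homs m s S n A \<and> L \<in> carrier_mat s n \<and> L * V = 1\<^sub>m s \<and>
     f * V = 0\<^sub>m p s"
proof -
  obtain r I P Q L R where F: "rep m r I" "P \<in> homs m r I p B" "Q \<in> homs m n A r I"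
     "L \<in> carrier_mat r p" "R \<in> carrier_mat n r" "f = P * Q" "L * P = 1\<^sub>m r" "Q * R = 1\<^sub>m r"
    using homs_image[OF f A B] by blast
  obtain e Y W where s: "split_mats n r e R Q Y W"
    using complement_exists[OF F(5) homs_carrier[OF F(3)] F(8)] by blast
  note ss = split_mats_sym[OF s] and s' = split_matsD[OF s]
  have ses: "ses m n A e (\<lambda>t. W * A t * Y) r I Y W R Q"
    by (rule ses_of_epi[OF ss F(3) F(1) A])
  note k = sesD[OF ses]
  have "e > 0"
  proof (rule ccontr)
    assume "\<not> e > 0"
    then have "r = n" using k(7) by simp
    then have "R * Q = 1\<^sub>m n"
      using mat_mult_left_right_inverse[of Q n R] F(5,8) homs_carrier[OF F(3)] by simp
    then have "(R * L) * f = 1\<^sub>m n"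
      using F(4,5) homs_dims[OF F(2)] homs_dims[OF F(3)] unfolding F(6)
      by (simp add: mat_ring mult_absorb[OF F(7)])
    then show False using ni F(4,5) by (meson mult_carrier_mat)
  qed
  then obtain c C V M where v: "simple_rep m c C" "V \<in> homs m c C e (\<lambda>t. W * A t * Y)"
      "M \<in> carrier_mat c e" "M * V = 1\<^sub>m c"
    using simple_sub_exists[OF k(3)] by blast
  have "Y * V \<in> homs m c C n A"
    by (rule homs_comp[OF v(2) k(5) simple_repD(1)[OF v(1)] k(3,2)])
  moreover have "(M * W) * (Y * V) = 1\<^sub>m c"
    using v(3,4) homs_dims[OF v(2)] k(8-) s'(6) by (simp add: mat_ring mult_absorb[OF s'(6)])
  moreover have "f * (Y * V) = 0\<^sub>m p c"
    using homs_dims[OF v(2)] homs_dims[OF F(2)] k(8-) unfolding F(6)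
    by (simp add: mat_ring mult_absorb[OF s'(8)])
  moreover have "M * W \<in> carrier_mat c n" using v(3) s'(4) by auto
  ultimately show ?thesis using v(1) by blast
qed

text \<open>
  As \<open>f\<close> does not vanish on the simple \<open>C\<close>, a simple subrepresentation of the kernel of \<open>f\<close> is not
  contained in \<open>C\<close>. So it maps isomorphically to \<open>D\<close>.
\<close>

lemma ses_splits:
  assumes s: "ses m n A c C d D P L Y Q" and C: "simple_rep m c C" and D: "simple_rep m d D"
    and B: "rep m p B" and f: "f \<in> homs m n A p B"
    and ni: "\<not> (\<exists>L \<in> carrier_mat n p. L * f = 1\<^sub>m n)" and fP: "f * P \<noteq> 0\<^sub>m p c"
  shows "\<exists>V \<in> homs m d D n A. Q * V = 1\<^sub>m d"
proof -
  note sd = sesD[OF s]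
  obtain e E V M where v: "simple_rep m e E" "V \<in> homs m e E n A" "M \<in> carrier_mat e n"
      "M * V = 1\<^sub>m e" "f * V = 0\<^sub>m p e"
    using simple_in_kernel[OF sd(2) B f ni] by blast
  note E' = simple_repD[OF v(1)]
  have QV: "Q * V \<in> homs m e E d D" by (rule homs_comp[OF v(2) sd(6) E'(1) sd(2,4)])
  have "Q * V \<noteq> 0\<^sub>m d e"
  proof
    assume 0: "Q * V = 0\<^sub>m d e"
    note l = ses_lift[OF s v(2) E'(1) 0]
    have "L * V \<noteq> 0\<^sub>m c e"
    proof
      assume "L * V = 0\<^sub>m c e"
      then have "V = 0\<^sub>m n e" using l(2) sd(8,9) by simp
      then show False using left_invertible_nonzero[OF v(4,3) E'(2)] by simp
    qed
    then obtain W where W: "W \<in> homs m c C e E" "(L * V) * W = 1\<^sub>m c"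
      using simple_simple(2)[OF v(1) C l(1)] by blast
    have "f * P = f * P * ((L * V) * W)" unfolding W(2) using homs_dims[OF f] sd(9) by simp
    also have "\<dots> = f * (P * (L * V)) * W"
      using homs_dims[OF f] sd(8-) homs_dims[OF v(2)] homs_dims[OF W(1)] by (simp add: mat_ring)
    also have "\<dots> = 0\<^sub>m p c" unfolding l(2)[symmetric] v(5) using homs_dims[OF W(1)] by simp
    finally show False using fP by simp
  qed
  then obtain W where W: "W \<in> homs m d D e E" "(Q * V) * W = 1\<^sub>m d"
    using simple_simple(2)[OF v(1) D QV] by blast
  have "V * W \<in> homs m d D n A" by (rule homs_comp[OF W(1) v(2) sd(4) E'(1) sd(2)])
  moreover have "Q * (V * W) = 1\<^sub>m d"
    using W(2) sd(8-) homs_dims[OF v(2)] homs_dims[OF W(1)] by (simp add: mat_ring)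
  ultimately show ?thesis by blast
qed

lemma smult_zero_mat: "a \<cdot>\<^sub>m 0\<^sub>m n k = (0\<^sub>m n k :: 'a::field mat)"
  by (rule eq_matI) auto

lemma zero_smult_add:
  "dim_row V = dim_row X \<Longrightarrow> dim_col V = dim_col X \<Longrightarrow> 0 \<cdot>\<^sub>m V + X = (X :: 'a::field mat)"
  by (rule eq_matI) auto

text \<open>
  Assume that no map from \<open>A\<close> to \<open>B\<close> is invertible. By \<open>direct_sum_criterion\<close>, all that is needed is a
  nonzero \<open>P'\<close> from \<open>C\<close> to \<open>B\<close> and a \<open>Q'\<close> from \<open>D\<close> to \<open>B\<close> that does not factor through \<open>P'\<close>. Maps from \<open>D\<close> to
  \<open>B\<close> arise in two ways. If some map from \<open>A\<close> to \<open>B\<close> is nonzero on \<open>C\<close>, then \<open>A\<close> splits by \<open>ses_splits\<close>,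
  and the maps from \<open>D\<close> to \<open>A\<close> count. If every map from \<open>A\<close> to \<open>B\<close> vanishes on \<open>C\<close>, then all of
  \<open>Hom(A, B)\<close> factors through \<open>D\<close>, and the endomorphisms of \<open>A\<close> count.
\<close>

theorem length_two_dichotomy:
  fixes A :: "nat \<Rightarrow> 'a::alg_closed_field mat"
  assumes s: "ses m n A c C d D P L Y Q" and C: "simple_rep m c C" and D: "simple_rep m d D"
    and B: "rep m n B" and dom: "hom_dominated m n A B"
  shows "(\<exists>Z \<in> homs m n A n B. \<exists>W \<in> carrier_mat n n. W * Z = 1\<^sub>m n \<and> Z * W = 1\<^sub>m n) \<or>
     (\<exists>P' \<in> homs m c C n B. \<exists>Q' \<in> homs m d D n B. \<exists>L' Y'. split_mats n c d P' L' Q' Y')"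
proof (cases "\<exists>f \<in> homs m n A n B. \<exists>L \<in> carrier_mat n n. L * f = 1\<^sub>m n")
  case True
  then obtain f M where f: "f \<in> homs m n A n B" "M \<in> carrier_mat n n" "M * f = 1\<^sub>m n" by blast
  have "f * M = 1\<^sub>m n" using mat_mult_left_right_inverse[OF f(2) homs_carrier[OF f(1)] f(3)] .
  then show ?thesis using f by blast
next
  case False
  then have ni: "\<And>f. f \<in> homs m n A n B \<Longrightarrow> \<not> (\<exists>L \<in> carrier_mat n n. L * f = 1\<^sub>m n)" by blast
  note sd = sesD[OF s] and s' = split_matsD[OF sesD(1)[OF s]]
  note C' = simple_repD[OF C] and D' = simple_repD[OF D]
  have n0: "n > 0" using sd(7) C'(2) by simp
  have QP0: "Q * (P * X) = 0\<^sub>m d k" if "dim_row X = c" "dim_col X = k" for X k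
    using that sd(8-) s'(7) by (simp add: mult_absorb[OF s'(7)])
  have "\<exists>P' \<in> homs m c C n B. \<exists>Q' \<in> homs m d D n B. P' \<noteq> 0\<^sub>m n c \<and> (\<forall>X \<in> homs m d D c C. Q' \<noteq> P' * X)"
  proof (cases "\<forall>X \<in> homs m d D c C. X = 0\<^sub>m c d")
    \<comment> \<open>Then only the zero map factors through \<open>P'\<close>.\<close>
    case True
    obtain P' where P': "P' \<in> homs m c C n B" "P' \<noteq> 0\<^sub>m n c"
      using hom_dominated_one[OF dom C'(1) sd(5) left_invertible_nonzero[OF s'(5,2) C'(2)]] by blast
    obtain f where f: "f \<in> homs m n A n B" "f \<noteq> 0\<^sub>m n n"
      using hom_dominated_one[OF dom sd(2) homs_one[OF sd(2)] one_mat_not_zero[OF n0]] by blast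
    have "\<exists>Q' \<in> homs m d D n B. Q' \<noteq> 0\<^sub>m n d"
    proof (cases "f * P = 0\<^sub>m n c")
      case True
      have "f * Y \<noteq> 0\<^sub>m n d"
        using ses_descend(2)[OF s f(1) B True] f(2) sd(8-) by auto
      then show ?thesis using ses_descend(1)[OF s f(1) B True] by blast
    next
      case False
      obtain V where V: "V \<in> homs m d D n A" "Q * V = 1\<^sub>m d"
        using ses_splits[OF s C D B f(1) ni[OF f(1)] False] by blast
      show ?thesis
        using hom_dominated_one[OF dom D'(1) V(1) left_invertible_nonzero[OF V(2) s'(4) D'(2)]] .
    qed
    then obtain Q' where Q': "Q' \<in> homs m d D n B" "Q' \<noteq> 0\<^sub>m n d" by blast
    have "Q' \<noteq> P' * X" if "X \<in> homs m d D c C" for X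
      using True that Q'(2) homs_dims[OF P'(1)] by auto
    then show ?thesis using P' Q' by blast
  next
    case False
    \<comment> \<open>Now \<open>C\<close> and \<open>D\<close> are isomorphic. By Schur's lemma the maps from \<open>D\<close> that factor through \<open>P' = Q1 W0\<close>
      are the multiples of \<open>Q1\<close>, so two independent maps from \<open>D\<close> to \<open>B\<close> suffice.\<close>
    then obtain X0 where X0: "X0 \<in> homs m d D c C" "X0 \<noteq> 0\<^sub>m c d" by blast
    obtain W0 where W0: "W0 \<in> homs m c C d D" "W0 * X0 = 1\<^sub>m d" "X0 * W0 = 1\<^sub>m c"
      using simple_simple(2)[OF D C X0] by blast
    note DD = sd(8-) homs_dims[OF X0(1)] homs_dims[OF W0(1)]
    have PX: "P * X0 \<in> homs m d D n A" by (rule homs_comp[OF X0(1) sd(5) D'(1) C'(1) sd(2)])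
    have PX0: "P * X0 \<noteq> 0\<^sub>m n d"
    proof
      assume "P * X0 = 0\<^sub>m n d"
      then have "L * (P * X0) = 0\<^sub>m c d" using DD by simp
      then show False using X0(2) DD by (simp add: mult_absorb[OF s'(5)])
    qed
    have "\<exists>Q1 \<in> homs m d D n B. \<exists>Q2 \<in> homs m d D n B.
       \<forall>a b. a \<cdot>\<^sub>m Q1 + b \<cdot>\<^sub>m Q2 = 0\<^sub>m n d \<longrightarrow> a = 0 \<and> b = 0"
    proof (cases "\<exists>f \<in> homs m n A n B. f * P \<noteq> 0\<^sub>m n c")
      case True
      then obtain f where f: "f \<in> homs m n A n B" "f * P \<noteq> 0\<^sub>m n c" by blast
      obtain V where V: "V \<in> homs m d D n A" "Q * V = 1\<^sub>m d"
        using ses_splits[OF s C D B f(1) ni[OF f(1)] f(2)] by blast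
      show ?thesis
      proof (rule hom_dominated_two[OF dom D'(1) V(1) PX])
        fix a b assume 0: "a \<cdot>\<^sub>m V + b \<cdot>\<^sub>m (P * X0) = 0\<^sub>m n d"
        have "Q * (a \<cdot>\<^sub>m V + b \<cdot>\<^sub>m (P * X0)) = a \<cdot>\<^sub>m 1\<^sub>m d"
          using V(2) by (simp add: mat_ring DD homs_dims[OF V(1)] QP0 smult_zero_mat)
        then have "a \<cdot>\<^sub>m 1\<^sub>m d = 0\<^sub>m d d" unfolding 0 using DD by simp
        then have a: "a = 0" using smult_eq_zero[OF one_carrier_mat one_mat_not_zero[OF D'(2)]] by blast
        have "b \<cdot>\<^sub>m (P * X0) = 0\<^sub>m n d"
          using 0 homs_dims[OF V(1)] DD unfolding a by (simp add: zero_smult_add)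
        then show "a = 0 \<and> b = 0" using a smult_eq_zero[OF homs_carrier[OF PX] PX0] by blast
      qed
    next
      case False
      have PXQ: "P * X0 * Q \<in> homs m n A n A" by (rule homs_comp[OF sd(6) PX sd(2,4,2)])
      have "\<exists>f0 \<in> homs m n A n B. \<exists>f1 \<in> homs m n A n B.
         \<forall>a b. a \<cdot>\<^sub>m f0 + b \<cdot>\<^sub>m f1 = 0\<^sub>m n n \<longrightarrow> a = 0 \<and> b = 0"
      proof (rule hom_dominated_two[OF dom sd(2) homs_one[OF sd(2)] PXQ])
        fix a b assume 0: "a \<cdot>\<^sub>m 1\<^sub>m n + b \<cdot>\<^sub>m (P * X0 * Q) = 0\<^sub>m n n"
        have "(a \<cdot>\<^sub>m 1\<^sub>m n + b \<cdot>\<^sub>m (P * X0 * Q)) * P = a \<cdot>\<^sub>m P"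
          using s'(7) by (simp add: mat_ring DD smult_zero_mat)
        then have "a \<cdot>\<^sub>m P = 0\<^sub>m n c" unfolding 0 using DD by simp
        then have a: "a = 0"
          using smult_eq_zero[OF s'(1) left_invertible_nonzero[OF s'(5,2) C'(2)]] by blast
        have "(a \<cdot>\<^sub>m 1\<^sub>m n + b \<cdot>\<^sub>m (P * X0 * Q)) * Y = a \<cdot>\<^sub>m Y + b \<cdot>\<^sub>m (P * X0)"
          using s'(6) by (simp add: mat_ring DD)
        also have "\<dots> = b \<cdot>\<^sub>m (P * X0)" unfolding a by (intro eq_matI) (auto simp: DD)
        finally have "b \<cdot>\<^sub>m (P * X0) = 0\<^sub>m n d" unfolding 0 using DD by simp
        then show "a = 0 \<and> b = 0" using a smult_eq_zero[OF homs_carrier[OF PX] PX0] by blast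
      qed
      then obtain f0 f1 where f: "f0 \<in> homs m n A n B" "f1 \<in> homs m n A n B"
        and ind: "\<And>a b. a \<cdot>\<^sub>m f0 + b \<cdot>\<^sub>m f1 = 0\<^sub>m n n \<Longrightarrow> a = 0 \<and> b = 0" by blast
      have fP: "f0 * P = 0\<^sub>m n c" "f1 * P = 0\<^sub>m n c" using f False by auto
      have "a = 0 \<and> b = 0" if 0: "a \<cdot>\<^sub>m (f0 * Y) + b \<cdot>\<^sub>m (f1 * Y) = 0\<^sub>m n d" for a b
      proof (rule ind)
        have "a \<cdot>\<^sub>m f0 + b \<cdot>\<^sub>m f1 = a \<cdot>\<^sub>m (f0 * Y * Q) + b \<cdot>\<^sub>m (f1 * Y * Q)"
          using ses_descend(2)[OF s f(1) B fP(1)] ses_descend(2)[OF s f(2) B fP(2)] by simp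
        also have "\<dots> = (a \<cdot>\<^sub>m (f0 * Y) + b \<cdot>\<^sub>m (f1 * Y)) * Q"
          by (simp add: mat_ring DD homs_dims[OF f(1)] homs_dims[OF f(2)])
        finally show "a \<cdot>\<^sub>m f0 + b \<cdot>\<^sub>m f1 = 0\<^sub>m n n" unfolding 0 using DD by simp
      qed
      then show ?thesis using ses_descend(1)[OF s f(1) B fP(1)] ses_descend(1)[OF s f(2) B fP(2)] by blast
    qed
    then obtain Q1 Q2 where q: "Q1 \<in> homs m d D n B" "Q2 \<in> homs m d D n B"
      and ind: "\<And>a b. a \<cdot>\<^sub>m Q1 + b \<cdot>\<^sub>m Q2 = 0\<^sub>m n d \<Longrightarrow> a = 0 \<and> b = 0" by blast
    note DQ = DD homs_dims[OF q(1)] homs_dims[OF q(2)]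
    have P': "Q1 * W0 \<in> homs m c C n B" by (rule homs_comp[OF W0(1) q(1) C'(1) D'(1) B])
    have nz: "Q1 * W0 \<noteq> 0\<^sub>m n c"
    proof
      assume 0: "Q1 * W0 = 0\<^sub>m n c"
      have "Q1 = (Q1 * W0) * X0" using W0(2) by (simp add: mat_ring DQ)
      then have "Q1 = 0\<^sub>m n d" unfolding 0 using DQ by simp
      then have "1 \<cdot>\<^sub>m Q1 + 0 \<cdot>\<^sub>m Q2 = 0\<^sub>m n d" using DQ by (intro eq_matI) auto
      then show False using ind by fastforce
    qed
    have "Q2 \<noteq> Q1 * W0 * X" if X: "X \<in> homs m d D c C" for X
    proof
      assume Q2: "Q2 = Q1 * W0 * X"
      have "W0 * X \<in> homs m d D d D" by (rule homs_comp[OF X W0(1) D'(1) C'(1) D'(1)])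
      then obtain a where a: "W0 * X = a \<cdot>\<^sub>m 1\<^sub>m d" using schur[OF D] by blast
      have "Q2 = Q1 * (W0 * X)" unfolding Q2 using homs_dims[OF X] DQ by (simp add: mat_ring)
      also have "\<dots> = a \<cdot>\<^sub>m Q1" unfolding a using DQ by (simp add: mat_ring)
      finally have "(- a) \<cdot>\<^sub>m Q1 + 1 \<cdot>\<^sub>m Q2 = 0\<^sub>m n d" using DQ by (intro eq_matI) auto
      then show False using ind by fastforce
    qed
    then show ?thesis using P' nz q(2) by blast
  qed
  then obtain P' Q' where P': "P' \<in> homs m c C n B" "P' \<noteq> 0\<^sub>m n c" and Q': "Q' \<in> homs m d D n B"
     and no: "\<And>X. X \<in> homs m d D c C \<Longrightarrow> Q' \<noteq> P' * X" by blast
  from direct_sum_criterion[OF C D B sd(7) P' Q' no] show ?thesis using P'(1) Q' by blast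
qed

section \<open>Length two is inherited downwards\<close>

lemma dominated_nonzero_hom:
  assumes "rep m n A" "n > 0" "hom_dominated m n A B"
  shows "\<exists>f \<in> homs m n A n B. f \<noteq> 0\<^sub>m n n"
  using hom_dominated_one[OF assms(3,1) homs_one[OF assms(1)] one_mat_not_zero[OF assms(2)]] .

lemma dominated_simple_source:
  assumes A: "simple_rep m n A" and B: "rep m n B" and dom: "hom_dominated m n A B"
  shows "\<exists>Z \<in> homs m n A n B. \<exists>W \<in> carrier_mat n n. W * Z = 1\<^sub>m n \<and> Z * W = 1\<^sub>m n"
proof -
  obtain f where f: "f \<in> homs m n A n B" "f \<noteq> 0\<^sub>m n n"
    using dominated_nonzero_hom[OF simple_repD[OF A] dom] by blast
  obtain W where W: "W \<in> carrier_mat n n" "W * f = 1\<^sub>m n"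
    using simple_source[OF A B f] by blast
  then show ?thesis using mat_mult_left_right_inverse[OF W(1) homs_carrier[OF f(1)] W(2)] f(1) by blast
qed

lemma dominated_simple_target:
  assumes B: "simple_rep m n B" and A: "rep m n A" and dom: "hom_dominated m n A B"
  shows "\<exists>Z \<in> homs m n A n B. \<exists>W \<in> carrier_mat n n. W * Z = 1\<^sub>m n \<and> Z * W = 1\<^sub>m n"
proof -
  obtain f where f: "f \<in> homs m n A n B" "f \<noteq> 0\<^sub>m n n"
    using dominated_nonzero_hom[OF A simple_repD(2)[OF B] dom] by blast
  obtain W where W: "W \<in> carrier_mat n n" "f * W = 1\<^sub>m n"
    using simple_target[OF B A f] by blast
  then show ?thesis using mat_mult_left_right_inverse[OF homs_carrier[OF f(1)] W] f(1) by blast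
qed

text \<open>
  If \<open>Hom(A, B)\<close> embeds into \<open>Hom(A, S)\<close> for a proper subrepresentation \<open>S\<close> of \<open>A\<close>, then it embeds
  into the endomorphisms of \<open>A\<close> with image in \<open>S\<close>, which do not include the identity. So
  \<open>dim End(A) > dim Hom(A, B)\<close>, against the domination hypothesis.
\<close>

lemma dominated_no_embedding:
  fixes A :: "nat \<Rightarrow> 'a::field mat"
  assumes A: "rep m n A" and B: "rep m n B" and S: "rep m s S" and dom: "hom_dominated m n A B"
    and U: "U \<in> homs m s S n A" "K \<in> carrier_mat s n" "K * U = 1\<^sub>m s" and sn: "s < n"
    and M: "M \<in> carrier_mat s n" "\<And>f. f \<in> homs m n A n B \<Longrightarrow> M * f \<in> homs m n A s S"
    and inj: "\<And>f. f \<in> homs m n A n B \<Longrightarrow> M * f = 0\<^sub>m s n \<Longrightarrow> f = 0\<^sub>m n n"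
  shows False
proof -
  have "\<exists>Z. (\<forall>i<k. Z i \<in> homs m n A n B) \<and> indep k n n Z" for k
  proof (induction k)
    case 0
    show ?case by (auto simp: indep_def)
  next
    case (Suc k)
    then obtain Z where Z: "\<And>i. i < k \<Longrightarrow> Z i \<in> homs m n A n B" "indep k n n Z" by blast
    have Zc: "\<And>i. i < k \<Longrightarrow> Z i \<in> carrier_mat n n" using Z(1) homs_carrier by blast
    define Z' where "Z' i = (if i < k then U * (M * Z i) else 1\<^sub>m n)" for i
    have Z': "\<forall>i<Suc k. Z' i \<in> homs m n A n A"
      using homs_comp[OF M(2)[OF Z(1)] U(1) A S A] homs_one[OF A] by (auto simp: Z'_def)
    have "indep (Suc k) n n Z'"
      unfolding indep_def
    proof (rule allI, rule impI)
      fix a assume 0: "lin_comb (Suc k) a Z' n n = 0\<^sub>m n n"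
      define f where "f = lin_comb k a Z n n"
      have f: "f \<in> homs m n A n B" unfolding f_def by (rule lin_comb_homs[OF A B Z(1)])
      note D = homs_dims[OF f] homs_dims[OF U(1)]
      have Mf: "M * f \<in> carrier_mat s n" using M(1) D by (intro carrier_matI) auto
      have MZ: "M * Z i \<in> carrier_mat s n" if "i < k" for i using M(1) Zc[OF that] by auto
      have "lin_comb k a Z' n n = lin_comb k a (\<lambda>i. U * (M * Z i)) n n"
        by (rule lin_comb_cong) (auto simp: Z'_def)
      also have "\<dots> = U * lin_comb k a (\<lambda>i. M * Z i) s n"
        using mult_lin_comb[OF homs_carrier[OF U(1)] MZ] by simp
      also have "lin_comb k a (\<lambda>i. M * Z i) s n = M * f"
        using mult_lin_comb[OF M(1) Zc] unfolding f_def by simp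
      finally have UMf: "lin_comb k a Z' n n = U * (M * f)" .
      have Z'k: "Z' k = 1\<^sub>m n" by (simp add: Z'_def)
      have eq: "U * (M * f) + a k \<cdot>\<^sub>m 1\<^sub>m n = 0\<^sub>m n n"
        using 0 lin_comb_Suc[of Z' k n n a] unfolding UMf Z'k by simp
      \<comment> \<open>Otherwise the identity of \<open>A\<close> would factor through \<open>S\<close>.\<close>
      have ak: "a k = 0"
      proof (rule ccontr)
        assume ak: "a k \<noteq> 0"
        have sm: "U * ((- inverse (a k)) \<cdot>\<^sub>m (M * f)) = (- inverse (a k)) \<cdot>\<^sub>m (U * (M * f))"
          by (rule mult_smult_dim) (use D Mf in auto)
        have "U * ((- inverse (a k)) \<cdot>\<^sub>m (M * f)) = 1\<^sub>m n"
          unfolding sm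
        proof (rule eq_matI)
          fix i j assume "i < dim_row (1\<^sub>m n :: 'a mat)" "j < dim_col (1\<^sub>m n :: 'a mat)"
          then have ij: "i < n" "j < n" by auto
          have "(U * (M * f)) $$ (i, j) + a k * (1\<^sub>m n $$ (i, j)) = 0"
            using arg_cong[OF eq, of "\<lambda>x. x $$ (i, j)"] ij Mf D by (simp del: index_mult_mat(1))
          then have "(- inverse (a k)) * (U * (M * f)) $$ (i, j) = 1\<^sub>m n $$ (i, j)"
            using ak by (simp add: field_simps del: index_mult_mat(1)) (metis add.commute add_eq_0_iff)
          then show "((- inverse (a k)) \<cdot>\<^sub>m (U * (M * f))) $$ (i, j) = 1\<^sub>m n $$ (i, j)"
            using ij Mf D by (simp del: index_mult_mat(1))
        qed (use D Mf in auto)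
        from left_invertible_le[OF _ homs_carrier[OF U(1)] this] Mf have "n \<le> s" by simp
        then show False using sn by simp
      qed
      have "U * (M * f) = U * (M * f) + a k \<cdot>\<^sub>m 1\<^sub>m n"
        unfolding ak using D Mf by (intro eq_matI) (auto simp del: index_mult_mat(1))
      then have "K * (U * (M * f)) = 0\<^sub>m s n" unfolding eq using U(2) by simp
      then have "M * f = 0\<^sub>m s n" using U(2) M(1) D by (simp add: mult_absorb[OF U(3)])
      then have "f = 0\<^sub>m n n" by (rule inj[OF f])
      then have "\<forall>i<k. a i = 0" using Z(2) unfolding indep_def f_def by blast
      then show "\<forall>i<Suc k. a i = 0" using ak by (auto simp: less_Suc_eq)
    qed
    then show ?case using dom A Z' unfolding hom_dominated_def by metis
  qed
  then obtain Z :: "nat \<Rightarrow> 'a mat" where "indep (Suc (n * n)) n n Z" by blast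
  from indep_bound[OF this] show False by simp
qed

lemma simple_rep_iso:
  assumes S: "simple_rep m s S" and K: "rep m s K" and Z: "Z \<in> homs m s S s K"
    and W: "W \<in> carrier_mat s s" "W * Z = 1\<^sub>m s"
  shows "simple_rep m s K"
  unfolding simple_rep_def
proof (intro conjI allI impI)
  have ZW: "Z * W = 1\<^sub>m s" by (rule mat_mult_left_right_inverse[OF W(1) homs_carrier[OF Z] W(2)])
  have Wh: "W \<in> homs m s K s S" by (rule homs_inverse[OF Z W ZW simple_repD(1)[OF S] K])
  fix r I P L assume I: "rep m r I" "P \<in> homs m r I s K" "L \<in> carrier_mat r s" "L * P = 1\<^sub>m r"
  have "W * P \<in> homs m r I s S" by (rule homs_comp[OF I(2) Wh I(1) K simple_repD(1)[OF S]])
  moreover have "(L * Z) * (W * P) = 1\<^sub>m r"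
    using homs_dims[OF I(2)] homs_dims[OF Z] W(1) I(3,4) by (simp add: mat_ring mult_absorb[OF ZW])
  moreover have "L * Z \<in> carrier_mat r s" using I(3) homs_carrier[OF Z] by (rule mult_carrier_mat)
  ultimately show "r = 0 \<or> r = s" using S I(1) unfolding simple_rep_def by blast
qed (use simple_repD[OF S] K in auto)

lemma simple_hom_to_length_two:
  assumes ses: "ses m n B c C d D P L Y Q" and W: "simple_rep m w W"
    and X: "X \<in> homs m w W n B" "X \<noteq> 0\<^sub>m n w"
  shows "(\<exists>f \<in> homs m w W c C. f \<noteq> 0\<^sub>m c w) \<or> (\<exists>f \<in> homs m w W d D. f \<noteq> 0\<^sub>m d w)"
proof (cases "Q * X = 0\<^sub>m d w")
  case True
  note sd = sesD[OF ses] and l = ses_lift[OF ses X(1) simple_repD(1)[OF W] True]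
  have "L * X \<noteq> 0\<^sub>m c w" using l(2) X(2) sd(8-) by auto
  then show ?thesis using l(1) by blast
next
  case False
  note sd = sesD[OF ses]
  show ?thesis using False homs_comp[OF X(1) sd(6) simple_repD(1)[OF W] sd(2,4)] by blast
qed

text \<open>
  The claim is that the kernel \<open>E\<close> of \<open>V\<close> is simple. If \<open>V\<close> vanishes on \<open>S\<close>, then \<open>S\<close> fills this kernel.
  If not, then \<open>S\<close> and \<open>T\<close> are isomorphic, and every simple subrepresentation of \<open>E\<close> has dimension
  \<open>s = dim E\<close> because of the hypothesis on dimensions.
\<close>

lemma length_two_of_sub_and_quotient:
  assumes A: "rep m n A" and S: "simple_rep m s S" and T: "simple_rep m t T" and n: "n = s + t"
    and U: "U \<in> homs m s S n A" "K \<in> carrier_mat s n" "K * U = 1\<^sub>m s"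
    and V: "V \<in> homs m n A t T" "V \<noteq> 0\<^sub>m t n"
    and dims: "\<And>w W X. simple_rep m w W \<Longrightarrow> X \<in> homs m w W n A \<Longrightarrow> X \<noteq> 0\<^sub>m n w \<Longrightarrow> w = s \<or> w = t"
  shows "\<exists>E P L Y Q. ses m n A s E t T P L Y Q \<and> simple_rep m s E"
proof -
  note S' = simple_repD[OF S] and T' = simple_repD[OF T]
  obtain R where R: "R \<in> carrier_mat n t" "V * R = 1\<^sub>m t" using simple_target[OF T A V] by blast
  obtain e P L where sp: "split_mats n t e R V P L"
    using complement_exists[OF R(1) homs_carrier[OF V(1)] R(2)] by blast
  have e: "e = s" using split_mats_dim[OF sp] n by simp
  define E where "E i = L * A i * P" for i
  have ses: "ses m n A s E t T P L R V"
    using ses_of_epi[OF split_mats_sym[OF sp] V(1) T'(1) A] unfolding E_def e .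
  note sd = sesD[OF ses] and s' = split_matsD[OF sesD(1)[OF ses]]
  have "simple_rep m s E"
  proof (cases "V * U = 0\<^sub>m t s")
    case True
    note l = ses_lift[OF ses U(1) S'(1) True]
    have "(K * P) * (L * U) = K * (P * (L * U))"
      using U(2) sd(8-) homs_dims[OF U(1)] by (simp add: mat_ring)
    also have "\<dots> = 1\<^sub>m s" unfolding l(2)[symmetric] by (rule U(3))
    finally show ?thesis
      using simple_rep_iso[OF S sd(3) l(1)] U(2) s'(1) by (meson mult_carrier_mat)
  next
    case False
    have "s = t"
      by (rule simple_simple(1)[OF S T homs_comp[OF U(1) V(1) S'(1) A T'(1)] False])
    have "r = 0 \<or> r = s" if I: "rep m r I" "X \<in> homs m r I s E" "M \<in> carrier_mat r s" "M * X = 1\<^sub>m r" for r I X M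
    proof (rule ccontr)
      assume r: "\<not> (r = 0 \<or> r = s)"
      have rs: "r \<le> s" by (rule left_invertible_le[OF homs_carrier[OF I(2)] I(3,4)])
      obtain w W F G where w: "simple_rep m w W" "F \<in> homs m w W r I" "G \<in> carrier_mat w r" "G * F = 1\<^sub>m w"
        using simple_sub_exists[OF I(1)] r by blast
      note w' = simple_repD[OF w(1)]
      have XF: "X * F \<in> homs m w W s E" by (rule homs_comp[OF w(2) I(2) w'(1) I(1) sd(3)])
      have h: "P * (X * F) \<in> homs m w W n A" by (rule homs_comp[OF XF sd(5) w'(1) sd(3) A])
      have "(G * M * L) * (P * (X * F)) = 1\<^sub>m w"
        using homs_dims[OF w(2)] homs_dims[OF I(2)] w(3,4) I(3) sd(8-)
        by (simp add: mat_ring mult_absorb[OF s'(5)] mult_absorb[OF I(4)])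
      moreover have "G * M * L \<in> carrier_mat w n" using w(3) I(3) s'(2) by (meson mult_carrier_mat)
      ultimately have "P * (X * F) \<noteq> 0\<^sub>m n w" using left_invertible_nonzero w'(2) by blast
      then have "w = s" using dims[OF w(1) h] \<open>s = t\<close> by blast
      moreover have "w \<le> r" by (rule left_invertible_le[OF homs_carrier[OF w(2)] w(3,4)])
      ultimately show False using r rs by simp
    qed
    then show ?thesis using sd(3) S'(2) unfolding simple_rep_def by blast
  qed
  then show ?thesis using ses by blast
qed

text \<open>
  A simple subrepresentation of \<open>A\<close> maps to \<open>B\<close> by domination, hence is isomorphic to \<open>C\<close> or \<open>D\<close>. Call
  it \<open>S\<close> and the other one \<open>T\<close>. If \<open>Hom(A, T) = 0\<close>, then \<open>Hom(A, B)\<close> embeds into \<open>Hom(A, S)\<close>, by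
  composition with \<open>L\<close> for \<open>S = C\<close> and with \<open>Q\<close> for \<open>S = D\<close>, which is impossible. So \<open>A\<close> maps onto \<open>T\<close>.
\<close>

theorem length_two_inherited:
  assumes ses: "ses m n B c C d D P L Y Q" and C: "simple_rep m c C" and D: "simple_rep m d D"
    and A: "rep m n A" and dom: "hom_dominated m n A B"
  shows "\<exists>c C d D P L Y Q. ses m n A c C d D P L Y Q \<and> simple_rep m c C \<and> simple_rep m d D"
proof -
  note sd = sesD[OF ses] and s' = split_matsD[OF sesD(1)[OF ses]]
  note C' = simple_repD[OF C] and D' = simple_repD[OF D]
  have target: "(\<exists>f \<in> homs m w W c C. f \<noteq> 0\<^sub>m c w) \<or> (\<exists>f \<in> homs m w W d D. f \<noteq> 0\<^sub>m d w)"
    if W: "simple_rep m w W" and X: "X \<in> homs m w W n A" "X \<noteq> 0\<^sub>m n w" for w W X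
    using hom_dominated_one[OF dom simple_repD(1)[OF W] X] simple_hom_to_length_two[OF ses W] by blast
  have dims: "w = c \<or> w = d" if "simple_rep m w W" "X \<in> homs m w W n A" "X \<noteq> 0\<^sub>m n w" for w W X
    using target[OF that] simple_simple(1)[OF that(1) C] simple_simple(1)[OF that(1) D] by blast
  have sub: "\<exists>U \<in> homs m w W n A. \<exists>K \<in> carrier_mat w n. K * U = 1\<^sub>m w"
    if S: "simple_rep m s S" and W: "simple_rep m w W" and U: "U \<in> homs m s S n A" "K \<in> carrier_mat s n" "K * U = 1\<^sub>m s"
      and f: "f \<in> homs m s S w W" "f \<noteq> 0\<^sub>m w s" for s S w W U K f
  proof -
    obtain g where g: "g \<in> homs m w W s S" "g * f = 1\<^sub>m s" "f * g = 1\<^sub>m w"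
      using simple_simple(2)[OF S W f] by blast
    have "U * g \<in> homs m w W n A"
      by (rule homs_comp[OF g(1) U(1) simple_repD(1)[OF W] simple_repD(1)[OF S] A])
    moreover have "(f * K) * (U * g) = 1\<^sub>m w"
      using U(2) homs_dims[OF U(1)] homs_dims[OF f(1)] homs_dims[OF g(1)] g(3)
      by (simp add: mat_ring mult_absorb[OF U(3)])
    moreover have "f * K \<in> carrier_mat w n" using homs_carrier[OF f(1)] U(2) by (rule mult_carrier_mat)
    ultimately show ?thesis by blast
  qed
  have n0: "n > 0" using sd(7) C'(2) by simp
  obtain s S U K where S: "simple_rep m s S" and U: "U \<in> homs m s S n A" "K \<in> carrier_mat s n" "K * U = 1\<^sub>m s"
    using simple_sub_exists[OF A n0] by blast
  have "U \<noteq> 0\<^sub>m n s" by (rule left_invertible_nonzero[OF U(3,2) simple_repD(2)[OF S]])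
  from target[OF S U(1) this] show ?thesis
  proof
    assume "\<exists>f \<in> homs m s S c C. f \<noteq> 0\<^sub>m c s"
    then obtain U K where U: "U \<in> homs m c C n A" "K \<in> carrier_mat c n" "K * U = 1\<^sub>m c"
      using sub[OF S C U] by blast
    show ?thesis
    proof (cases "\<forall>V \<in> homs m n A d D. V = 0\<^sub>m d n")
      case True
      have Qf: "Q * f = 0\<^sub>m d n" if "f \<in> homs m n A n B" for f
        using True homs_comp[OF that sd(6) A sd(2,4)] by blast
      have False
      proof (rule dominated_no_embedding[OF A sd(2) C'(1) dom U _ s'(2)])
        show "c < n" using sd(7) D'(2) by simp
        fix f assume f: "f \<in> homs m n A n B"
        note l = ses_lift[OF ses f A Qf[OF f]]
        show "L * f \<in> homs m n A c C" by (rule l(1))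
        show "f = 0\<^sub>m n n" if "L * f = 0\<^sub>m c n" using l(2) sd(8-) unfolding that by simp
      qed
      then show ?thesis ..
    next
      case False
      then obtain V where V: "V \<in> homs m n A d D" "V \<noteq> 0\<^sub>m d n" by blast
      have "\<exists>E P L Y Q. ses m n A c E d D P L Y Q \<and> simple_rep m c E"
        by (rule length_two_of_sub_and_quotient[OF A C D sd(7) U V]) (rule dims)
      then show ?thesis using D by blast
    qed
  next
    assume "\<exists>f \<in> homs m s S d D. f \<noteq> 0\<^sub>m d s"
    then obtain U K where U: "U \<in> homs m d D n A" "K \<in> carrier_mat d n" "K * U = 1\<^sub>m d"
      using sub[OF S D U] by blast
    show ?thesis
    proof (cases "\<forall>V \<in> homs m n A c C. V = 0\<^sub>m c n")
      case True
      have False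
      proof (rule dominated_no_embedding[OF A sd(2) D'(1) dom U _ s'(4)])
        show "d < n" using sd(7) C'(2) by simp
        fix f assume f: "f \<in> homs m n A n B"
        show "Q * f \<in> homs m n A d D" by (rule homs_comp[OF f sd(6) A sd(2,4)])
        show "f = 0\<^sub>m n n" if 0: "Q * f = 0\<^sub>m d n"
        proof -
          note l = ses_lift[OF ses f A 0]
          have "L * f = 0\<^sub>m c n" using True l(1) by blast
          then show ?thesis using l(2) sd(8-) by simp
        qed
      qed
      then show ?thesis ..
    next
      case False
      then obtain V where V: "V \<in> homs m n A c C" "V \<noteq> 0\<^sub>m c n" by blast
      have n': "n = d + c" using sd(7) by simp
      have "\<exists>E P L Y Q. ses m n A d E c C P L Y Q \<and> simple_rep m d E"
        by (rule length_two_of_sub_and_quotient[OF A D C n' U V]) (use dims in blast)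
      then show ?thesis using C by blast
    qed
  qed
qed

section \<open>Polynomial functions on matrix tuples\<close>

definition monomial_eval :: "'a::comm_ring_1 mat list \<Rightarrow> (nat \<times> nat \<times> nat \<Rightarrow>\<^sub>0 nat) \<Rightarrow> 'a" where
  "monomial_eval A c = (\<Prod>(t, i, j) \<in> Poly_Mapping.keys c. (A ! t $$ (i, j)) ^ Poly_Mapping.lookup c (t, i, j))"

lemma entry_poly_eval_monomials:
  "entry_poly_eval A p = (\<Sum>c \<in> Poly_Mapping.keys p. Poly_Mapping.lookup p c * monomial_eval A c)"
  by (simp add: entry_poly_eval_def monomial_eval_def)

lemma monomial_eval_superset:
  assumes "finite S" "Poly_Mapping.keys c \<subseteq> S"
  shows "monomial_eval A c = (\<Prod>(t, i, j) \<in> S. (A ! t $$ (i, j)) ^ Poly_Mapping.lookup c (t, i, j))"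
  unfolding monomial_eval_def
  by (rule prod.mono_neutral_left) (use assms in \<open>auto simp: in_keys_iff\<close>)

lemma monomial_eval_add: "monomial_eval A (c + d) = monomial_eval A c * monomial_eval A d"
proof -
  let ?S = "Poly_Mapping.keys c \<union> Poly_Mapping.keys d"
  have "monomial_eval A (c + d) =
     (\<Prod>(t, i, j) \<in> ?S. (A ! t $$ (i, j)) ^ Poly_Mapping.lookup (c + d) (t, i, j))"
    by (rule monomial_eval_superset) (auto simp: Poly_Mapping.keys_add)
  also have "\<dots> = (\<Prod>(t, i, j) \<in> ?S. (A ! t $$ (i, j)) ^ Poly_Mapping.lookup c (t, i, j)) *
     (\<Prod>(t, i, j) \<in> ?S. (A ! t $$ (i, j)) ^ Poly_Mapping.lookup d (t, i, j))"
    unfolding prod.distrib[symmetric] by (rule prod.cong) (auto simp: lookup_add power_add)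
  also have "\<dots> = monomial_eval A c * monomial_eval A d"
    by (subst (1 2) monomial_eval_superset[of ?S]) auto
  finally show ?thesis .
qed

lemma entry_poly_eval_add: "entry_poly_eval A (p + q) = entry_poly_eval A p + entry_poly_eval A q"
  unfolding entry_poly_eval_monomials by (rule setsum_keys_plus_distrib) (auto simp: algebra_simps)

lemma entry_poly_eval_zero: "entry_poly_eval A 0 = 0"
  by (simp add: entry_poly_eval_def)

lemma entry_poly_eval_sum: "entry_poly_eval A (\<Sum>i\<in>I. p i) = (\<Sum>i\<in>I. entry_poly_eval A (p i))"
  by (induction I rule: infinite_finite_induct) (auto simp: entry_poly_eval_add entry_poly_eval_zero)

lemma entry_poly_eval_single: "entry_poly_eval A (Poly_Mapping.single c a) = a * monomial_eval A c"
  by (cases "a = 0") (auto simp: entry_poly_eval_monomials)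

lemma sum_of_singles: "p = (\<Sum>c \<in> Poly_Mapping.keys p. Poly_Mapping.single c (Poly_Mapping.lookup p c))"
proof (rule poly_mapping_eqI)
  fix k
  show "Poly_Mapping.lookup p k =
    Poly_Mapping.lookup (\<Sum>c \<in> Poly_Mapping.keys p. Poly_Mapping.single c (Poly_Mapping.lookup p c)) k"
    by (cases "k \<in> Poly_Mapping.keys p")
       (auto simp: lookup_sum lookup_single when_def in_keys_iff)
qed

lemma entry_poly_eval_mult: "entry_poly_eval A (p * q) = entry_poly_eval A p * entry_poly_eval A q"
proof -
  have "p * q = (\<Sum>c \<in> Poly_Mapping.keys p. \<Sum>d \<in> Poly_Mapping.keys q.
     Poly_Mapping.single (c + d) (Poly_Mapping.lookup p c * Poly_Mapping.lookup q d))"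
    using arg_cong2[OF sum_of_singles[of p] sum_of_singles[of q], of "(*)"]
    unfolding sum_product mult_single .
  then have "entry_poly_eval A (p * q) = (\<Sum>c \<in> Poly_Mapping.keys p. \<Sum>d \<in> Poly_Mapping.keys q.
     (Poly_Mapping.lookup p c * Poly_Mapping.lookup q d) * (monomial_eval A c * monomial_eval A d))"
    by (simp add: entry_poly_eval_sum entry_poly_eval_single monomial_eval_add)
  then show ?thesis
    by (simp add: entry_poly_eval_monomials sum_product ac_simps)
qed

definition poly_fun :: "nat \<Rightarrow> nat \<Rightarrow> ('a::comm_ring_1 mat list \<Rightarrow> 'a) \<Rightarrow> bool" where
  "poly_fun n m f \<longleftrightarrow> (\<exists>p \<in> entry_polys n m. \<forall>A \<in> mat_tuples n m. f A = entry_poly_eval A p)"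

lemma poly_fun_const: "poly_fun n m (\<lambda>_. a)"
  unfolding poly_fun_def
  by (rule bexI[of _ "Poly_Mapping.single 0 a"])
     (auto simp: entry_poly_eval_single monomial_eval_def entry_polys_def)

lemma poly_fun_entry: "t < m \<Longrightarrow> i < n \<Longrightarrow> j < n \<Longrightarrow> poly_fun n m (\<lambda>A. A ! t $$ (i, j))"
  unfolding poly_fun_def
  by (rule bexI[of _ "Poly_Mapping.single (Poly_Mapping.single (t, i, j) 1) 1"])
     (auto simp: entry_poly_eval_single monomial_eval_def entry_polys_def)

lemma poly_fun_add: "poly_fun n m f \<Longrightarrow> poly_fun n m g \<Longrightarrow> poly_fun n m (\<lambda>A. f A + g A)"
  unfolding poly_fun_def
proof (elim bexE)
  fix p q assume pq: "p \<in> entry_polys n m" "q \<in> entry_polys n m"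
    "\<forall>A \<in> mat_tuples n m. f A = entry_poly_eval A p" "\<forall>A \<in> mat_tuples n m. g A = entry_poly_eval A q"
  have "p + q \<in> entry_polys n m"
    using pq(1,2) Poly_Mapping.keys_add[of p q] unfolding entry_polys_def by blast
  then show "\<exists>p \<in> entry_polys n m. \<forall>A \<in> mat_tuples n m. f A + g A = entry_poly_eval A p"
    using pq by (intro bexI[of _ "p + q"]) (auto simp: entry_poly_eval_add)
qed

lemma poly_fun_mult: "poly_fun n m f \<Longrightarrow> poly_fun n m g \<Longrightarrow> poly_fun n m (\<lambda>A. f A * g A)"
  unfolding poly_fun_def
proof (elim bexE)
  fix p q assume pq: "p \<in> entry_polys n m" "q \<in> entry_polys n m"
    "\<forall>A \<in> mat_tuples n m. f A = entry_poly_eval A p" "\<forall>A \<in> mat_tuples n m. g A = entry_poly_eval A q"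
  have "Poly_Mapping.keys c \<subseteq> {..<m} \<times> {..<n} \<times> {..<n}" if c: "c \<in> Poly_Mapping.keys (p * q)" for c
  proof -
    obtain a b where "c = a + b" "a \<in> Poly_Mapping.keys p" "b \<in> Poly_Mapping.keys q"
      using c keys_mult[of p q] by blast
    then show ?thesis using pq(1,2) Poly_Mapping.keys_add[of a b] unfolding entry_polys_def by blast
  qed
  then have "p * q \<in> entry_polys n m" unfolding entry_polys_def by blast
  then show "\<exists>p \<in> entry_polys n m. \<forall>A \<in> mat_tuples n m. f A * g A = entry_poly_eval A p"
    using pq by (intro bexI[of _ "p * q"]) (auto simp: entry_poly_eval_mult)
qed

lemma poly_fun_cong:
  "(\<And>A. A \<in> mat_tuples n m \<Longrightarrow> f A = g A) \<Longrightarrow> poly_fun n m g \<Longrightarrow> poly_fun n m f"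
  by (simp add: poly_fun_def)

lemma poly_fun_sum: "(\<And>i. i \<in> I \<Longrightarrow> poly_fun n m (f i)) \<Longrightarrow> poly_fun n m (\<lambda>A. \<Sum>i\<in>I. f i A)"
  by (induction I rule: infinite_finite_induct) (auto intro: poly_fun_const poly_fun_add)

lemma poly_fun_prod: "(\<And>i. i \<in> I \<Longrightarrow> poly_fun n m (f i)) \<Longrightarrow> poly_fun n m (\<lambda>A. \<Prod>i\<in>I. f i A)"
  by (induction I rule: infinite_finite_induct) (auto intro: poly_fun_const poly_fun_mult)

text \<open>The smallest closed set is cut out by all polynomials that vanish on the orbit.\<close>

lemma deg_le_iff:
  assumes "B \<in> mat_tuples n m" "conj_orbit n A \<subseteq> mat_tuples n m"
  shows "deg_le n m A B \<longleftrightarrow>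
    (\<forall>p \<in> entry_polys n m. (\<forall>X \<in> conj_orbit n A. entry_poly_eval X p = 0) \<longrightarrow> entry_poly_eval B p = 0)"
    (is "_ \<longleftrightarrow> ?r")
proof
  assume d: "deg_le n m A B"
  show ?r
  proof (intro ballI impI)
    fix p assume p: "p \<in> entry_polys n m" "\<forall>X \<in> conj_orbit n A. entry_poly_eval X p = 0"
    let ?Z = "{A \<in> mat_tuples n m. \<forall>q \<in> {p}. entry_poly_eval A q = 0}"
    have "zariski_closed n m ?Z" unfolding zariski_closed_def using p(1) by (intro exI[of _ "{p}"]) auto
    moreover have "conj_orbit n A \<subseteq> ?Z" using assms p by auto
    ultimately have "B \<in> ?Z" using d unfolding deg_le_def hull_def by blast
    then show "entry_poly_eval B p = 0" by simp
  qed
next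
  assume r: ?r
  have "B \<in> Z" if Z: "zariski_closed n m Z" "conj_orbit n A \<subseteq> Z" for Z
  proof -
    obtain P where P: "P \<subseteq> entry_polys n m" "Z = {A \<in> mat_tuples n m. \<forall>p \<in> P. entry_poly_eval A p = 0}"
      using Z(1) unfolding zariski_closed_def by blast
    have "entry_poly_eval B p = 0" if p: "p \<in> P" for p
      using r P Z(2) p by blast
    then show ?thesis using P(2) assms(1) by simp
  qed
  then show "deg_le n m A B" unfolding deg_le_def hull_def by blast
qed

lemma mat_tuples_rep: "A \<in> mat_tuples n m \<longleftrightarrow> length A = m \<and> rep m n ((!) A)"
  by (auto simp: mat_tuples_def rep_def set_conv_nth)

lemma conj_orbit_tuples: "A \<in> mat_tuples n m \<Longrightarrow> conj_orbit n A \<subseteq> mat_tuples n m"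
  unfolding conj_orbit_def mat_tuples_def by fastforce

lemma conj_orbitI:
  assumes A: "A \<in> mat_tuples n m" and B: "length B = m"
    and g: "g \<in> carrier_mat n n" "h \<in> carrier_mat n n" "g * h = 1\<^sub>m n" "h * g = 1\<^sub>m n"
    and eq: "\<And>t. t < m \<Longrightarrow> B ! t = g * A ! t * h"
  shows "B \<in> conj_orbit n A"
proof -
  have "B = map (\<lambda>X. g * X * h) A"
    by (rule nth_equalityI) (use A B eq in \<open>auto simp: mat_tuples_def\<close>)
  then show ?thesis unfolding conj_orbit_def inverts_mat_def using g by auto
qed

section \<open>Extensions degenerate to direct sums\<close>

lemma infinite_alg_closed: "infinite (UNIV :: 'a::alg_closed_field set)"
proof
  assume fin: "finite (UNIV :: 'a set)"
  \<comment> \<open>The polynomial \<open>?p + 1\<close> takes the value \<open>1\<close> everywhere.\<close>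
  let ?p = "\<Prod>a\<in>(UNIV :: 'a set). [:- a, 1:]"
  have d: "degree ?p = card (UNIV :: 'a set)"
    by (subst degree_prod_sum_eq) auto
  have c: "card (UNIV :: 'a set) > 0" using fin by (simp add: card_gt_0_iff)
  have "degree (?p + 1) > 0" using d c by (subst degree_add_eq_left) auto
  then obtain x where "poly (?p + 1) x = 0" using alg_closed_imp_poly_has_root by blast
  moreover have "poly ?p x = 0" using fin by (auto simp: poly_prod)
  ultimately show False by simp
qed

lemma poly_zero_at_zero:
  fixes p :: "'a::alg_closed_field poly"
  assumes "\<And>s. s \<noteq> 0 \<Longrightarrow> poly p s = 0"
  shows "poly p 0 = 0"
proof (cases "p = 0")
  case False
  have "infinite (UNIV - {0 :: 'a})" using infinite_alg_closed by simp
  moreover have "UNIV - {0} \<subseteq> {s. poly p s = 0}" using assms by auto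
  ultimately show ?thesis using poly_roots_finite[OF False] finite_subset by blast
qed simp

lemma entry_poly_eval_line:
  fixes p :: "'a::field entry_poly"
  assumes p: "p \<in> entry_polys n m" and B: "length B = m" "rep m n ((!) B)" and N: "rep m n N"
  shows "\<exists>q. \<forall>s. poly q s = entry_poly_eval (map (\<lambda>t. B ! t + s \<cdot>\<^sub>m N t) [0..<m]) p"
proof -
  let ?q = "\<Sum>c \<in> Poly_Mapping.keys p. [:Poly_Mapping.lookup p c:] * (\<Prod>(t, i, j) \<in> Poly_Mapping.keys c.
     [:B ! t $$ (i, j), N t $$ (i, j):] ^ Poly_Mapping.lookup c (t, i, j))"
  have "poly ?q s = entry_poly_eval (map (\<lambda>t. B ! t + s \<cdot>\<^sub>m N t) [0..<m]) p" for s
  proof -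
    have "(B ! t $$ (i, j) + s * N t $$ (i, j)) = map (\<lambda>t. B ! t + s \<cdot>\<^sub>m N t) [0..<m] ! t $$ (i, j)"
      if "c \<in> Poly_Mapping.keys p" "(t, i, j) \<in> Poly_Mapping.keys c" for c t i j
    proof -
      have "t < m" "i < n" "j < n" using that p unfolding entry_polys_def by blast+
      then show ?thesis using B N by (auto simp: rep_def)
    qed
    then show ?thesis
      unfolding entry_poly_eval_def
      by (auto simp: poly_sum poly_prod poly_power case_prod_unfold intro!: sum.cong arg_cong2[of _ _ _ _ "(*)"] prod.cong)
  qed
  then show ?thesis by blast
qed

lemma deg_le_of_iso:
  assumes A: "A \<in> mat_tuples n m" and B: "B \<in> mat_tuples n m"
    and Z: "Z \<in> homs m n ((!) A) n ((!) B)" and W: "W \<in> carrier_mat n n" "W * Z = 1\<^sub>m n" "Z * W = 1\<^sub>m n"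
  shows "deg_le n m A B"
proof -
  have rB: "rep m n ((!) B)" and B': "length B = m" using B by (auto simp: mat_tuples_rep)
  have "B \<in> conj_orbit n A"
  proof (rule conj_orbitI[OF A B' homs_carrier[OF Z] W(1,3,2)])
    fix t assume t: "t < m"
    have "Z * A ! t * W = B ! t * (Z * W)"
      using homs_eq[OF Z t, symmetric] homs_dims[OF Z] W(1) rep_dims[OF rB t] by (simp add: mat_ring)
    then show "B ! t = Z * A ! t * W" using rep_dims[OF rB t] unfolding W(3) by simp
  qed
  then show ?thesis using deg_le_iff[OF B conj_orbit_tuples[OF A]] by blast
qed

text \<open>
  In adapted bases \<open>A\<close> is block triangular with diagonal blocks \<open>C\<close>, \<open>D\<close>. Conjugation by
  \<open>diag(1, 1/s)\<close> multiplies the off-diagonal block by \<open>s\<close>, and \<open>B\<close> is the limit \<open>s = 0\<close>.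
\<close>

lemma deg_le_of_direct_sum:
  fixes A B :: "'a::alg_closed_field mat list"
  assumes A: "A \<in> mat_tuples n m" and B: "B \<in> mat_tuples n m"
    and ses: "ses m n ((!) A) c C d D P L Y Q"
    and P': "P' \<in> homs m c C n ((!) B)" and Q': "Q' \<in> homs m d D n ((!) B)"
    and sp: "split_mats n c d P' L' Q' Y'"
  shows "deg_le n m A B"
proof -
  note sd = sesD[OF ses] and s = split_matsD[OF sesD(1)[OF ses]] and s' = split_matsD[OF sp]
  have rB: "rep m n ((!) B)" and B': "length B = m" using B by (auto simp: mat_tuples_rep)
  define N where "N t = P' * (L * A ! t * Y) * Y'" for t
  have N: "rep m n N" using sd(2) s(2,3) s'(1,4) unfolding rep_def N_def by (meson mult_carrier_mat)
  have DD: "dim_row P' = n" "dim_col P' = c" "dim_row L' = c" "dim_col L' = n"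
    "dim_row Q' = n" "dim_col Q' = d" "dim_row Y' = d" "dim_col Y' = n" using s' by auto
  note DD = DD sd(8-)
  have orbit: "map (\<lambda>t. B ! t + x \<cdot>\<^sub>m N t) [0..<m] \<in> conj_orbit n A" if x: "x \<noteq> 0" for x
  proof -
    define g where "g = P' * L + inverse x \<cdot>\<^sub>m (Q' * Q)"
    define h where "h = P * L' + x \<cdot>\<^sub>m (Y * Y')"
    have g: "g \<in> carrier_mat n n" and h: "h \<in> carrier_mat n n"
      using DD by (auto simp: g_def h_def intro!: carrier_matI)
    have gP: "g * P = P'" and gY: "g * Y = inverse x \<cdot>\<^sub>m Q'"
      using s(5-8) by (simp_all add: g_def mat_ring DD smult_zero_mat)
    have gh: "g * h = 1\<^sub>m n"
    proof -
      have "g * h = (g * P) * L' + x \<cdot>\<^sub>m ((g * Y) * Y')"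
        using g by (simp add: h_def mat_ring DD)
      also have "\<dots> = P' * L' + Q' * Y'"
        unfolding gP gY using x DD by (intro eq_matI) (auto simp: mat_ring simp del: index_mult_mat(1))
      finally show ?thesis using s'(9) by simp
    qed
    show ?thesis
    proof (rule conj_orbitI[OF A _ g h gh mat_mult_left_right_inverse[OF g h gh]])
      fix t assume t: "t < m"
      note D' = DD rep_dims[OF sd(2) t] rep_dims[OF sd(3) t] rep_dims[OF sd(4) t] rep_dims[OF rB t]
      have gD: "dim_row g = n" "dim_col g = n" using g by auto
      have AY: "A ! t * Y = P * (L * A ! t * Y) + Y * D t"
      proof -
        have "A ! t * Y = (P * L + Y * Q) * (A ! t * Y)" using s(9) D' by simp
        also have "\<dots> = P * (L * A ! t * Y) + Y * ((Q * A ! t) * Y)" by (simp add: mat_ring D')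
        also have "(Q * A ! t) * Y = D t"
          unfolding homs_eq[OF sd(6) t, symmetric] using s(6) by (simp add: mat_ring D')
        finally show ?thesis .
      qed
      have BB: "B ! t = P' * C t * L' + Q' * D t * Y'"
      proof -
        have "B ! t = B ! t * (P' * L' + Q' * Y')" using s'(9) D' by simp
        also have "\<dots> = (B ! t * P') * L' + (B ! t * Q') * Y'" by (simp add: mat_ring D')
        finally show ?thesis unfolding homs_eq[OF P' t] homs_eq[OF Q' t] .
      qed
      have "g * A ! t * h = g * (A ! t * P) * L' + x \<cdot>\<^sub>m (g * (A ! t * Y) * Y')"
        by (simp add: h_def mat_ring D' gD)
      also have "g * (A ! t * P) = P' * C t"
        unfolding homs_eq[OF sd(5) t] gP[symmetric] by (simp add: mat_ring D' gD)
      also have "g * (A ! t * Y) = (g * P) * (L * A ! t * Y) + (g * Y) * D t"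
        unfolding AY by (simp add: mat_ring D' gD)
      also have "\<dots> = P' * (L * A ! t * Y) + inverse x \<cdot>\<^sub>m (Q' * D t)"
        unfolding gP gY by (simp add: mat_ring D')
      also have "x \<cdot>\<^sub>m ((P' * (L * A ! t * Y) + inverse x \<cdot>\<^sub>m (Q' * D t)) * Y') =
          x \<cdot>\<^sub>m N t + Q' * D t * Y'"
        unfolding N_def using x D'
        by (intro eq_matI) (auto simp: mat_ring algebra_simps simp del: index_mult_mat(1))
      also have "P' * C t * L' + (x \<cdot>\<^sub>m N t + Q' * D t * Y') = B ! t + x \<cdot>\<^sub>m N t"
        unfolding BB using D' rep_dims[OF N t] by (intro eq_matI) (auto simp del: index_mult_mat(1))
      finally show "map (\<lambda>t. B ! t + x \<cdot>\<^sub>m N t) [0..<m] ! t = g * A ! t * h" using t by simp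
    qed simp
  qed
  show ?thesis
    unfolding deg_le_iff[OF B conj_orbit_tuples[OF A]]
  proof (intro ballI impI)
    fix p assume p: "p \<in> entry_polys n m" "\<forall>X \<in> conj_orbit n A. entry_poly_eval X p = 0"
    obtain q where q: "\<And>x. poly q x = entry_poly_eval (map (\<lambda>t. B ! t + x \<cdot>\<^sub>m N t) [0..<m]) p"
      using entry_poly_eval_line[OF p(1) B' rB N] by blast
    have "poly q 0 = 0" by (rule poly_zero_at_zero) (use q p(2) orbit in auto)
    moreover have "map (\<lambda>t. B ! t + 0 \<cdot>\<^sub>m N t) [0..<m] = B"
    proof (rule nth_equalityI)
      fix t assume "t < length (map (\<lambda>t. B ! t + 0 \<cdot>\<^sub>m N t) [0..<m])"
      then have t: "t < m" by simp
      then show "map (\<lambda>t. B ! t + 0 \<cdot>\<^sub>m N t) [0..<m] ! t = B ! t"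
        using rep_dims[OF rB t] rep_dims[OF N t] by (auto intro!: eq_matI)
    qed (simp add: B')
    ultimately show "entry_poly_eval B p = 0" using q[of 0] by simp
  qed
qed

section \<open>The hom order and intertwiners\<close>

lemma rank_eq_inner_dim:
  fixes P Q :: "'a::field mat"
  assumes P: "P \<in> carrier_mat nr r" and Q: "Q \<in> carrier_mat r nc" and L: "L \<in> carrier_mat r nr" "L * P = 1\<^sub>m r"
    and R: "R \<in> carrier_mat nc r" "Q * R = 1\<^sub>m r"
  shows "vec_space.rank nr (P * Q) = r"
proof -
  interpret V: vec_space "TYPE('a)" nr .
  have PQ: "P * Q \<in> carrier_mat nr nc" using P Q by simp
  have "V.col_space (P * Q) = V.col_space P"
    unfolding V.col_space_eq[OF PQ] V.col_space_eq[OF P]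
  proof (intro equalityI subsetI; clarsimp)
    fix x :: "'a vec" assume x: "x \<in> carrier_vec (dim_col Q)" "P * Q *\<^sub>v x \<in> carrier_vec (dim_row P)"
    have "P * Q *\<^sub>v x = P *\<^sub>v (Q *\<^sub>v x)" using P Q x by (intro assoc_mult_mat_vec) auto
    moreover have "Q *\<^sub>v x \<in> carrier_vec (dim_col P)" using P Q x by (intro mult_mat_vec_carrier) auto
    ultimately show "\<exists>y \<in> carrier_vec (dim_col P). P *\<^sub>v y = P * Q *\<^sub>v x" by auto
  next
    fix x :: "'a vec" assume x: "x \<in> carrier_vec (dim_col P)" "P *\<^sub>v x \<in> carrier_vec (dim_row P)"
    have xr: "x \<in> carrier_vec r" using x P by auto
    have "P * Q *\<^sub>v (R *\<^sub>v x) = P *\<^sub>v (Q *\<^sub>v (R *\<^sub>v x))"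
      using P Q R xr by (intro assoc_mult_mat_vec) auto
    also have "Q *\<^sub>v (R *\<^sub>v x) = (Q * R) *\<^sub>v x" by (rule assoc_mult_mat_vec[symmetric, OF Q R(1) xr])
    also have "\<dots> = x" using R xr by simp
    finally have "P * Q *\<^sub>v (R *\<^sub>v x) = P *\<^sub>v x" .
    moreover have "R *\<^sub>v x \<in> carrier_vec (dim_col Q)" using Q mult_mat_vec_carrier[OF R(1) xr] by auto
    ultimately show "\<exists>y \<in> carrier_vec (dim_col Q). P * Q *\<^sub>v y = P *\<^sub>v x" by blast
  qed
  then have eq: "V.rank (P * Q) = V.rank P" unfolding V.rank_def V.col_space_def by simp
  have Lc: "L *\<^sub>v col P j = unit_vec r j" if "j < r" for j
    using col_mult_vec[OF L(1) P that] that L(2) by simp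
  have inj: "j = k" if "j < r" "k < r" "col P j = col P k" for j k
  proof -
    have "unit_vec r j = (unit_vec r k :: 'a vec)" using Lc that by metis
    then show ?thesis using that by (metis index_unit_vec(1) zero_neq_one)
  qed
  have dist: "distinct (cols P)"
    using inj P by (auto simp: distinct_conv_nth)
  have "V.lin_indpt (set (cols P))"
  proof
    assume "V.lin_dep (set (cols P))"
    from V.lin_depE[OF P this dist] obtain v where v: "v \<in> carrier_vec r" "v \<noteq> 0\<^sub>v r" "P *\<^sub>v v = 0\<^sub>v nr" by blast
    have "v = (L * P) *\<^sub>v v" using L v by simp
    also have "\<dots> = L *\<^sub>v (P *\<^sub>v v)" by (rule assoc_mult_mat_vec[OF L(1) P v(1)])
    also have "\<dots> = 0\<^sub>v r" unfolding v(3) using L(1) by (rule mult_mat_zero_vec)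
    finally show False using v(2) by simp
  qed
  then have "V.rank P = r" by (rule V.lin_indpt_full_rank[OF P dist])
  then show ?thesis using eq by simp
qed

lemma rank_factorization_rank:
  fixes M :: "'a::field mat"
  assumes "M \<in> carrier_mat nr nc"
  shows "\<exists>P Q L R. P \<in> carrier_mat nr (vec_space.rank nr M) \<and> Q \<in> carrier_mat (vec_space.rank nr M) nc \<and>
     L \<in> carrier_mat (vec_space.rank nr M) nr \<and> R \<in> carrier_mat nc (vec_space.rank nr M) \<and> M = P * Q \<and>
     L * P = 1\<^sub>m (vec_space.rank nr M) \<and> Q * R = 1\<^sub>m (vec_space.rank nr M)"
proof -
  obtain r P Q L R where f: "P \<in> carrier_mat nr r" "Q \<in> carrier_mat r nc" "L \<in> carrier_mat r nr"
     "R \<in> carrier_mat nc r" "M = P * Q" "L * P = 1\<^sub>m r" "Q * R = 1\<^sub>m r"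
    using rank_factorization[OF assms] by blast
  have "vec_space.rank nr M = r" unfolding f(5) by (rule rank_eq_inner_dim[OF f(1-3,6,4,7)])
  then show ?thesis using f by blast
qed

lemma nc_eval_index:
  "i < n \<Longrightarrow> j < n \<Longrightarrow> nc_eval n A f $$ (i, j) =
     (\<Sum>w \<in> Poly_Mapping.keys f. Poly_Mapping.lookup f w * word_eval n A w $$ (i, j))"
  by (simp add: nc_eval_def)

lemma nc_eval_carrier [simp]: "nc_eval n A f \<in> carrier_mat n n"
  by (simp add: nc_eval_def)

lemma nc_eval_dims [simp]: "dim_row (nc_eval n A f) = n" "dim_col (nc_eval n A f) = n"
  by (simp_all add: nc_eval_def)

lemma nc_eval_add: "nc_eval n A (f + g) = nc_eval n A f + nc_eval n A g"
proof (rule eq_matI)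
  fix i j assume "i < dim_row (nc_eval n A f + nc_eval n A g)" "j < dim_col (nc_eval n A f + nc_eval n A g)"
  then have ij: "i < n" "j < n" by (auto simp: nc_eval_def)
  have "(\<Sum>w \<in> Poly_Mapping.keys (f + g). Poly_Mapping.lookup (f + g) w * word_eval n A w $$ (i, j)) =
     (\<Sum>w \<in> Poly_Mapping.keys f. Poly_Mapping.lookup f w * word_eval n A w $$ (i, j)) +
     (\<Sum>w \<in> Poly_Mapping.keys g. Poly_Mapping.lookup g w * word_eval n A w $$ (i, j))"
    by (rule setsum_keys_plus_distrib) (auto simp: algebra_simps)
  then show "nc_eval n A (f + g) $$ (i, j) = (nc_eval n A f + nc_eval n A g) $$ (i, j)"
    using ij by (simp add: nc_eval_def)
qed (auto simp: nc_eval_def)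

lemma word_eval_simps:
  "word_eval n A (Word []) = 1\<^sub>m n"
  "word_eval n A (Word (t # w)) = A ! t * word_eval n A (Word w)"
  by (simp_all add: word_eval_def)

lemma nc_eval_single:
  "i < n \<Longrightarrow> j < n \<Longrightarrow> nc_eval n A (Poly_Mapping.single w a) $$ (i, j) = a * word_eval n A w $$ (i, j)"
  by (cases "a = 0") (auto simp: nc_eval_index)

text \<open>
  The matrix over the free algebra whose kernel at \<open>A\<close> consists of the stacked intertwiners from
  \<open>C\<close> to \<open>A\<close>: row \<open>t d + j\<close> expresses that the \<open>j\<close>-th columns of \<open>A\<^sub>t X\<close> and \<open>X C\<^sub>t\<close> agree.
\<close>

definition intertwiner_equations :: "nat \<Rightarrow> nat \<Rightarrow> (nat \<Rightarrow> 'a::field mat) \<Rightarrow> 'a nc_poly mat" where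
  "intertwiner_equations m d C = mat (m * d) d (\<lambda>(p, i).
     Poly_Mapping.single (Word [p div d]) (if p mod d = i then 1 else 0) +
     Poly_Mapping.single 0 (- C (p div d) $$ (i, p mod d)))"

lemma intertwiner_equations_carrier:
  "intertwiner_equations m d C \<in> carrier_mat (m * d) d"
  "elements_mat (intertwiner_equations m d C) \<subseteq> carrier (free_algebra m)"
proof -
  show "intertwiner_equations m d C \<in> carrier_mat (m * d) d" by (simp add: intertwiner_equations_def)
  have "Poly_Mapping.single (Word [t]) a + Poly_Mapping.single 0 b \<in> carrier (free_algebra m)" if "t < m"
    for t and a b :: 'a
  proof -
    have "Poly_Mapping.keys (Poly_Mapping.single (Word [t]) a + Poly_Mapping.single 0 b) \<subseteq> {Word [t], 0}"
      using Poly_Mapping.keys_add[of "Poly_Mapping.single (Word [t]) a" "Poly_Mapping.single 0 b"]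
      by (auto split: if_splits)
    then show ?thesis using that by (force simp: free_algebra_def zero_free_word_def)
  qed
  then show "elements_mat (intertwiner_equations m d C) \<subseteq> carrier (free_algebra m)"
    by (auto simp: elements_mat_def intertwiner_equations_def less_mult_imp_div_less)
qed

lemma sum_blocks: "(\<Sum>q<d * n. F q) = (\<Sum>i<d. \<Sum>c<n. F (i * n + c :: nat))"
proof -
  have "(\<Sum>c<n. F (i * n + c)) = sum F {i * n ..< i * n + n}" for i
    by (subst sum.atLeastLessThan_shift_0) (simp add: atLeast0LessThan)
  then show ?thesis by (simp add: sum.nat_group)
qed

lemma block_eval_carrier:
  "\<phi> \<in> carrier_mat k l \<Longrightarrow> block_eval n A \<phi> \<in> carrier_mat (k * n) (l * n)"
  by (simp add: block_eval_def)

lemma block_eval_index: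
  assumes "\<phi> \<in> carrier_mat k l" "p < k" "i < l" "r < n" "c < n"
  shows "block_eval n A \<phi> $$ (p * n + r, i * n + c) = nc_eval n A (\<phi> $$ (p, i)) $$ (r, c)"
  using assms stack_index[of p k r n] stack_index[of i l c n] by (auto simp: block_eval_def)

lemma intertwiner_equations_eval:
  fixes A :: "'a::field mat list"
  assumes A: "rep m n ((!) A)" and C: "rep m d C" and Z: "Z l \<in> carrier_mat n d"
    and t: "t < m" and j: "j < d" and r: "r < n" and l: "l < k"
  shows "(block_eval n A (intertwiner_equations m d C) * stack_family k n d Z) $$ ((t * d + j) * n + r, l) =
     (A ! t * Z l - Z l * C t) $$ (r, j)"
proof -
  let ?E = "intertwiner_equations m d C" and ?p = "t * d + j"
  note p = stack_index[OF t j]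
  note Ac = rep_dims[OF A t] and Cc = rep_dims[OF C t]
  have E: "nc_eval n A (?E $$ (?p, i)) $$ (r, c) =
     (if j = i then A ! t $$ (r, c) else 0) - C t $$ (i, j) * (if r = c then 1 else 0)"
    if i: "i < d" and c: "c < n" for i c
  proof -
    have w: "word_eval n A (Word [t]) = A ! t" "word_eval n A 0 = 1\<^sub>m n"
      using Ac by (simp_all add: word_eval_simps zero_free_word_def)
    have "?E $$ (?p, i) = Poly_Mapping.single (Word [t]) (if j = i then 1 else 0) +
        Poly_Mapping.single 0 (- C t $$ (i, j))"
      using p i by (simp add: intertwiner_equations_def)
    then show ?thesis
      using r c by (simp add: nc_eval_add nc_eval_single w carrier_matD[OF nc_eval_carrier])
  qed
  have S: "stack_family k n d Z $$ (i * n + c, l) = Z l $$ (c, i)" if "i < d" "c < n" for i c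
    using stack_index[OF that] l by (simp add: stack_family_def)
  have BE: "block_eval n A ?E \<in> carrier_mat (m * d * n) (d * n)"
    by (rule block_eval_carrier[OF intertwiner_equations_carrier(1)])
  have "(block_eval n A ?E * stack_family k n d Z) $$ (?p * n + r, l) =
     (\<Sum>q<d * n. block_eval n A ?E $$ (?p * n + r, q) * stack_family k n d Z $$ (q, l))"
    using BE l stack_index(1)[OF p(1) r]
    by (subst index_mult_sum) (auto simp: stack_family_def)
  also have "\<dots> = (\<Sum>i<d. \<Sum>c<n. ((if j = i then A ! t $$ (r, c) else 0) -
      C t $$ (i, j) * (if r = c then 1 else 0)) * Z l $$ (c, i))"
    unfolding sum_blocks
    by (intro sum.cong refl) (simp add: block_eval_index[OF intertwiner_equations_carrier(1) p(1) _ r] E S)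
  also have "\<dots> = (\<Sum>i<d. (if j = i then (\<Sum>c<n. A ! t $$ (r, c) * Z l $$ (c, i)) else 0) - C t $$ (i, j) * Z l $$ (r, i))"
  proof (intro sum.cong refl)
    fix i
    have "(\<Sum>c<n. ((if j = i then A ! t $$ (r, c) else 0) - C t $$ (i, j) * (if r = c then 1 else 0)) * Z l $$ (c, i)) =
       (\<Sum>c<n. (if j = i then A ! t $$ (r, c) * Z l $$ (c, i) else 0) - (if r = c then C t $$ (i, j) * Z l $$ (c, i) else 0))"
      by (intro sum.cong) (auto simp: algebra_simps)
    then show "(\<Sum>c<n. ((if j = i then A ! t $$ (r, c) else 0) - C t $$ (i, j) * (if r = c then 1 else 0)) * Z l $$ (c, i)) =
       (if j = i then (\<Sum>c<n. A ! t $$ (r, c) * Z l $$ (c, i)) else 0) - C t $$ (i, j) * Z l $$ (r, i)"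
      using r by (simp add: sum_subtractf)
  qed
  also have "\<dots> = (\<Sum>c<n. A ! t $$ (r, c) * Z l $$ (c, j)) - (\<Sum>i<d. Z l $$ (r, i) * C t $$ (i, j))"
    using j by (simp add: sum_subtractf mult.commute)
  also have "(\<Sum>c<n. A ! t $$ (r, c) * Z l $$ (c, j)) = (A ! t * Z l) $$ (r, j)"
    using Z Ac r j by (subst index_mult_sum) auto
  also have "(\<Sum>i<d. Z l $$ (r, i) * C t $$ (i, j)) = (Z l * C t) $$ (r, j)"
    using Z Cc r j by (subst index_mult_sum) auto
  finally show ?thesis using Z Cc r j by (simp del: index_mult_mat(1))
qed

lemma intertwiner_equations_kernel:
  fixes A :: "'a::field mat list"
  assumes A: "rep m n ((!) A)" and C: "rep m d C" and Z: "\<And>l. l < k \<Longrightarrow> Z l \<in> carrier_mat n d"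
  shows "block_eval n A (intertwiner_equations m d C) * stack_family k n d Z = 0\<^sub>m (m * d * n) k \<longleftrightarrow>
     (\<forall>l<k. Z l \<in> homs m d C n ((!) A))" (is "?M = _ \<longleftrightarrow> _")
proof
  assume 0: "?M = 0\<^sub>m (m * d * n) k"
  show "\<forall>l<k. Z l \<in> homs m d C n ((!) A)"
  proof (intro allI impI homsI)
    fix l t assume l: "l < k" and t: "t < m"
    show "A ! t * Z l = Z l * C t"
    proof (rule eq_matI)
      fix r j assume "r < dim_row (Z l * C t)" "j < dim_col (Z l * C t)"
      then have rj: "r < n" "j < d" using Z[OF l] rep_dims[OF C t] by auto
      have "(A ! t * Z l - Z l * C t) $$ (r, j) = 0"
        unfolding intertwiner_equations_eval[where Z = Z, OF A C Z[OF l] t rj(2,1) l, symmetric] 0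
        using stack_index(1)[OF stack_index(1)[OF t rj(2)] rj(1)] l by simp
      then show "(A ! t * Z l) $$ (r, j) = (Z l * C t) $$ (r, j)"
        using rj Z[OF l] rep_dims[OF C t] by (simp del: index_mult_mat(1))
    qed (use Z[OF l] rep_dims[OF C t] rep_dims[OF A t] in auto)
  qed (use Z in auto)
next
  assume h: "\<forall>l<k. Z l \<in> homs m d C n ((!) A)"
  have E: "block_eval n A (intertwiner_equations m d C) \<in> carrier_mat (m * d * n) (d * n)"
    by (rule block_eval_carrier[OF intertwiner_equations_carrier(1)])
  show "?M = 0\<^sub>m (m * d * n) k"
  proof (rule eq_matI)
    fix q l assume "q < dim_row (0\<^sub>m (m * d * n) k :: 'a mat)" "l < dim_col (0\<^sub>m (m * d * n) k :: 'a mat)"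
    then have q: "q < m * d * n" and l: "l < k" by auto
    let ?p = "q div n" let ?r = "q mod n" let ?t = "?p div d" let ?j = "?p mod d"
    note 1 = unstack_index[OF q] note 2 = unstack_index[OF 1(2)]
    have tt: "A ! ?t * Z l = Z l * C ?t" using h l homs_eq 2(2) by blast
    have "?M $$ (q, l) = ?M $$ ((?t * d + ?j) * n + ?r, l)" using 1(3) 2(3) by simp
    also have "\<dots> = (A ! ?t * Z l - Z l * C ?t) $$ (?r, ?j)"
      by (rule intertwiner_equations_eval[where Z = Z, OF A C Z[OF l] 2(2,1) 1(1) l])
    also have "\<dots> = 0" unfolding tt using Z[OF l] rep_dims[OF C 2(2)] 1(1) 2(1) by simp
    finally show "?M $$ (q, l) = 0\<^sub>m (m * d * n) k $$ (q, l)" using q l by simp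
  qed (use E in \<open>auto simp: stack_family_def\<close>)
qed

text \<open>
  By rank and nullity, an inequality of ranks is the reverse inequality of the dimensions of kernels.
\<close>

lemma kernel_family_transfer:
  fixes M N :: "'a::field mat"
  assumes M: "M \<in> carrier_mat p q" and N: "N \<in> carrier_mat p q"
    and rk: "vec_space.rank p N \<le> vec_space.rank p M"
    and W: "W \<in> carrier_mat q k" "L \<in> carrier_mat k q" "L * W = 1\<^sub>m k" "M * W = 0\<^sub>m p k"
  shows "\<exists>W' L'. W' \<in> carrier_mat q k \<and> L' \<in> carrier_mat k q \<and> L' * W' = 1\<^sub>m k \<and> N * W' = 0\<^sub>m p k"
proof -
  define r where "r = vec_space.rank p M"
  define s where "s = vec_space.rank p N"
  obtain P Q K R where f: "P \<in> carrier_mat p r" "Q \<in> carrier_mat r q" "K \<in> carrier_mat r p"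
     "R \<in> carrier_mat q r" "M = P * Q" "K * P = 1\<^sub>m r" "Q * R = 1\<^sub>m r"
    using rank_factorization_rank[OF M] unfolding r_def[symmetric] by blast
  obtain P' Q' K' R' where g: "P' \<in> carrier_mat p s" "Q' \<in> carrier_mat s q" "K' \<in> carrier_mat s p"
     "R' \<in> carrier_mat q s" "N = P' * Q'" "K' * P' = 1\<^sub>m s" "Q' * R' = 1\<^sub>m s"
    using rank_factorization_rank[OF N] unfolding s_def[symmetric] by blast
  obtain e Y V where s: "split_mats q r e R Q Y V" using complement_exists[OF f(4,2,7)] by blast
  obtain e' Y' V' where s': "split_mats q s e' R' Q' Y' V'" using complement_exists[OF g(4,2,7)] by blast
  note sD = split_matsD[OF s] and sD' = split_matsD[OF s']
  have "k \<le> e"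
  proof (rule left_invertible_le)
    show "V * W \<in> carrier_mat e k" using sD W by auto
    show "L * Y \<in> carrier_mat k e" using sD W by auto
    have "Q * W = K * (M * W)"
      using f(1-3) W(1) unfolding f(5) by (simp add: mat_ring mult_absorb[OF f(6)])
    then have QW: "Q * W = 0\<^sub>m r k" using f(3) unfolding W(4) by simp
    have "W = (R * Q + Y * V) * W" using sD(9) W(1) by simp
    also have "\<dots> = R * (Q * W) + Y * (V * W)" using sD(1-4) W(1) by (simp add: mat_ring)
    also have "\<dots> = Y * (V * W)" using sD(1-4) W(1) unfolding QW by (simp add: add_zero_dim)
    finally have YVW: "W = Y * (V * W)" .
    have "(L * Y) * (V * W) = L * (Y * (V * W))" using sD(3,4) W(1,2) by (simp add: mat_ring)
    then show "(L * Y) * (V * W) = 1\<^sub>m k" unfolding YVW[symmetric] W(3) .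
  qed
  moreover have "e \<le> e'" using split_mats_dim[OF s] split_mats_dim[OF s'] rk by (simp add: r_def s_def)
  ultimately have ke: "k \<le> e'" by simp
  define W' where "W' = mat q k (\<lambda>(i, j). Y' $$ (i, j))"
  define L' where "L' = mat k q (\<lambda>(i, j). V' $$ (i, j))"
  have c: "W' \<in> carrier_mat q k" "L' \<in> carrier_mat k q" by (simp_all add: W'_def L'_def)
  have "L' * W' = 1\<^sub>m k"
  proof (rule eq_matI)
    fix i j assume "i < dim_row (1\<^sub>m k :: 'a mat)" "j < dim_col (1\<^sub>m k :: 'a mat)"
    then have ij: "i < k" "j < k" by auto
    have "(L' * W') $$ (i, j) = (\<Sum>l<q. V' $$ (i, l) * Y' $$ (l, j))"
      using ij c by (subst index_mult_sum) (auto simp: W'_def L'_def)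
    also have "\<dots> = (V' * Y') $$ (i, j)"
      using ij ke sD'(3,4) by (subst index_mult_sum) auto
    finally show "(L' * W') $$ (i, j) = 1\<^sub>m k $$ (i, j)" using ij ke unfolding sD'(6) by simp
  qed (use c in auto)
  moreover have "N * W' = 0\<^sub>m p k"
  proof (rule eq_matI)
    have NY: "N * Y' = 0\<^sub>m p e'"
      using g(1,2) sD'(3,8) unfolding g(5) by (simp add: mat_ring)
    fix i j assume "i < dim_row (0\<^sub>m p k :: 'a mat)" "j < dim_col (0\<^sub>m p k :: 'a mat)"
    then have ij: "i < p" "j < k" by auto
    have "(N * W') $$ (i, j) = (\<Sum>l<q. N $$ (i, l) * Y' $$ (l, j))"
      using ij c N by (subst index_mult_sum) (auto simp: W'_def)
    also have "\<dots> = (N * Y') $$ (i, j)"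
      using ij ke sD'(3) N by (subst index_mult_sum) auto
    finally show "(N * W') $$ (i, j) = 0\<^sub>m p k $$ (i, j)" using ij ke unfolding NY by simp
  qed (use c N in auto)
  ultimately show ?thesis using c by blast
qed

text \<open>
  The families of intertwiners from \<open>C\<close> are the families in the kernel of \<open>intertwiner_equations\<close>,
  evaluated at \<open>A\<close> or at \<open>B\<close>.
\<close>

theorem hom_le_imp_dominated:
  fixes A B :: "'a::field mat list"
  assumes A: "rep m n ((!) A)" and B: "rep m n ((!) B)" and m: "m \<ge> 1" and h: "hom_le n m A B"
  shows "hom_dominated m n ((!) A) ((!) B)"
  unfolding hom_dominated_def
proof (intro allI impI)
  fix d C k and Z :: "nat \<Rightarrow> 'a mat"
  assume C: "rep m d C" and Z: "\<forall>i<k. Z i \<in> homs m d C n ((!) A)" and ind: "indep k n d Z"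
  show "\<exists>Z'. (\<forall>i<k. Z' i \<in> homs m d C n ((!) B)) \<and> indep k n d Z'"
  proof (cases "k = 0")
    case True
    then show ?thesis by (auto simp: indep_def)
  next
    case False
    then have d: "d \<ge> 1" using indep_bound[OF ind] by (cases d) auto
    let ?E = "intertwiner_equations m d C"
    have md: "m * d \<ge> 1" using m d by simp
    have rk: "vec_space.rank (m * d * n) (block_eval n B ?E) \<le> vec_space.rank (m * d * n) (block_eval n A ?E)"
      using h md d intertwiner_equations_carrier[of m d C] unfolding hom_le_def by blast
    have Zc: "Z l \<in> carrier_mat n d" if "l < k" for l using Z that homs_carrier by blast
    have ker: "block_eval n A ?E * stack_family k n d Z = 0\<^sub>m (m * d * n) k"
    proof -
      have "?thesis \<longleftrightarrow> (\<forall>l<k. Z l \<in> homs m d C n ((!) A))"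
        by (rule intertwiner_equations_kernel[OF A C]) (rule Zc)
      then show ?thesis using Z by simp
    qed
    obtain L where L: "L \<in> carrier_mat k (d * n)" "L * stack_family k n d Z = 1\<^sub>m k"
      using indep_left_inverse[OF ind] by blast
    have Sc: "stack_family k n d Z \<in> carrier_mat (d * n) k" for Z :: "nat \<Rightarrow> 'a mat" by (simp add: stack_family_def)
    note bc = block_eval_carrier[OF intertwiner_equations_carrier(1)]
    obtain W' L' where W': "W' \<in> carrier_mat (d * n) k" "L' \<in> carrier_mat k (d * n)" "L' * W' = 1\<^sub>m k"
        "block_eval n B ?E * W' = 0\<^sub>m (m * d * n) k"
      using kernel_family_transfer[OF bc bc rk Sc L ker] by blast
    define Z' where "Z' l = mat n d (\<lambda>(r, j). W' $$ (j * n + r, l))" for l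
    have SZ: "stack_family k n d Z' = W'"
    proof (rule eq_matI)
      fix q l assume "q < dim_row W'" "l < dim_col W'"
      then have q: "q < d * n" "l < k" using W' by auto
      show "stack_family k n d Z' $$ (q, l) = W' $$ (q, l)"
        using q unstack_index[OF q(1)] by (simp add: stack_family_def Z'_def)
    qed (use W' in \<open>auto simp: stack_family_def\<close>)
    have "\<forall>i<k. Z' i \<in> homs m d C n ((!) B)"
    proof -
      have "block_eval n B ?E * stack_family k n d Z' = 0\<^sub>m (m * d * n) k \<longleftrightarrow>
          (\<forall>i<k. Z' i \<in> homs m d C n ((!) B))"
        by (rule intertwiner_equations_kernel[OF B C]) (simp add: Z'_def)
      then show ?thesis using W'(4) unfolding SZ by simp
    qed
    moreover have "indep k n d Z'"
      unfolding indep_def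
    proof (rule allI, rule impI)
      fix a assume 0: "lin_comb k a Z' n d = 0\<^sub>m n d"
      let ?v = "vec k a"
      have "lin_comb k (\<lambda>l. ?v $ l) Z' n d = lin_comb k a Z' n d" by (rule lin_comb_cong) auto
      then have "W' *\<^sub>v ?v = 0\<^sub>v (d * n)"
        using stack_family_kernel[of ?v k n d Z'] 0 unfolding SZ by simp
      then have "(L' * W') *\<^sub>v ?v = 0\<^sub>v k"
        using assoc_mult_mat_vec[OF W'(2,1), of ?v] mult_mat_zero_vec[OF W'(2)] by simp
      then have v0: "?v = 0\<^sub>v k" unfolding W'(3) by simp
      show "\<forall>i<k. a i = 0"
        using arg_cong[OF v0, of "\<lambda>x. x $ i" for i] by (metis index_vec index_zero_vec(1))
    qed
    ultimately show ?thesis by blast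
  qed
qed

section \<open>Degenerations lower ranks\<close>

lemma word_eval_carrier:
  assumes "rep m n ((!) A)" "set ws \<subseteq> {..<m}"
  shows "word_eval n A (Word ws) \<in> carrier_mat n n"
  using assms(2)
proof (induction ws)
  case (Cons t ws)
  then show ?case using assms(1) by (auto simp: word_eval_simps rep_def intro!: mult_carrier_mat[of _ n n])
qed (simp add: word_eval_simps)

lemma word_eval_conj:
  assumes A: "rep m n ((!) A)" "length A = m" and ws: "set ws \<subseteq> {..<m}"
    and g: "g \<in> carrier_mat n n" "h \<in> carrier_mat n n" "g * h = 1\<^sub>m n" "h * g = 1\<^sub>m n"
  shows "word_eval n (map (\<lambda>X. g * X * h) A) (Word ws) = g * word_eval n A (Word ws) * h"
  using ws
proof (induction ws)
  case Nil
  then show ?case using g by (simp add: word_eval_simps)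
next
  case (Cons t ws)
  then have t: "t < m" and ws: "set ws \<subseteq> {..<m}" by auto
  note D = rep_dims[OF A(1) t] carrier_matD[OF word_eval_carrier[OF A(1) ws]] carrier_matD[OF g(1)] carrier_matD[OF g(2)]
  show ?case
    using Cons.IH[OF ws] t A(2) by (simp add: word_eval_simps mat_ring D mult_absorb[OF g(4)])
qed

lemma free_algebra_letters:
  "f \<in> carrier (free_algebra m) \<Longrightarrow> w \<in> Poly_Mapping.keys f \<Longrightarrow> set (letters w) \<subseteq> {..<m}"
  by (auto simp: free_algebra_def)

lemma index_triple_product:
  assumes "g \<in> carrier_mat n n" "M \<in> carrier_mat n n" "h \<in> carrier_mat n n" "i < n" "j < n"
  shows "(g * M * h) $$ (i, j) = (\<Sum>b<n. \<Sum>a<n. g $$ (i, a) * M $$ (a, b) * (h $$ (b, j) :: 'a::comm_ring_1))"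
proof -
  have "(g * M * h) $$ (i, j) = (\<Sum>b<n. (g * M) $$ (i, b) * h $$ (b, j))"
    using assms by (subst index_mult_sum) auto
  also have "\<dots> = (\<Sum>b<n. (\<Sum>a<n. g $$ (i, a) * M $$ (a, b)) * h $$ (b, j))"
    using assms by (intro sum.cong refl) (subst index_mult_sum, auto)
  finally show ?thesis by (simp add: sum_distrib_right)
qed

lemma nc_eval_conj:
  assumes A: "rep m n ((!) A)" "length A = m" and f: "f \<in> carrier (free_algebra m)"
    and g: "g \<in> carrier_mat n n" "h \<in> carrier_mat n n" "g * h = 1\<^sub>m n" "h * g = 1\<^sub>m n"
  shows "nc_eval n (map (\<lambda>X. g * X * h) A) f = g * nc_eval n A f * h"
proof (rule eq_matI)
  fix i j assume "i < dim_row (g * nc_eval n A f * h)" "j < dim_col (g * nc_eval n A f * h)"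
  then have ij: "i < n" "j < n" using g by auto
  have W: "word_eval n A w \<in> carrier_mat n n"
    "word_eval n (map (\<lambda>X. g * X * h) A) w = g * word_eval n A w * h" if "w \<in> Poly_Mapping.keys f" for w
    using word_eval_carrier[OF A(1), of "letters w"] word_eval_conj[OF A _ g, of "letters w"]
      free_algebra_letters[OF f that] by simp_all
  let ?l = "Poly_Mapping.lookup f"
  have "nc_eval n (map (\<lambda>X. g * X * h) A) f $$ (i, j) =
     (\<Sum>w \<in> Poly_Mapping.keys f. ?l w * (\<Sum>b<n. \<Sum>a<n. g $$ (i, a) * word_eval n A w $$ (a, b) * h $$ (b, j)))"
    unfolding nc_eval_index[OF ij]
    by (intro sum.cong refl) (simp only: W index_triple_product[OF g(1) W(1) g(2) ij])
  also have "\<dots> = (\<Sum>b<n. \<Sum>w \<in> Poly_Mapping.keys f. \<Sum>a<n. ?l w * (g $$ (i, a) * word_eval n A w $$ (a, b) * h $$ (b, j)))"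
    by (subst sum.swap) (simp add: sum_distrib_left)
  also have "\<dots> = (\<Sum>b<n. \<Sum>a<n. g $$ (i, a) * nc_eval n A f $$ (a, b) * h $$ (b, j))"
  proof (intro sum.cong refl)
    fix b assume "b \<in> {..<n}"
    then show "(\<Sum>w \<in> Poly_Mapping.keys f. \<Sum>a<n. ?l w * (g $$ (i, a) * word_eval n A w $$ (a, b) * h $$ (b, j))) =
        (\<Sum>a<n. g $$ (i, a) * nc_eval n A f $$ (a, b) * h $$ (b, j))"
      by (subst sum.swap) (auto simp: nc_eval_index sum_distrib_left sum_distrib_right ac_simps intro!: sum.cong)
  qed
  also have "\<dots> = (g * nc_eval n A f * h) $$ (i, j)"
    by (rule index_triple_product[symmetric, OF g(1) nc_eval_carrier g(2) ij])
  finally show "nc_eval n (map (\<lambda>X. g * X * h) A) f $$ (i, j) = (g * nc_eval n A f * h) $$ (i, j)" .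
qed (use g carrier_matD[OF nc_eval_carrier] in auto)

definition block_diag :: "nat \<Rightarrow> nat \<Rightarrow> 'a::comm_ring_1 mat \<Rightarrow> 'a mat" where
  "block_diag n k g = mat (k * n) (k * n) (\<lambda>(p, q). if p div n = q div n then g $$ (p mod n, q mod n) else 0)"

lemma block_diag_index:
  assumes "i < k" "r < n" "j < k" "c < n"
  shows "block_diag n k g $$ (i * n + r, j * n + c) = (if i = j then g $$ (r, c) else 0)"
  using stack_index[OF assms(1,2)] stack_index[OF assms(3,4)] by (simp add: block_diag_def)

lemma block_eval_conj:
  fixes A :: "'a::field mat list"
  assumes A: "rep m n ((!) A)" "length A = m" and \<phi>: "\<phi> \<in> carrier_mat k l"
    "elements_mat \<phi> \<subseteq> carrier (free_algebra m)"
    and g: "g \<in> carrier_mat n n" "h \<in> carrier_mat n n" "g * h = 1\<^sub>m n" "h * g = 1\<^sub>m n"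
  shows "block_eval n (map (\<lambda>X. g * X * h) A) \<phi> = block_diag n k g * block_eval n A \<phi> * block_diag n l h"
    (is "?L = ?R")
proof (rule eq_matI)
  note bc = block_eval_carrier[OF \<phi>(1)]
  have dc: "block_diag n k g \<in> carrier_mat (k * n) (k * n)" for k and g :: "'a mat"
    by (simp add: block_diag_def)
  show "dim_row ?L = dim_row ?R" "dim_col ?L = dim_col ?R"
    using carrier_matD[OF bc] carrier_matD[OF dc] by simp_all
  fix p q assume "p < dim_row ?R" "q < dim_col ?R"
  then have "p < k * n" "q < l * n" using carrier_matD[OF dc] by simp_all
  then obtain i r j c where p: "p = i * n + r" "i < k" "r < n" and q: "q = j * n + c" "j < l" "c < n"
    using unstack_index by metis
  have el: "\<phi> $$ (i, j) \<in> carrier (free_algebra m)"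
    using \<phi>(2) elements_matI[OF \<phi>(1) p(2) q(2) refl] by blast
  have G: "(block_diag n k g * block_eval n A \<phi>) $$ (p, j * n + b) =
      (\<Sum>a<n. g $$ (r, a) * nc_eval n A (\<phi> $$ (i, j)) $$ (a, b))" if b: "b < n" for b
  proof -
    have "(block_diag n k g * block_eval n A \<phi>) $$ (p, j * n + b) =
      (\<Sum>s<k * n. block_diag n k g $$ (p, s) * block_eval n A \<phi> $$ (s, j * n + b))"
      using bc[of n A] dc[of k g] p q(2) b stack_index(1)[OF p(2,3)] stack_index(1)[OF q(2) b]
      by (subst index_mult_sum) auto
    also have "\<dots> = (\<Sum>i'<k. \<Sum>a<n. (if i = i' then g $$ (r, a) * nc_eval n A (\<phi> $$ (i', j)) $$ (a, b) else 0))"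
      unfolding sum_blocks p(1)
      by (intro sum.cong refl) (simp add: block_diag_index p(2,3) block_eval_index[OF \<phi>(1)] q(2) b)
    also have "\<dots> = (\<Sum>i'<k. if i = i' then (\<Sum>a<n. g $$ (r, a) * nc_eval n A (\<phi> $$ (i', j)) $$ (a, b)) else 0)"
      by (intro sum.cong refl) auto
    finally show ?thesis using p(2) by simp
  qed
  have "?R $$ (p, q) = (\<Sum>s<l * n. (block_diag n k g * block_eval n A \<phi>) $$ (p, s) * block_diag n l h $$ (s, q))"
    using bc[of n A] dc[of k g] dc[of l h] p(1) q(1) stack_index(1)[OF p(2,3)] stack_index(1)[OF q(2,3)]
    by (subst index_mult_sum) auto
  also have "\<dots> = (\<Sum>j'<l. \<Sum>b<n. (if j' = j then (block_diag n k g * block_eval n A \<phi>) $$ (p, j' * n + b) * h $$ (b, c) else 0))"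
    unfolding sum_blocks q(1) by (intro sum.cong refl) (simp add: block_diag_index q(2,3))
  also have "\<dots> = (\<Sum>j'<l. if j' = j then (\<Sum>b<n. (block_diag n k g * block_eval n A \<phi>) $$ (p, j' * n + b) * h $$ (b, c)) else 0)"
    by (intro sum.cong refl) auto
  also have "\<dots> = (\<Sum>b<n. \<Sum>a<n. g $$ (r, a) * nc_eval n A (\<phi> $$ (i, j)) $$ (a, b) * h $$ (b, c))"
    using q(2) by (simp add: G sum_distrib_right)
  also have "\<dots> = nc_eval n (map (\<lambda>X. g * X * h) A) (\<phi> $$ (i, j)) $$ (r, c)"
    unfolding nc_eval_conj[OF A el g]
    by (rule index_triple_product[symmetric, OF g(1) nc_eval_carrier g(2) p(3) q(3)])
  also have "\<dots> = ?L $$ (p, q)"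
    unfolding p(1) q(1) by (rule block_eval_index[symmetric, OF \<phi>(1) p(2) q(2) p(3) q(3)])
  finally show "?L $$ (p, q) = ?R $$ (p, q)" by simp
qed

lemma poly_fun_word_eval:
  assumes "set ws \<subseteq> {..<m}" "i < n" "j < n"
  shows "poly_fun n m (\<lambda>X. word_eval n X (Word ws) $$ (i, j) :: 'a::field)"
  using assms
proof (induction ws arbitrary: i j)
  case Nil
  then show ?case by (simp add: word_eval_simps poly_fun_const)
next
  case (Cons t ws)
  have "poly_fun n m (\<lambda>X. \<Sum>k<n. X ! t $$ (i, k) * word_eval n X (Word ws) $$ (k, j) :: 'a)"
    using Cons by (intro poly_fun_sum poly_fun_mult poly_fun_entry) auto
  moreover have "word_eval n X (Word (t # ws)) $$ (i, j) =
      (\<Sum>k<n. X ! t $$ (i, k) * word_eval n X (Word ws) $$ (k, j) :: 'a)" if "X \<in> mat_tuples n m" for X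
  proof -
    have r: "rep m n ((!) X)" using that by (simp add: mat_tuples_rep)
    then show ?thesis
      using Cons.prems rep_dims[OF r, of t] carrier_matD[OF word_eval_carrier[OF r, of ws]]
      unfolding word_eval_simps by (subst index_mult_sum) auto
  qed
  ultimately show ?case using poly_fun_cong by (metis (no_types, lifting))
qed

lemma poly_fun_block_eval:
  assumes \<phi>: "\<phi> \<in> carrier_mat k l" "elements_mat \<phi> \<subseteq> carrier (free_algebra m)"
    and p: "p < k * n" and q: "q < l * n"
  shows "poly_fun n m (\<lambda>X. block_eval n X \<phi> $$ (p, q) :: 'a::field)"
proof -
  let ?f = "\<phi> $$ (p div n, q div n)"
  note P = unstack_index[OF p] and Q = unstack_index[OF q]
  have f: "?f \<in> carrier (free_algebra m)" using \<phi>(2) elements_matI[OF \<phi>(1) P(2) Q(2) refl] by blast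
  have "block_eval n X \<phi> $$ (p, q) =
     (\<Sum>w \<in> Poly_Mapping.keys ?f. Poly_Mapping.lookup ?f w * word_eval n X w $$ (p mod n, q mod n))" for X :: "'a mat list"
    using \<phi>(1) p q P Q by (auto simp: block_eval_def nc_eval_index)
  moreover have "poly_fun n m (\<lambda>X. word_eval n X w $$ (p mod n, q mod n) :: 'a)" if "w \<in> Poly_Mapping.keys ?f" for w
    using poly_fun_word_eval[OF free_algebra_letters[OF f that] P(1) Q(1)] by simp
  ultimately show ?thesis
    by (simp add: poly_fun_sum poly_fun_mult poly_fun_const)
qed

lemma poly_fun_minor:
  assumes \<phi>: "\<phi> \<in> carrier_mat k l" "elements_mat \<phi> \<subseteq> carrier (free_algebra m)"
    and L: "L \<in> carrier_mat s (k * n)" and R: "R \<in> carrier_mat (l * n) s"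
  shows "poly_fun n m (\<lambda>X. det (L * block_eval n X \<phi> * R) :: 'a::field)"
proof -
  have c: "L * block_eval n X \<phi> * R \<in> carrier_mat s s" for X
    using L R block_eval_carrier[OF \<phi>(1), of n X] by (meson mult_carrier_mat)
  have "poly_fun n m (\<lambda>X. (L * block_eval n X \<phi> * R) $$ (i, j) :: 'a)" if ij: "i < s" "j < s" for i j
  proof -
    have "(L * block_eval n X \<phi> * R) $$ (i, j) =
      (\<Sum>q<l * n. (\<Sum>p<k * n. L $$ (i, p) * block_eval n X \<phi> $$ (p, q)) * R $$ (q, j))" for X
    proof -
      have "(L * block_eval n X \<phi> * R) $$ (i, j) =
        (\<Sum>q<l * n. (L * block_eval n X \<phi>) $$ (i, q) * R $$ (q, j))"
        using ij L R block_eval_carrier[OF \<phi>(1), of n X] by (subst index_mult_sum) auto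
      also have "\<dots> = (\<Sum>q<l * n. (\<Sum>p<k * n. L $$ (i, p) * block_eval n X \<phi> $$ (p, q)) * R $$ (q, j))"
        using ij L block_eval_carrier[OF \<phi>(1), of n X]
        by (intro sum.cong refl) (subst index_mult_sum, auto)
      finally show ?thesis .
    qed
    then show ?thesis
      by (simp only:) (intro poly_fun_sum poly_fun_mult poly_fun_const poly_fun_block_eval[OF \<phi>]; simp)
  qed
  then have "poly_fun n m (\<lambda>X. \<Sum>\<pi> | \<pi> permutes {0..<s}.
      signof \<pi> * (\<Prod>i = 0..<s. (L * block_eval n X \<phi> * R) $$ (i, \<pi> i)))"
    by (intro poly_fun_sum poly_fun_mult poly_fun_const poly_fun_prod)
       (auto dest: permutes_in_image)
  then show ?thesis by (simp add: det_def'[OF c])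
qed

text \<open>
  A rank factorisation of \<open>\<phi>(B)\<close> provides matrices \<open>L\<close>, \<open>R\<close> for which \<open>det (L \<phi>(X) R)\<close> is a polynomial
  in \<open>X\<close> that does not vanish at \<open>B\<close>. So it does not vanish at some \<open>X\<close> in the orbit of \<open>A\<close>. The size
  of this determinant is the rank of \<open>\<phi>(B)\<close>, and \<open>\<phi>(X)\<close> factors through the rank of \<open>\<phi>(A)\<close>.
\<close>

theorem deg_le_imp_hom_le:
  fixes A B :: "'a::field mat list"
  assumes A: "A \<in> mat_tuples n m" and B: "B \<in> mat_tuples n m" and deg: "deg_le n m A B"
  shows "hom_le n m A B"
  unfolding hom_le_def
proof (intro allI impI ballI)
  fix k l and \<phi> :: "'a nc_poly mat"
  assume \<phi>: "\<phi> \<in> carrier_mat k l" "elements_mat \<phi> \<subseteq> carrier (free_algebra m)"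
  note bc = block_eval_carrier[OF \<phi>(1)]
  have rA: "rep m n ((!) A)" "length A = m" using A by (auto simp: mat_tuples_rep)
  define r where "r = vec_space.rank (k * n) (block_eval n A \<phi>)"
  define s where "s = vec_space.rank (k * n) (block_eval n B \<phi>)"
  obtain P Q where f: "P \<in> carrier_mat (k * n) r" "Q \<in> carrier_mat r (l * n)" "block_eval n A \<phi> = P * Q"
    using rank_factorization_rank[OF bc, of n A] unfolding r_def[symmetric] by blast
  obtain P' Q' L R where h: "P' \<in> carrier_mat (k * n) s" "Q' \<in> carrier_mat s (l * n)" "L \<in> carrier_mat s (k * n)"
     "R \<in> carrier_mat (l * n) s" "block_eval n B \<phi> = P' * Q'" "L * P' = 1\<^sub>m s" "Q' * R = 1\<^sub>m s"
    using rank_factorization_rank[OF bc, of n B] unfolding s_def[symmetric] by blast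
  obtain p where p: "p \<in> entry_polys n m"
    "\<And>X. X \<in> mat_tuples n m \<Longrightarrow> det (L * block_eval n X \<phi> * R) = entry_poly_eval X p"
    using poly_fun_minor[OF \<phi> h(3,4)] unfolding poly_fun_def by blast
  have "L * block_eval n B \<phi> * R = 1\<^sub>m s"
    using h(1-4) unfolding h(5) by (simp add: mat_ring mult_absorb[OF h(6)] h(7))
  then have "entry_poly_eval B p \<noteq> 0" using p(2)[OF B] by simp
  then obtain X where X: "X \<in> conj_orbit n A" "entry_poly_eval X p \<noteq> 0"
    using deg p(1) unfolding deg_le_iff[OF B conj_orbit_tuples[OF A]] by blast
  then obtain g g' where g: "X = map (\<lambda>M. g * M * g') A" "g \<in> carrier_mat n n" "g' \<in> carrier_mat n n"
      "g * g' = 1\<^sub>m n" "g' * g = 1\<^sub>m n"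
    unfolding conj_orbit_def inverts_mat_def by auto
  let ?G = "block_diag n k g" and ?H = "block_diag n l g'"
  have GH: "?G \<in> carrier_mat (k * n) (k * n)" "?H \<in> carrier_mat (l * n) (l * n)" by (simp_all add: block_diag_def)
  let ?D = "L * block_eval n X \<phi> * R"
  have Dc: "?D \<in> carrier_mat s s" using h(3,4) bc[of n X] by (meson mult_carrier_mat)
  have "det ?D \<noteq> 0" using p(2) X conj_orbit_tuples[OF A] by auto
  then obtain N where N: "N \<in> carrier_mat s s" "N * ?D = 1\<^sub>m s"
    using det_non_zero_imp_unit[OF Dc] unfolding Units_def ring_mat_def by auto
  have XPQ: "block_eval n X \<phi> = ?G * (P * Q) * ?H"
    unfolding g(1) block_eval_conj[OF rA \<phi> g(2-5)] f(3) ..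
  have "(N * L * ?G * P) * (Q * ?H * R) = N * ?D"
    unfolding XPQ using N(1) h(3,4) GH f(1,2) by (simp add: mat_ring)
  then have "s \<le> r"
    using left_invertible_le[of "Q * ?H * R" r s "N * L * ?G * P"] N h(3,4) GH f(1,2)
    by (metis mult_carrier_mat)
  then show "vec_space.rank (k * n) (block_eval n B \<phi>) \<le> vec_space.rank (k * n) (block_eval n A \<phi>)"
    by (simp add: r_def s_def)
qed

section \<open>Composition series of length at most two\<close>

abbreviation range_mat :: "'a::field mat \<Rightarrow> nat \<Rightarrow> 'a vec set" where
  "range_mat P c \<equiv> (\<lambda>u. P *\<^sub>v u) ` carrier_vec c"

lemma word_eval_intertwine:
  assumes A: "rep m n ((!) A)" and C: "rep m c ((!) C)" and P: "P \<in> homs m c ((!) C) n ((!) A)"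
    and ws: "set ws \<subseteq> {..<m}"
  shows "word_eval n A (Word ws) * P = P * word_eval c C (Word ws)"
  using ws
proof (induction ws)
  case Nil
  then show ?case using homs_dims[OF P] by (simp add: word_eval_simps)
next
  case (Cons t ws)
  then have t: "t < m" and ws: "set ws \<subseteq> {..<m}" by auto
  note D = rep_dims[OF A t] rep_dims[OF C t] homs_dims[OF P]
    carrier_matD[OF word_eval_carrier[OF A ws]] carrier_matD[OF word_eval_carrier[OF C ws]]
  have "word_eval n A (Word (t # ws)) * P = A ! t * (P * word_eval c C (Word ws))"
    unfolding Cons.IH[OF ws, symmetric] by (simp add: word_eval_simps mat_ring D)
  also have "\<dots> = (A ! t * P) * word_eval c C (Word ws)" by (simp add: mat_ring D)
  also have "\<dots> = P * word_eval c C (Word (t # ws))"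
    unfolding homs_eq[OF P t] by (simp add: word_eval_simps mat_ring D)
  finally show ?case .
qed

lemma nc_eval_intertwine:
  assumes A: "rep m n ((!) A)" and C: "rep m c ((!) C)" and P: "P \<in> homs m c ((!) C) n ((!) A)"
    and f: "f \<in> carrier (free_algebra m)"
  shows "nc_eval n A f * P = P * nc_eval c C f"
proof (rule eq_matI)
  note D = homs_dims[OF P] carrier_matD[OF nc_eval_carrier]
  fix i j assume "i < dim_row (P * nc_eval c C f)" "j < dim_col (P * nc_eval c C f)"
  then have ij: "i < n" "j < c" using D by simp_all
  let ?l = "Poly_Mapping.lookup f"
  have W: "(\<Sum>k<n. word_eval n A w $$ (i, k) * P $$ (k, j)) = (\<Sum>k<c. P $$ (i, k) * word_eval c C w $$ (k, j))"
    if "w \<in> Poly_Mapping.keys f" for w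
  proof -
    note ws = free_algebra_letters[OF f that]
    have "(word_eval n A w * P) $$ (i, j) = (P * word_eval c C w) $$ (i, j)"
      using word_eval_intertwine[OF A C P ws] by simp
    then show ?thesis
      using ij D(1,2) word_eval_carrier[OF A ws] word_eval_carrier[OF C ws]
      by (subst (asm) (1 2) index_mult_sum) auto
  qed
  have "(nc_eval n A f * P) $$ (i, j) = (\<Sum>k<n. (\<Sum>w \<in> Poly_Mapping.keys f. ?l w * word_eval n A w $$ (i, k)) * P $$ (k, j))"
    using ij D(1,2) carrier_matD[OF nc_eval_carrier[of n A f]]
    by (subst index_mult_sum) (auto simp: nc_eval_index)
  also have "\<dots> = (\<Sum>w \<in> Poly_Mapping.keys f. ?l w * (\<Sum>k<n. word_eval n A w $$ (i, k) * P $$ (k, j)))"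
    unfolding sum_distrib_right sum_distrib_left by (subst sum.swap) (simp add: mult.assoc)
  also have "\<dots> = (\<Sum>w \<in> Poly_Mapping.keys f. ?l w * (\<Sum>k<c. P $$ (i, k) * word_eval c C w $$ (k, j)))"
    by (simp add: W)
  also have "\<dots> = (\<Sum>k<c. P $$ (i, k) * (\<Sum>w \<in> Poly_Mapping.keys f. ?l w * word_eval c C w $$ (k, j)))"
    unfolding sum_distrib_left by (subst sum.swap) (simp add: ac_simps)
  also have "\<dots> = (P * nc_eval c C f) $$ (i, j)"
    using ij D(1,2) carrier_matD[OF nc_eval_carrier[of c C f]]
    by (subst index_mult_sum) (auto simp: nc_eval_index)
  finally show "(nc_eval n A f * P) $$ (i, j) = (P * nc_eval c C f) $$ (i, j)" .
qed (simp_all add: homs_dims[OF P] carrier_matD[OF nc_eval_carrier])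

lemma range_mat_submodule:
  fixes A :: "'a::field mat list"
  assumes A: "A \<in> mat_tuples n m" and C: "rep m c C" and P: "P \<in> homs m c C n ((!) A)"
  shows "Module.submodule (range_mat P c) (free_algebra m :: 'a nc_poly ring) (rep_module n A)"
proof -
  have rA: "rep m n ((!) A)" using A by (simp add: mat_tuples_rep)
  let ?C = "map C [0..<m]"
  have C': "rep m c ((!) ?C)" using C by (auto simp: rep_def)
  have P': "P \<in> homs m c ((!) ?C) n ((!) A)" using P by (auto simp: homs_def)
  note Pc = homs_carrier[OF P]
  have sub: "range_mat P c \<subseteq> carrier_vec n" using Pc by auto
  show ?thesis
  proof (intro Module.submodule.intro subgroup.intro Module.submodule_axioms.intro)
    show "range_mat P c \<subseteq> carrier (add_monoid (rep_module n A))"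
      using sub by (simp add: rep_module_def)
    fix x assume "x \<in> range_mat P c"
    then obtain u where u: "u \<in> carrier_vec c" "x = P *\<^sub>v u" by blast
    show "x \<otimes>\<^bsub>add_monoid (rep_module n A)\<^esub> y \<in> range_mat P c" if y: "y \<in> range_mat P c" for y
    proof -
      obtain v where v: "v \<in> carrier_vec c" "y = P *\<^sub>v v" using y by blast
      have "x + y = P *\<^sub>v (u + v)" using u v Pc by (simp add: mult_add_distrib_mat_vec)
      then show ?thesis using u v by (auto simp: rep_module_def)
    qed
    have "inv\<^bsub>add_monoid (rep_module n A)\<^esub> x = P *\<^sub>v (- u)"
      unfolding m_inv_def
    proof (rule the_equality)
      have mx: "P *\<^sub>v (- u) = - x"
        using u Pc by (intro eq_vecI) auto
      have xc: "x \<in> carrier_vec n" using u Pc by auto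
      show "P *\<^sub>v (- u) \<in> carrier (add_monoid (rep_module n A)) \<and>
        x \<otimes>\<^bsub>add_monoid (rep_module n A)\<^esub> (P *\<^sub>v (- u)) = \<one>\<^bsub>add_monoid (rep_module n A)\<^esub> \<and>
        (P *\<^sub>v (- u)) \<otimes>\<^bsub>add_monoid (rep_module n A)\<^esub> x = \<one>\<^bsub>add_monoid (rep_module n A)\<^esub>"
        unfolding mx using xc by (auto simp: rep_module_def)
      fix y assume "y \<in> carrier (add_monoid (rep_module n A)) \<and>
        x \<otimes>\<^bsub>add_monoid (rep_module n A)\<^esub> y = \<one>\<^bsub>add_monoid (rep_module n A)\<^esub> \<and>
        y \<otimes>\<^bsub>add_monoid (rep_module n A)\<^esub> x = \<one>\<^bsub>add_monoid (rep_module n A)\<^esub>"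
      then have y: "y \<in> carrier_vec n" "x + y = 0\<^sub>v n" by (auto simp: rep_module_def)
      have "y = - x"
      proof (rule eq_vecI)
        fix i assume "i < dim_vec (- x)"
        then have i: "i < n" using xc by auto
        have "x $ i + y $ i = 0" using arg_cong[OF y(2), of "\<lambda>v. v $ i"] i xc y(1) by auto
        then show "y $ i = (- x) $ i" using i xc by (simp add: eq_neg_iff_add_eq_0 add.commute)
      qed (use xc y in auto)
      then show "y = P *\<^sub>v (- u)" using mx by simp
    qed
    then show "inv\<^bsub>add_monoid (rep_module n A)\<^esub> x \<in> range_mat P c" using u by auto
  next
    have "0\<^sub>v n = P *\<^sub>v 0\<^sub>v c" using mult_mat_zero_vec[OF Pc] by simp
    then show "\<one>\<^bsub>add_monoid (rep_module n A)\<^esub> \<in> range_mat P c" by (auto simp: rep_module_def)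
  next
    fix f :: "'a nc_poly" and x assume f: "f \<in> carrier (free_algebra m)" and x: "x \<in> range_mat P c"
    then obtain u where u: "u \<in> carrier_vec c" "x = P *\<^sub>v u" by blast
    have "nc_eval n A f *\<^sub>v x = (nc_eval n A f * P) *\<^sub>v u"
      unfolding u(2) by (rule assoc_mult_mat_vec[symmetric, OF nc_eval_carrier Pc u(1)])
    also have "\<dots> = P *\<^sub>v (nc_eval c ?C f *\<^sub>v u)"
      unfolding nc_eval_intertwine[OF rA C' P' f] by (rule assoc_mult_mat_vec[OF Pc nc_eval_carrier u(1)])
    also have "\<dots> \<in> range_mat P c" using mult_mat_vec_carrier[OF nc_eval_carrier u(1)] by blast
    finally show "f \<odot>\<^bsub>rep_module n A\<^esub> x \<in> range_mat P c" by (simp add: rep_module_def)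
  qed
qed

lemma submodule_range_mat:
  fixes A :: "'a::field mat list"
  assumes A: "A \<in> mat_tuples n m" and H: "Module.submodule H (free_algebra m :: 'a nc_poly ring) (rep_module n A)"
  shows "\<exists>c C P L. rep m c C \<and> P \<in> homs m c C n ((!) A) \<and> L \<in> carrier_mat c n \<and> L * P = 1\<^sub>m c \<and>
     H = range_mat P c"
proof -
  have rA: "rep m n ((!) A)" using A by (simp add: mat_tuples_rep)
  note sg = Module.submodule.axioms(1)[OF H]
  have Hc: "H \<subseteq> carrier_vec n" using subgroup.subset[OF sg] by (simp add: rep_module_def)
  have zero: "0\<^sub>v n \<in> H" using subgroup.one_closed[OF sg] by (simp add: rep_module_def)
  have add: "x + y \<in> H" if "x \<in> H" "y \<in> H" for x y
    using subgroup.m_closed[OF sg that] by (simp add: rep_module_def)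
  have act: "nc_eval n A f *\<^sub>v x \<in> H" if "f \<in> carrier (free_algebra m)" "x \<in> H" for f x
    using Module.submodule.smult_closed[OF H that] by (simp add: rep_module_def)
  have smult: "a \<cdot>\<^sub>v x \<in> H" if x: "x \<in> H" for a x
  proof -
    have xc: "x \<in> carrier_vec n" using x Hc by blast
    have "nc_eval n A (Poly_Mapping.single 0 a) = a \<cdot>\<^sub>m 1\<^sub>m n"
      by (rule eq_matI) (auto simp: nc_eval_single zero_free_word_def word_eval_simps carrier_matD[OF nc_eval_carrier])
    then have "nc_eval n A (Poly_Mapping.single 0 a) *\<^sub>v x = a \<cdot>\<^sub>v x" using xc by (intro eq_vecI) auto
    moreover have "Poly_Mapping.single 0 a \<in> carrier (free_algebra m)"
      by (auto simp: free_algebra_def zero_free_word_def)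
    ultimately show ?thesis using act x by metis
  qed
  have gen: "A ! t *\<^sub>v x \<in> H" if t: "t < m" and x: "x \<in> H" for t x
  proof -
    have "nc_eval n A (Poly_Mapping.single (Word [t]) 1) = A ! t"
      using rep_dims[OF rA t] by (intro eq_matI) (auto simp: nc_eval_single word_eval_simps carrier_matD[OF nc_eval_carrier])
    moreover have "Poly_Mapping.single (Word [t]) (1 :: 'a) \<in> carrier (free_algebra m)"
      using t by (auto simp: free_algebra_def)
    ultimately show ?thesis using act x by metis
  qed
  obtain c P L where P: "P \<in> carrier_mat n c" "L \<in> carrier_mat c n" "L * P = 1\<^sub>m c" and HP: "H = range_mat P c"
    using subspace_eq_range[OF Hc zero add smult] by blast
  have "\<exists>D \<in> carrier_mat c c. A ! t * P = P * D" if t: "t < m" for t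
  proof (rule cols_in_range[OF P(1)])
    have At: "A ! t \<in> carrier_mat n n" using rA t by (auto simp: rep_def)
    show "A ! t * P \<in> carrier_mat n c" using At P by auto
    fix j assume j: "j < c"
    have "col P j \<in> H" using col_range[OF P(1) j] HP by simp
    then show "col (A ! t * P) j \<in> range_mat P c"
      using gen[OF t] unfolding HP[symmetric] by (simp add: col_mult_vec[OF At P(1) j])
  qed
  then obtain C where C: "\<And>t. t < m \<Longrightarrow> C t \<in> carrier_mat c c" "\<And>t. t < m \<Longrightarrow> A ! t * P = P * C t" by metis
  have "rep m c C" "P \<in> homs m c C n ((!) A)" using C P by (auto simp: rep_def homs_def)
  then show ?thesis using P HP by blast
qed

lemma range_mat_psubset:
  fixes P P' :: "'a::field mat"
  assumes P: "P \<in> carrier_mat n a" and P': "P' \<in> carrier_mat n b" "L \<in> carrier_mat b n" "L * P' = 1\<^sub>m b"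
    and X: "X \<in> carrier_mat b a" "P = P' * X" and ab: "a < b"
  shows "range_mat P a \<subset> range_mat P' b"
proof
  have "P *\<^sub>v u = P' *\<^sub>v (X *\<^sub>v u)" if "u \<in> carrier_vec a" for u
    unfolding X(2) by (rule assoc_mult_mat_vec[OF P'(1) X(1) that])
  then show "range_mat P a \<subseteq> range_mat P' b" using mult_mat_vec_carrier[OF X(1)] by auto
  show "range_mat P a \<noteq> range_mat P' b"
  proof
    assume "range_mat P a = range_mat P' b"
    then obtain Q where Q: "Q \<in> carrier_mat a b" "P' = P * Q"
      using cols_in_range[OF P P'(1)] col_range[OF P'(1)] by blast
    have "(L * P) * Q = 1\<^sub>m b" using P P'(2,3) Q(1) unfolding Q(2) by (simp add: mat_ring)
    then have "b \<le> a" using left_invertible_le[OF Q(1)] P P'(2) by (metis mult_carrier_mat)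
    then show False using ab by simp
  qed
qed

lemma zero_range_mat: "{0\<^sub>v n} = range_mat (0\<^sub>m n 0 :: 'a::field mat) 0"
proof -
  have "0\<^sub>m n 0 *\<^sub>v u = 0\<^sub>v n" if "u \<in> carrier_vec 0" for u :: "'a vec"
    using that by (intro eq_vecI) (auto simp: scalar_prod_def)
  moreover have "(0\<^sub>v 0 :: 'a vec) \<in> carrier_vec 0" by simp
  ultimately show ?thesis by (metis (no_types, lifting) image_cong image_constant)
qed

lemma carrier_range_mat: "carrier_vec n = range_mat (1\<^sub>m n :: 'a::field mat) n"
  by force

lemma zero_psubset_range_mat:
  fixes P :: "'a::field mat"
  assumes "P \<in> carrier_mat n b" "L \<in> carrier_mat b n" "L * P = 1\<^sub>m b" "0 < b"
  shows "{0\<^sub>v n} \<subset> range_mat P b"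
  unfolding zero_range_mat
  by (rule range_mat_psubset[of _ n 0 P b L "0\<^sub>m b 0"]) (use assms in auto)

lemma range_mat_psubset_carrier:
  fixes P :: "'a::field mat"
  assumes "P \<in> carrier_mat n a" "a < n"
  shows "range_mat P a \<subset> carrier_vec n"
proof -
  have "range_mat P a \<subset> range_mat (1\<^sub>m n) n"
    by (rule range_mat_psubset[of P n a "1\<^sub>m n" n "1\<^sub>m n" P]) (use assms in auto)
  then show ?thesis by (simp only: carrier_range_mat[symmetric])
qed

text \<open>
  A proper nonzero subrepresentation of a composition factor would refine the composition series.
  For the upper factor \<open>D\<close> its preimage in \<open>A\<close> appears as the kernel of a map to a quotient of \<open>D\<close>.
\<close>

lemma composition_length_le_2:
  fixes A :: "'a::field mat list"
  assumes A: "A \<in> mat_tuples n m" and n: "n > 0"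
    and len: "composition_length (free_algebra m :: 'a nc_poly ring) (rep_module n A) \<le> 2"
  shows "simple_rep m n ((!) A) \<or>
    (\<exists>c C d D P L Y Q. ses m n ((!) A) c C d D P L Y Q \<and> simple_rep m c C \<and> simple_rep m d D)"
proof -
  let ?R = "free_algebra m :: 'a nc_poly ring" and ?M = "rep_module n A"
  have rA: "rep m n ((!) A)" using A by (simp add: mat_tuples_rep)
  have M: "carrier ?M = carrier_vec n" "\<zero>\<^bsub>?M\<^esub> = 0\<^sub>v n" by (simp_all add: rep_module_def)
  have "\<exists>Hs. composition_series ?R ?M Hs \<and> length Hs \<le> 3"
  proof (rule ccontr)
    assume no: "\<nexists>Hs. composition_series ?R ?M Hs \<and> length Hs \<le> 3"
    have "(3 :: enat) \<le> composition_length ?R ?M"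
      unfolding composition_length_def
    proof (rule INF_greatest)
      fix Hs assume "Hs \<in> {Hs. composition_series ?R ?M Hs}"
      then have "3 \<le> length Hs - 1" using no by force
      then show "(3 :: enat) \<le> enat (length Hs - 1)" by (simp add: numeral_eq_enat)
    qed
    then have "(3 :: enat) \<le> 2" using len by (rule order_trans)
    then show False by simp
  qed
  then obtain Hs where Hs: "composition_series ?R ?M Hs" "length Hs \<le> 3" by blast
  have hd: "Hs \<noteq> []" "hd Hs = {0\<^sub>v n}" "last Hs = carrier_vec n"
    and sub: "\<And>H. H \<in> set Hs \<Longrightarrow> Module.submodule H ?R ?M"
    and step: "\<And>i H. Suc i < length Hs \<Longrightarrow> Module.submodule H ?R ?M \<Longrightarrow> Hs ! i \<subset> H \<Longrightarrow> H \<subset> Hs ! Suc i \<Longrightarrow> False"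
    and strict: "\<And>i. Suc i < length Hs \<Longrightarrow> Hs ! i \<subset> Hs ! Suc i"
    using Hs(1) unfolding composition_series_def M by blast+
  have ne: "{0\<^sub>v n} \<noteq> (carrier_vec n :: 'a vec set)"
    using zero_psubset_range_mat[of "1\<^sub>m n" n n "1\<^sub>m n"] n unfolding carrier_range_mat[symmetric] by auto
  consider "length Hs = 1" | "length Hs = 2" | "length Hs = 3"
    using hd(1) Hs(2) by (cases Hs) (auto simp: le_Suc_eq numeral_3_eq_3 numeral_2_eq_2)
  then show ?thesis
  proof cases
    case 1
    then show ?thesis using hd ne by (cases Hs) auto
  next
    case 2
    have e: "Hs ! 0 = {0\<^sub>v n}" "Hs ! Suc 0 = carrier_vec n"
      using hd 2 by (simp_all add: hd_conv_nth last_conv_nth)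
    have "simple_rep m n ((!) A)"
      unfolding simple_rep_def
    proof (intro conjI allI impI)
      fix r I P L assume I: "rep m r I" "P \<in> homs m r I n ((!) A)" "L \<in> carrier_mat r n" "L * P = 1\<^sub>m r"
      note Pc = homs_carrier[OF I(2)]
      show "r = 0 \<or> r = n"
      proof (rule ccontr)
        assume "\<not> (r = 0 \<or> r = n)"
        then have r: "0 < r" "r < n" using left_invertible_le[OF Pc I(3,4)] by auto
        show False
          using step[of 0, OF _ range_mat_submodule[OF A I(1,2)]] e 2
            zero_psubset_range_mat[OF Pc I(3,4) r(1)] range_mat_psubset_carrier[OF Pc r(2)] by simp
      qed
    qed (use rA n in auto)
    then show ?thesis ..
  next
    case 3
    define H where "H = Hs ! Suc 0"
    have e: "Hs ! 0 = {0\<^sub>v n}" "Hs ! Suc (Suc 0) = carrier_vec n"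
      using hd 3 by (simp_all add: hd_conv_nth last_conv_nth numeral_2_eq_2)
    have Hsub: "Module.submodule H ?R ?M" using sub 3 unfolding H_def by simp
    have st: "{0\<^sub>v n} \<subset> H" "H \<subset> carrier_vec n"
      using strict[of 0] strict[of "Suc 0"] 3 e unfolding H_def by auto
    have low: "\<not> ({0\<^sub>v n} \<subset> G \<and> G \<subset> H)" and up: "\<not> (H \<subset> G \<and> G \<subset> carrier_vec n)"
      if "Module.submodule G ?R ?M" for G
      using step[of 0, OF _ that] step[of "Suc 0", OF _ that] 3 e unfolding H_def by auto
    obtain c C P L where C: "rep m c C" and P: "P \<in> homs m c C n ((!) A)" "L \<in> carrier_mat c n" "L * P = 1\<^sub>m c"
      and HP: "H = range_mat P c"
      using submodule_range_mat[OF A Hsub] by blast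
    note Pc = homs_carrier[OF P(1)]
    have c0: "c > 0"
    proof (rule ccontr)
      assume "\<not> c > 0"
      then have "P = 0\<^sub>m n 0" "c = 0" using Pc by auto
      then show False using st(1) zero_range_mat unfolding HP by auto
    qed
    obtain d Y Q where sp: "split_mats n c d P L Y Q" using complement_exists[OF Pc P(2,3)] by blast
    define D where "D t = Q * A ! t * Y" for t
    have ses: "ses m n ((!) A) c C d D P L Y Q"
      using ses_of_mono[OF sp P(1) C rA] unfolding D_def .
    note sd = sesD[OF ses] and s = split_matsD[OF sp]
    have d0: "d > 0"
    proof (rule ccontr)
      assume "\<not> d > 0"
      then have cn: "c = n" using sd(7) by simp
      then have PL: "P * L = 1\<^sub>m n" using mat_mult_left_right_inverse[of L n P] P Pc by simp
      have "v \<in> H" if v: "v \<in> carrier_vec n" for v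
      proof -
        have "v = P *\<^sub>v (L *\<^sub>v v)"
          using assoc_mult_mat_vec[OF Pc P(2) v] v unfolding PL by simp
        then show ?thesis unfolding HP using mult_mat_vec_carrier[OF P(2) v] by blast
      qed
      then show False using st(2) by blast
    qed
    have "simple_rep m c C"
      unfolding simple_rep_def
    proof (intro conjI allI impI)
      fix r I P1 L1 assume I: "rep m r I" "P1 \<in> homs m r I c C" "L1 \<in> carrier_mat r c" "L1 * P1 = 1\<^sub>m r"
      note P1c = homs_carrier[OF I(2)]
      show "r = 0 \<or> r = c"
      proof (rule ccontr)
        assume "\<not> (r = 0 \<or> r = c)"
        then have r: "0 < r" "r < c" using left_invertible_le[OF P1c I(3,4)] by auto
        have h: "P * P1 \<in> homs m r I n ((!) A)" by (rule homs_comp[OF I(2) P(1) I(1) C rA])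
        have "(L1 * L) * (P * P1) = 1\<^sub>m r"
          using I(3,4) P(2) Pc P1c by (simp add: mat_ring mult_absorb[OF P(3)])
        moreover have "L1 * L \<in> carrier_mat r n" using I(3) P(2) by simp
        ultimately have "{0\<^sub>v n} \<subset> range_mat (P * P1) r"
          using zero_psubset_range_mat[OF homs_carrier[OF h] _ _ r(1)] by blast
        moreover have "range_mat (P * P1) r \<subset> H"
          unfolding HP by (rule range_mat_psubset[OF homs_carrier[OF h] Pc P(2,3) P1c refl r(2)])
        ultimately show False using low[OF range_mat_submodule[OF A I(1) h]] by blast
      qed
    qed (use C c0 in auto)
    moreover have "simple_rep m d D"
      unfolding simple_rep_def
    proof (intro conjI allI impI)
      fix r I P1 L1 assume I: "rep m r I" "P1 \<in> homs m r I d D" "L1 \<in> carrier_mat r d" "L1 * P1 = 1\<^sub>m r"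
      note P1c = homs_carrier[OF I(2)]
      show "r = 0 \<or> r = d"
      proof (rule ccontr)
        assume "\<not> (r = 0 \<or> r = d)"
        then have r: "0 < r" "r < d" using left_invertible_le[OF P1c I(3,4)] by auto
        obtain e Y1 Q1 where sp1: "split_mats d r e P1 L1 Y1 Q1" using complement_exists[OF P1c I(3,4)] by blast
        define E where "E t = Q1 * D t * Y1" for t
        have ses1: "ses m d D r I e E P1 L1 Y1 Q1"
          using ses_of_mono[OF sp1 I(2,1) sd(4)] unfolding E_def .
        note sd1 = sesD[OF ses1] and s1 = split_matsD[OF sp1]
        have QQ: "Q1 * Q \<in> homs m n ((!) A) e E" by (rule homs_comp[OF sd(6) sd1(6) rA sd(4) sd1(4)])
        have QYY: "(Q1 * Q) * (Y * Y1) = 1\<^sub>m e"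
          using sd(8-) sd1(8-) s1(6) by (simp add: mat_ring mult_absorb[OF s(6)])
        have YY: "Y * Y1 \<in> carrier_mat n e" using s(3) s1(3) by simp
        obtain k P2 L2 where sp2: "split_mats n e k (Y * Y1) (Q1 * Q) P2 L2"
          using complement_exists[OF YY homs_carrier[OF QQ] QYY] by blast
        have ses2: "ses m n ((!) A) k (\<lambda>t. L2 * A ! t * P2) e E P2 L2 (Y * Y1) (Q1 * Q)"
          by (rule ses_of_epi[OF split_mats_sym[OF sp2] QQ sd1(4) rA])
        note sd2 = sesD[OF ses2] and s2 = split_matsD[OF split_mats_sym[OF sp2]]
        have k: "c < k" "k < n" using sd(7) sd1(7) sd2(7) r by simp_all
        have "(Q1 * Q) * P = 0\<^sub>m e c"
          using sd(8-) sd1(8-) s(7) by (simp add: mat_ring)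
        note l = ses_lift[OF ses2 P(1) C this]
        have "H \<subset> range_mat P2 k"
          unfolding HP by (rule range_mat_psubset[OF Pc s2(1,2,5) homs_carrier[OF l(1)] l(2) k(1)])
        moreover have "range_mat P2 k \<subset> carrier_vec n"
          by (rule range_mat_psubset_carrier[OF s2(1) k(2)])
        ultimately show False using up[OF range_mat_submodule[OF A sd2(3,5)]] by blast
      qed
    qed (use sd(4) d0 in auto)
    ultimately show ?thesis using ses by blast
  qed
qed

section \<open>Degeneration and hom order agree\<close>

lemma dominated_length_two_imp_deg_le:
  fixes A B :: "'a::alg_closed_field mat list"
  assumes A: "A \<in> mat_tuples n m" and B: "B \<in> mat_tuples n m" and dom: "hom_dominated m n ((!) A) ((!) B)"
    and ses: "ses m n ((!) A) c C d D P L Y Q" and C: "simple_rep m c C" and D: "simple_rep m d D"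
  shows "deg_le n m A B"
proof -
  have rB: "rep m n ((!) B)" using B by (simp add: mat_tuples_rep)
  from length_two_dichotomy[OF ses C D rB dom] show ?thesis
    using deg_le_of_iso[OF A B] deg_le_of_direct_sum[OF A B ses] by blast
qed

theorem corollary3p2:
  fixes A B :: "'a::alg_closed_field mat list" and n m :: nat
  assumes "n \<ge> 2" and "m \<ge> 1"
    and "A \<in> mat_tuples n m" and "B \<in> mat_tuples n m"
    and "composition_length (free_algebra m :: 'a nc_poly ring) (rep_module n A) \<le> 2 \<or>
         composition_length (free_algebra m :: 'a nc_poly ring) (rep_module n B) \<le> 2"
  shows "deg_le n m A B \<longleftrightarrow> hom_le n m A B"
proof
  note A = assms(3) and B = assms(4)
  show "hom_le n m A B" if "deg_le n m A B" by (rule deg_le_imp_hom_le[OF A B that])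
  assume hom: "hom_le n m A B"
  have rA: "rep m n ((!) A)" and rB: "rep m n ((!) B)" using A B by (simp_all add: mat_tuples_rep)
  have n: "n > 0" using assms(1) by simp
  have dom: "hom_dominated m n ((!) A) ((!) B)"
    by (rule hom_le_imp_dominated[OF rA rB assms(2) hom])
  from assms(5) show "deg_le n m A B"
  proof
    assume "composition_length (free_algebra m :: 'a nc_poly ring) (rep_module n A) \<le> 2"
    from composition_length_le_2[OF A n this] show ?thesis
      using dominated_simple_source[OF _ rB dom] deg_le_of_iso[OF A B]
        dominated_length_two_imp_deg_le[OF A B dom] by blast
  next
    assume "composition_length (free_algebra m :: 'a nc_poly ring) (rep_module n B) \<le> 2"
    from composition_length_le_2[OF B n this] show ?thesis
    proof
      assume "simple_rep m n ((!) B)"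
      then show ?thesis using dominated_simple_target[OF _ rA dom] deg_le_of_iso[OF A B] by blast
    next
      assume "\<exists>c C d D P L Y Q. ses m n ((!) B) c C d D P L Y Q \<and> simple_rep m c C \<and> simple_rep m d D"
      then show ?thesis
        using length_two_inherited[OF _ _ _ rA dom] dominated_length_two_imp_deg_le[OF A B dom] by blast
    qed
  qed
qed

end
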